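(* Consider $p=p_n\to\infty$ as $n\to\infty$. For each $n$ let $X_i=AX_{i-1}+\boldsymbol\varepsilon_i$ be the stationary $p$-dimensional VAR(1) process with transition matrix $A\in\mathbb R^{p\times p}$, $\lambda_{\max}(A)<1$, and $\boldsymbol\varepsilon_i=(\varepsilon_{i1},\dots,\varepsilon_{ip})^\top$ with $\varepsilon_{ij}$ i.i.d. over $i\in\mathbb Z$, $1\le j\le p$; $X_0,X_1,\dots,X_n$ are observed. Assume: (B1) $\mathbb E\varepsilon_{ij}=0$, $\mathbb E\varepsilon_{ij}^2=1$, and $\max_{1\le j\le p}\|X_{ij}\|_q=\mu_q<\infty$ for some $q>2$; (B2) $\mu_q\gamma\tau s^2[(\log p)/n]^{(q-2)/(2q-2)}\to0$. Choose $\nu\asymp\mu_q(n/\log p)^{1/(2q-2)}$, and let $$\hat A=\arg\min_{D\in\mathbb R^{p\times p}}\frac1n\sum_{i=1}^n|\tilde X_i-D\tilde X_{i-1}|_2^2+\lambda|D|_1$$ with $\lambda\asymp\mu_q\gamma\tau(\|A\|_\infty+1)[(\log p)/n]^{(q-2)/(2q-2)}$ (suitable implicit constants in both choices). Then there are constants $c,C>0$, not depending on $n$ and $p$, such that for all sufficiently large $n$, with probability at least $1-8p^{-c}$, $$\|\hat A-A\|_\infty\le C\mu_q\gamma\tau(\|A\|_\infty+1)\,s\Big(\frac{\log p}n\Big)^{\frac12-\frac1{2q-2}}.$$ If, further, (B2') $\mu_q\gamma\tau\mathcal S^2[(\log p)/n]^{(q-2)/(2q-2)}\to0$ holds, then also,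 with constants $c,C'>0$ and for all sufficiently large $n$, with probability at least $1-8p^{-c}$, $$\|\hat A-A\|_F\le C'\mu_q\gamma\tau(\|A\|_\infty+1)\sqrt{\mathcal S}\Big(\frac{\log p}n\Big)^{\frac12-\frac1{2q-2}}.$$
   Context: $\lambda_{\max}(A)$ is the spectral radius. Fix a universal constant $0<\rho_0<1$ and set $\tau=\min\{k\in\mathbb Z^+:\|A^k\|\le\rho_0\}$ and $\gamma=\rho_0^{-1}\max_{0\le k\le\tau-1}\|A^k\|$ ($\|\cdot\|$ the spectral norm), so that $\|A^k\|\le\gamma\rho_0^{k/\tau}$ for all $k\ge0$; it is assumed that $\tau\le n$. $\tilde X_i=\phi_\nu(X_i)$ is the componentwise truncation with $\phi_\nu(x)=(x\wedge\nu)\vee(-\nu)$. With $\boldsymbol a_{j\cdot}^\top$ the $j$-th row of $A$, $s_j=|\mathrm{supp}(\boldsymbol a_{j\cdot})|$, $s=\max_{1\le j\le p}s_j$, $\mathcal S=\sum_{j=1}^ps_j$. For a matrix $D=(d_{ij})$: $|D|_1=\sum_{i,j}|d_{ij}|$, $\|D\|_\infty=\max_i\sum_j|d_{ij}|$, $\|D\|_F$ is the Frobenius norm. $\|X\|_q=(\mathbb E|X|^q)^{1/q}$. $a_n\asymp b_n$ means that $a_n/b_n$ is bounded above and below by positive constants. *)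

theory Defs
  imports "HOL-Probability.Probability" "Jordan_Normal_Form.Spectral_Radius"
begin

unbundle no vec_syntax

text \<open>
  The dimension \<open>p\<close> grows with the sample size, so vectors and matrices are the carrier-based ones of
  \<open>Jordan_Normal_Form\<close>; coordinates \<open>1, \<dots>, p\<close> become indices \<open>j < p\<close>.
\<close>

section \<open>Vector and matrix norms\<close>

definition vec_l2 :: "real vec \<Rightarrow> real" where
  "vec_l2 v = sqrt (\<Sum>i<dim_vec v. (v $ i)\<^sup>2)"

definition spectral_norm :: "real mat \<Rightarrow> real" where
  "spectral_norm D = (SUP v\<in>{v \<in> carrier_vec (dim_col D). vec_l2 v = 1}. vec_l2 (D *\<^sub>v v))"

definition mat_l1 :: "real mat \<Rightarrow> real" where
  "mat_l1 D = (\<Sum>i<dim_row D. \<Sum>j<dim_col D. \<bar>D $$ (i, j)\<bar>)"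

definition mat_linf :: "real mat \<Rightarrow> real" where
  "mat_linf D = Max ((\<lambda>i. \<Sum>j<dim_col D. \<bar>D $$ (i, j)\<bar>) ` {..<dim_row D})"

definition mat_frob :: "real mat \<Rightarrow> real" where
  "mat_frob D = sqrt (\<Sum>i<dim_row D. \<Sum>j<dim_col D. (D $$ (i, j))\<^sup>2)"

section \<open>Parameters of the transition matrix\<close>

definition tau :: "real \<Rightarrow> real mat \<Rightarrow> nat" where
  "tau \<rho>\<^sub>0 A = (LEAST k. 1 \<le> k \<and> spectral_norm (A ^\<^sub>m k) \<le> \<rho>\<^sub>0)"

definition gam :: "real \<Rightarrow> real mat \<Rightarrow> real" where
  "gam \<rho>\<^sub>0 A = inverse \<rho>\<^sub>0 * Max ((\<lambda>k. spectral_norm (A ^\<^sub>m k)) ` {0..tau \<rho>\<^sub>0 A - 1})"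

definition row_supp :: "real mat \<Rightarrow> nat \<Rightarrow> nat" where
  "row_supp A j = card {k. k < dim_col A \<and> A $$ (j, k) \<noteq> 0}"

definition max_supp :: "real mat \<Rightarrow> nat" where
  "max_supp A = Max (row_supp A ` {..<dim_row A})"

definition total_supp :: "real mat \<Rightarrow> nat" where
  "total_supp A = (\<Sum>j<dim_row A. row_supp A j)"

section \<open>The VAR(1) process\<close>

definition iid :: "'a measure \<Rightarrow> (int \<Rightarrow> nat \<Rightarrow> 'a \<Rightarrow> real) \<Rightarrow> bool" where
  "iid M \<epsilon> \<longleftrightarrow>
     prob_space.indep_vars M (\<lambda>_. borel) (\<lambda>(i, j). \<epsilon> i j) UNIV \<and>
     (\<forall>i j. distr M borel (\<epsilon> i j) = distr M borel (\<epsilon> 0 0))"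

definition process_law :: "'a measure \<Rightarrow> nat \<Rightarrow> (int \<Rightarrow> 'a \<Rightarrow> real vec) \<Rightarrow> (int \<times> nat \<Rightarrow> real) measure" where
  "process_law M p X =
     distr M (\<Pi>\<^sub>M _\<in>UNIV \<times> {..<p}. borel) (\<lambda>\<omega>. \<lambda>(i, j)\<in>UNIV \<times> {..<p}. X i \<omega> $ j)"

text \<open>Stationarity is strict stationarity of the two-sided process.\<close>

definition stationary_VAR1 ::
  "'a measure \<Rightarrow> nat \<Rightarrow> real mat \<Rightarrow> (int \<Rightarrow> nat \<Rightarrow> 'a \<Rightarrow> real) \<Rightarrow> (int \<Rightarrow> 'a \<Rightarrow> real vec) \<Rightarrow> bool" where
  "stationary_VAR1 M p A \<epsilon> X \<longleftrightarrow>
     (\<forall>i. \<forall>\<omega>\<in>space M. X i \<omega> \<in> carrier_vec p) \<and>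
     (\<forall>i. \<forall>j<p. (\<lambda>\<omega>. X i \<omega> $ j) \<in> borel_measurable M) \<and>
     (\<forall>i. AE \<omega> in M. X i \<omega> = A *\<^sub>v X (i - 1) \<omega> + vec p (\<lambda>j. \<epsilon> i j \<omega>)) \<and>
     (\<forall>h. process_law M p (\<lambda>i. X (i + h)) = process_law M p X)"

definition Lq_norm :: "'a measure \<Rightarrow> real \<Rightarrow> ('a \<Rightarrow> real) \<Rightarrow> real" where
  "Lq_norm M q Y = (\<integral>\<omega>. \<bar>Y \<omega>\<bar> powr q \<partial>M) powr (1 / q)"

text \<open>
  The Bochner integral of a non-integrable function is 0, so finiteness of the \<open>L\<^sup>q\<close> norms is stated as
  integrability. By stationarity the maximum does not depend on \<open>i\<close>.
\<close>

definition max_coord_moment :: "'a measure \<Rightarrow> real \<Rightarrow> nat \<Rightarrow> (int \<Rightarrow> 'a \<Rightarrow> real vec) \<Rightarrow> real \<Rightarrow> bool" where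
  "max_coord_moment M q p X \<mu> \<longleftrightarrow>
     (\<forall>i. (\<forall>j<p. integrable M (\<lambda>\<omega>. \<bar>X i \<omega> $ j\<bar> powr q)) \<and>
          Max ((\<lambda>j. Lq_norm M q (\<lambda>\<omega>. X i \<omega> $ j)) ` {..<p}) = \<mu>)"

section \<open>The robust Lasso estimator\<close>

definition trunc :: "real \<Rightarrow> real \<Rightarrow> real" where
  "trunc \<nu> x = max (min x \<nu>) (- \<nu>)"

definition lasso_objective :: "nat \<Rightarrow> real \<Rightarrow> real \<Rightarrow> (int \<Rightarrow> real vec) \<Rightarrow> real mat \<Rightarrow> real" where
  "lasso_objective n \<nu> lam x D =
     (1 / real n) *
       (\<Sum>i\<in>{1..int n}. (vec_l2 (map_vec (trunc \<nu>) (x i) - D *\<^sub>v map_vec (trunc \<nu>) (x (i - 1))))\<^sup>2)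
     + lam * mat_l1 D"

text \<open>The minimiser need not be unique; this says that \<open>Ahat\<close> is one of them.\<close>

definition is_lasso :: "nat \<Rightarrow> nat \<Rightarrow> real \<Rightarrow> real \<Rightarrow> (int \<Rightarrow> real vec) \<Rightarrow> real mat \<Rightarrow> bool" where
  "is_lasso n p \<nu> lam x Ahat \<longleftrightarrow>
     is_arg_min (lasso_objective n \<nu> lam x) (\<lambda>D. D \<in> carrier_mat p p) Ahat"

section \<open>Asymptotic and probabilistic vocabulary\<close>

text \<open>\<open>f \<asymp> g\<close> with the implicit constants \<open>a\<close> (below) and \<open>b\<close> (above) made explicit.\<close>

definition asymp_between :: "real \<Rightarrow> real \<Rightarrow> (nat \<Rightarrow> real) \<Rightarrow> (nat \<Rightarrow> real) \<Rightarrow> bool" where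
  "asymp_between a b f g \<longleftrightarrow> (\<forall>\<^sub>F n in sequentially. a * g n \<le> f n \<and> f n \<le> b * g n)"

text \<open>
  For an arbitrary selection of minimisers the event in question need not be measurable, hence the
  event inside it; for a measurable \<open>P\<close> this is the plain inequality between probabilities.
\<close>

definition with_prob_at_least :: "'a measure \<Rightarrow> real \<Rightarrow> ('a \<Rightarrow> bool) \<Rightarrow> bool" where
  "with_prob_at_least M r P \<longleftrightarrow> (\<exists>E\<in>sets M. r \<le> measure M E \<and> (\<forall>\<omega>\<in>E. P \<omega>))"

end

theory Submission
  imports Defs
begin

text \<open>
  On the event that all truncated empirical covariances of lag 0 and 1 are within
  \<open>\<delta> = K \<mu> \<gamma> \<tau> (ln p / n) powr ((q - 2) / (2 * q - 2))\<close> of the true ones, the Lasso analysis is deterministic and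
  separates over the rows: \<open>\<lambda> \<ge> 4 \<delta> (\<parallel>A\<parallel> + 1)\<close> dominates the score, and since the covariance matrix of the
  stationary law is bounded below by the identity (the variance of the innovations), \<open>32 s \<delta> \<le> 1\<close> gives the
  restricted eigenvalue condition.

  For the deviation of a truncated empirical covariance, the partial sum is made a martingale by the conditional
  expectations of the remaining summands given the current state. Replacing one innovation by an independent copy
  changes the summand \<open>m\<close> steps later by at most \<open>2 \<nu>\<^sup>2\<close>, and in mean square by
  \<open>O (\<nu>\<^sup>2 \<gamma>\<^sup>2 \<rho> powr (2 * m))\<close> with \<open>\<rho> = \<rho>\<^sub>0 powr (1 / \<tau>)\<close>. Summing the \<open>r\<close>-th moments over \<open>m\<close> with geometric
  weights costs a factor \<open>r powr r / (1 - \<rho>) powr r\<close>, which is exactly what a Bernstein bound with variance proxy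
  \<open>O (n \<nu>\<^sup>2 \<gamma>\<^sup>2 \<tau>\<^sup>2)\<close> tolerates. The dependence on the initial state costs the same as \<open>\<tau> \<le> n\<close> innovations.

  The truncation bias is \<open>O (\<mu>\<^sup>2)\<close> times the rate, and a Rosenthal-type bound on the moving average representation
  shows \<open>\<mu> = O (\<gamma> \<tau>)\<close>.
\<close>

section \<open>Matrix norms and powers\<close>

text \<open>After truncation a summand is bounded by \<nu>^2 and Lipschitz with constant \<nu>, but
  an innovation has only q moments. Its influence m steps later is therefore known in two ways: by a
  bound that does not decay in m, and by a second moment that does. Adding the bounds over all later
  summands would give n \<nu>^2, far too much for a Bernstein exponent; so moments are added, and in
  the moment of order r the bound enters with power r - 2 and the decaying second moment once. The
  constants are uniform in n because one array \<epsilon> drives all the processes: they depend on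
  \<rho>_0, q and the q-th moment of one innovation, while \<gamma>, \<tau> and \<mu> stay explicit.
  The bound on \<mu> has two uses: it turns the bias \<mu>^2 L, with L = (ln p / n)^((q-2)/(2q-2)),
  into a multiple of \<mu> \<gamma> \<tau> L, and for A = 0, where (B2) says nothing, it keeps the
  exponential parameter admissible. The truncation level is balanced so that \<nu>^2 ln p has the
  order \<mu>^2 n L^2; then fluctuation and bias both scale with L.\<close>

lemma vec_l2_smult: "vec_l2 (c \<cdot>\<^sub>v v) = \<bar>c\<bar> * vec_l2 v"
  unfolding vec_l2_def
  by (simp add: power_mult_distrib sum_distrib_left[symmetric] real_sqrt_mult)

lemma vec_l2_nonneg: "0 \<le> vec_l2 v"
  unfolding vec_l2_def by (simp add: sum_nonneg)

lemma abs_index_le_vec_l2: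
  assumes "i < dim_vec v" shows "\<bar>v $ i\<bar> \<le> vec_l2 v"
proof -
  have "(v $ i)\<^sup>2 \<le> (\<Sum>i<dim_vec v. (v $ i)\<^sup>2)"
    using assms by (intro member_le_sum) auto
  then show ?thesis unfolding vec_l2_def by (simp add: real_le_rsqrt)
qed

lemma vec_l2_le_sum_abs: "vec_l2 v \<le> (\<Sum>i<dim_vec v. \<bar>v $ i\<bar>)"
  unfolding vec_l2_def
  using L2_set_le_sum_abs[of "\<lambda>i. v $ i" "{..<dim_vec v}"] by (simp add: L2_set_def)

text \<open>Crude, but it makes the set in \<open>spectral_norm\<close> bounded above, without which
  a real supremum has no useful value. It also lets entrywise convergence of the powers carry over
  to the norm.\<close>

lemma vec_l2_mult_le_entries:
  assumes "v \<in> carrier_vec (dim_col D)" "vec_l2 v = 1"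
  shows "vec_l2 (D *\<^sub>v v) \<le> (\<Sum>i<dim_row D. \<Sum>j<dim_col D. \<bar>D $$ (i, j)\<bar>)"
proof -
  have "vec_l2 (D *\<^sub>v v) \<le> (\<Sum>i<dim_row D. \<bar>(D *\<^sub>v v) $ i\<bar>)"
    using vec_l2_le_sum_abs[of "D *\<^sub>v v"] by simp
  also have "\<dots> \<le> (\<Sum>i<dim_row D. \<Sum>j<dim_col D. \<bar>D $$ (i, j)\<bar>)"
  proof (rule sum_mono)
    fix i assume i: "i \<in> {..<dim_row D}"
    have "\<bar>(D *\<^sub>v v) $ i\<bar> = \<bar>\<Sum>j<dim_col D. D $$ (i, j) * v $ j\<bar>"
      using i assms by (auto simp: scalar_prod_def lessThan_atLeast0 intro!: sum.cong)
    also have "\<dots> \<le> (\<Sum>j<dim_col D. \<bar>D $$ (i, j)\<bar> * \<bar>v $ j\<bar>)"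
      by (rule order_trans[OF sum_abs]) (simp add: abs_mult)
    also have "\<dots> \<le> (\<Sum>j<dim_col D. \<bar>D $$ (i, j)\<bar> * 1)"
      using assms abs_index_le_vec_l2[of _ v] by (intro sum_mono mult_left_mono) auto
    finally show "\<bar>(D *\<^sub>v v) $ i\<bar> \<le> (\<Sum>j<dim_col D. \<bar>D $$ (i, j)\<bar>)" by simp
  qed
  finally show ?thesis .
qed

lemma vec_l2_mult_le:
  assumes v: "v \<in> carrier_vec (dim_col D)"
  shows "vec_l2 (D *\<^sub>v v) \<le> spectral_norm D * vec_l2 v"
proof (cases "vec_l2 v = 0")
  case True
  have "v $ i = 0" if "i < dim_vec v" for i
    using abs_index_le_vec_l2[OF that] True by simp
  then have "v = 0\<^sub>v (dim_col D)" using v by (intro eq_vecI) auto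
  then have "D *\<^sub>v v = 0\<^sub>v (dim_row D)" by (auto simp: scalar_prod_def)
  then show ?thesis using True by (simp add: vec_l2_def)
next
  case False
  let ?c = "vec_l2 v" let ?u = "(1 / ?c) \<cdot>\<^sub>v v"
  have pos: "?c > 0" using False vec_l2_nonneg[of v] by simp
  have u: "?u \<in> carrier_vec (dim_col D)" "vec_l2 ?u = 1"
    using v pos by (auto simp: vec_l2_smult)
  have "vec_l2 (D *\<^sub>v ?u) \<le> spectral_norm D" unfolding spectral_norm_def
  proof (rule cSUP_upper)
    show "?u \<in> {v \<in> carrier_vec (dim_col D). vec_l2 v = 1}" using u by simp
    show "bdd_above ((\<lambda>v. vec_l2 (D *\<^sub>v v)) ` {v \<in> carrier_vec (dim_col D). vec_l2 v = 1})"
      using vec_l2_mult_le_entries[of _ D] by (intro bdd_aboveI2) auto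
  qed
  moreover have "D *\<^sub>v ?u = (1 / ?c) \<cdot>\<^sub>v (D *\<^sub>v v)"
    using v by (intro mult_mat_vec) auto
  ultimately have "(1 / ?c) * vec_l2 (D *\<^sub>v v) \<le> spectral_norm D"
    using pos by (simp add: vec_l2_smult)
  then show ?thesis using pos by (simp add: field_simps)
qed

lemma vec_l2_unit_vec: "0 < p \<Longrightarrow> vec_l2 (unit_vec p 0) = 1"
proof -
  have "(\<Sum>i<p. (unit_vec p 0 $ i)\<^sup>2) = (\<Sum>i<p. if i = 0 then (1::real) else 0)"
    by (intro sum.cong) auto
  then show "0 < p \<Longrightarrow> vec_l2 (unit_vec p 0) = 1" unfolding vec_l2_def by simp
qed

text \<open>The dimension is positive so that the unit sphere is non-empty and the supremum over it
  is a least upper bound.\<close>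

lemma spectral_norm_le:
  assumes "0 < dim_col D"
    and "\<And>v. v \<in> carrier_vec (dim_col D) \<Longrightarrow> vec_l2 v = 1 \<Longrightarrow> vec_l2 (D *\<^sub>v v) \<le> B"
  shows "spectral_norm D \<le> B"
  unfolding spectral_norm_def
proof (rule cSUP_least)
  have "vec_l2 (unit_vec (dim_col D) 0) = 1"
    using assms(1) by (rule vec_l2_unit_vec)
  then show "{v \<in> carrier_vec (dim_col D). vec_l2 v = 1} \<noteq> {}"
    using unit_vec_carrier[of "dim_col D" 0] by blast
qed (use assms(2) in auto)

lemma spectral_norm_nonneg:
  assumes "0 < dim_col D" shows "0 \<le> spectral_norm D"
proof -
  have 1: "vec_l2 (unit_vec (dim_col D) 0) = 1"
    using assms(1) by (rule vec_l2_unit_vec)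
  show ?thesis
    using vec_l2_mult_le[of "unit_vec (dim_col D) 0" D] vec_l2_nonneg[of "D *\<^sub>v unit_vec (dim_col D) 0"]
    unfolding 1 by simp
qed

lemma spectral_norm_mult_le:
  assumes "B \<in> carrier_mat p p" "C \<in> carrier_mat p p" "0 < p"
  shows "spectral_norm (B * C) \<le> spectral_norm B * spectral_norm C"
proof (rule spectral_norm_le)
  fix v assume v: "v \<in> carrier_vec (dim_col (B * C))" "vec_l2 v = 1"
  have "vec_l2 (B * C *\<^sub>v v) = vec_l2 (B *\<^sub>v (C *\<^sub>v v))"
    using assms v by (subst assoc_mult_mat_vec[of B p p C p]) auto
  also have "\<dots> \<le> spectral_norm B * vec_l2 (C *\<^sub>v v)"
    using assms v by (intro vec_l2_mult_le) auto
  also have "\<dots> \<le> spectral_norm B * (spectral_norm C * vec_l2 v)"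
    using assms v by (intro mult_left_mono vec_l2_mult_le spectral_norm_nonneg) auto
  finally show "vec_l2 (B * C *\<^sub>v v) \<le> spectral_norm B * spectral_norm C" using v by simp
qed (use assms in auto)

lemma spectral_norm_one: 
  assumes "0 < p" shows "spectral_norm (1\<^sub>m p) = 1"
proof (rule antisym)
  show "spectral_norm (1\<^sub>m p) \<le> 1" using assms by (intro spectral_norm_le) auto
  have 1: "vec_l2 (unit_vec p 0) = 1"
    using assms(1) by (rule vec_l2_unit_vec)
  show "1 \<le> spectral_norm (1\<^sub>m p)"
    using vec_l2_mult_le[of "unit_vec p 0" "1\<^sub>m p"] by (simp add: 1)
qed

text \<open>Apply B to its own i-th row: coordinate i of the image is the squared length of the row,
  and dividing by the length gives the bound. Whole rows of the powers are thus controlled without a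
  factor p.\<close>

lemma row_sq_le_spectral_norm:
  assumes B: "B \<in> carrier_mat p p" and i: "i < p"
  shows "(\<Sum>k<p. (B $$ (i, k))\<^sup>2) \<le> (spectral_norm B)\<^sup>2"
proof -
  let ?S = "\<Sum>k<p. (B $$ (i, k))\<^sup>2"
  have S0: "?S \<ge> 0" by (simp add: sum_nonneg)
  have l: "vec_l2 (row B i) = sqrt ?S" using B i by (simp add: vec_l2_def)
  have "?S = (B *\<^sub>v row B i) $ i"
    using B i by (auto simp: scalar_prod_def power2_eq_square lessThan_atLeast0 intro!: sum.cong)
  also have "\<dots> \<le> vec_l2 (B *\<^sub>v row B i)"
    using abs_index_le_vec_l2[of i "B *\<^sub>v row B i"] B i by simp
  also have "\<dots> \<le> spectral_norm B * sqrt ?S"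
    using vec_l2_mult_le[of "row B i" B] B i by (simp add: l)
  finally have *: "?S \<le> spectral_norm B * sqrt ?S" .
  have "sqrt ?S \<le> spectral_norm B"
  proof (cases "?S = 0")
    case True then show ?thesis using spectral_norm_nonneg[of B] B i by auto
  next
    case False
    then have "sqrt ?S > 0" using S0 by simp
    moreover have "sqrt ?S * sqrt ?S \<le> spectral_norm B * sqrt ?S" using * S0 by simp
    ultimately show ?thesis by (metis mult_le_cancel_right_pos)
  qed
  then show ?thesis using S0 by (metis real_sqrt_ge_zero power_mono real_sqrt_pow2)
qed

lemma spectral_norm_le_entries:
  assumes "0 < dim_col D"
  shows "spectral_norm D \<le> (\<Sum>i<dim_row D. \<Sum>j<dim_col D. \<bar>D $$ (i, j)\<bar>)"
  using assms vec_l2_mult_le_entries by (intro spectral_norm_le) auto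

section \<open>Decay of matrix powers when the spectral radius is below 1\<close>

lemma pow_mat_smult:
  fixes A :: "'a::comm_ring_1 mat"
  assumes A: "A \<in> carrier_mat p p"
  shows "(t \<cdot>\<^sub>m A) ^\<^sub>m k = t ^ k \<cdot>\<^sub>m (A ^\<^sub>m k)"
proof (induction k)
  case 0 then show ?case by (intro eq_matI) auto
next
  case (Suc k)
  have Ak: "A ^\<^sub>m k \<in> carrier_mat p p" using A by simp
  have "(t \<cdot>\<^sub>m A) ^\<^sub>m Suc k = (t ^ k \<cdot>\<^sub>m (A ^\<^sub>m k)) * (t \<cdot>\<^sub>m A)" using Suc by simp
  also have "\<dots> = t ^ k \<cdot>\<^sub>m (t \<cdot>\<^sub>m (A ^\<^sub>m k * A))"
    using A Ak by (simp add: mult_smult_assoc_mat[OF Ak, of _ p] mult_smult_distrib[OF Ak A])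
  also have "\<dots> = t ^ Suc k \<cdot>\<^sub>m (A ^\<^sub>m Suc k)" by (intro eq_matI) auto
  finally show ?case .
qed

lemma eigenvalue_smult:
  fixes A :: "complex mat"
  assumes A: "A \<in> carrier_mat p p" and t: "t \<noteq> 0" and e: "eigenvalue (t \<cdot>\<^sub>m A) x"
  shows "eigenvalue A (x / t)"
proof -
  obtain v where v: "v \<in> carrier_vec p" "v \<noteq> 0\<^sub>v p" "(t \<cdot>\<^sub>m A) *\<^sub>v v = x \<cdot>\<^sub>v v"
    using e A unfolding eigenvalue_def eigenvector_def by auto
  have "A *\<^sub>v v = (x / t) \<cdot>\<^sub>v v"
  proof (rule eq_vecI)
    fix i assume i: "i < dim_vec ((x / t) \<cdot>\<^sub>v v)"
    then have i': "i < p" using v by simp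
    have "((t \<cdot>\<^sub>m A) *\<^sub>v v) $ i = (x \<cdot>\<^sub>v v) $ i" using v(3) by simp
    moreover have "((t \<cdot>\<^sub>m A) *\<^sub>v v) $ i = t * (A *\<^sub>v v) $ i"
      using i' A v(1) by (simp add: scalar_prod_def sum_distrib_left mult.assoc)
    ultimately have "t * (A *\<^sub>v v) $ i = x * v $ i"
      using i' v(1) by simp
    then show "(A *\<^sub>v v) $ i = ((x / t) \<cdot>\<^sub>v v) $ i" using t i' v by (simp add: field_simps)
  qed (use A v in auto)
  then show ?thesis using v A unfolding eigenvalue_def eigenvector_def by auto
qed

text \<open>Rescaling turns bounded powers into decaying ones: for a suitable t > 1 the matrix t A
  still has spectral radius below 1, the Jordan normal form bounds its powers, and division by t^k
  leaves the geometric factor.\<close>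

lemma pow_entries_bounded_of_spectral_radius:
  assumes A: "A \<in> carrier_mat p p" and p: "0 < p" and r: "spectral_radius (A :: complex mat) < 1"
  obtains C t where "1 < t" "0 \<le> C" "\<And>k i j. i < p \<Longrightarrow> j < p \<Longrightarrow> norm ((A ^\<^sub>m k) $$ (i, j)) \<le> C * (1 / t) ^ k"
proof -
  let ?r = "spectral_radius A"
  have r0: "0 \<le> ?r" using spectral_radius_mem_max(1)[OF A p] by auto
  \<comment> \<open>For a radius r < 1 the product t r = 2 r / (1 + r) is still below 1.\<close>
  define t where "t = 2 / (1 + ?r)"
  have t: "1 < t" "t * ?r < 1" using r r0 by (auto simp: t_def field_simps)
  let ?B = "complex_of_real t \<cdot>\<^sub>m A"
  have B: "?B \<in> carrier_mat p p" using A by simp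
  have "spectral_radius ?B < 1"
  proof -
    obtain x where x: "x \<in> spectrum ?B" "spectral_radius ?B = norm x"
      using spectral_radius_mem_max(1)[OF B p] by auto
    then have "eigenvalue A (x / t)" 
      using eigenvalue_smult[OF A, of t x] t by (auto simp: spectrum_def)
    then have "norm (x / t) \<le> ?r"
      using spectral_radius_mem_max(2)[OF A p] by (auto simp: spectrum_def)
    then have "norm x \<le> t * ?r" using t(1) by (simp add: norm_divide field_simps)
    then show ?thesis using x t by simp
  qed
  moreover have "\<exists>n_as. jordan_nf ?B n_as"
    using jordan_nf_exists[OF B] char_poly_factorized[OF B] by metis
  ultimately obtain c where c: "\<And>k. norm_bound (?B ^\<^sub>m k) c"
    using spectral_radius_jnf_norm_bound_less_1[OF B] by auto
  have main: "norm ((A ^\<^sub>m k) $$ (i, j)) \<le> c * (1 / t) ^ k" if ij: "i < p" "j < p" for k i j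
  proof -
    have "norm ((?B ^\<^sub>m k) $$ (i, j)) \<le> c"
    proof -
      have d: "dim_row (?B ^\<^sub>m k) = p" "dim_col (?B ^\<^sub>m k) = p"
        using pow_carrier_mat[OF B, of k] by auto
      show ?thesis using c[of k, unfolded norm_bound_def d] ij by simp
    qed
    then have "t ^ k * norm ((A ^\<^sub>m k) $$ (i, j)) \<le> c"
      using ij A t unfolding pow_mat_smult[OF A] by (simp add: norm_mult norm_power)
    then show ?thesis using t by (simp add: field_simps)
  qed
  moreover have "0 \<le> c" using main[of 0 0 0] p A by simp
  ultimately show ?thesis using that t by blast
qed

lemma real_pow_entries_tendsto_0:
  assumes A: "A \<in> carrier_mat p p" and r: "spectral_radius (map_mat complex_of_real A) < 1"
    and ij: "i < p" "j < p"
  shows "(\<lambda>k. (A ^\<^sub>m k) $$ (i, j)) \<longlonglongrightarrow> 0"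
proof -
  let ?B = "map_mat complex_of_real A"
  have B: "?B \<in> carrier_mat p p" using A by simp
  obtain C t where t: "1 < t" and C: "0 \<le> C" "\<And>k i j. i < p \<Longrightarrow> j < p \<Longrightarrow> norm ((?B ^\<^sub>m k) $$ (i, j)) \<le> C * (1 / t) ^ k"
    using pow_entries_bounded_of_spectral_radius[OF B _ r] ij by (metis gr0I not_less0)
  have "norm ((A ^\<^sub>m k) $$ (i, j)) \<le> C * (1 / t) ^ k" for k
  proof -
    have "?B ^\<^sub>m k = map_mat complex_of_real (A ^\<^sub>m k)"
      using of_real_hom.mat_hom_pow[OF A, of k] by (rule sym)
    then have "(?B ^\<^sub>m k) $$ (i, j) = complex_of_real ((A ^\<^sub>m k) $$ (i, j))"
      using ij A by simp
    then show ?thesis using C(2)[OF ij, of k] by simp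
  qed
  then have "\<forall>\<^sub>F k in sequentially. norm ((A ^\<^sub>m k) $$ (i, j)) \<le> C * (1 / t) ^ k" by simp
  moreover have "(\<lambda>k. C * (1 / t) ^ k) \<longlonglongrightarrow> 0"
    using t by (intro tendsto_mult_right_zero LIMSEQ_power_zero) auto
  ultimately show ?thesis by (rule Lim_null_comparison)
qed

lemma spectral_norm_pow_tendsto_0:
  assumes A: "A \<in> carrier_mat p p" and p: "0 < p" and r: "spectral_radius (map_mat complex_of_real A) < 1"
  shows "(\<lambda>k. spectral_norm (A ^\<^sub>m k)) \<longlonglongrightarrow> 0"
proof (rule Lim_null_comparison)
  have "(\<lambda>k. \<Sum>i<p. \<Sum>j<p. \<bar>(A ^\<^sub>m k) $$ (i, j)\<bar>) \<longlonglongrightarrow> (\<Sum>i<p. \<Sum>j<p. \<bar>0\<bar>)"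
    using real_pow_entries_tendsto_0[OF A r] by (intro tendsto_sum tendsto_rabs) auto
  then show "(\<lambda>k. \<Sum>i<p. \<Sum>j<p. \<bar>(A ^\<^sub>m k) $$ (i, j)\<bar>) \<longlonglongrightarrow> 0" by simp
  have d: "dim_row (A ^\<^sub>m k) = p" "dim_col (A ^\<^sub>m k) = p" for k using A by auto
  show "\<forall>\<^sub>F k in sequentially. norm (spectral_norm (A ^\<^sub>m k)) \<le> (\<Sum>i<p. \<Sum>j<p. \<bar>(A ^\<^sub>m k) $$ (i, j)\<bar>)"
  proof (rule always_eventually, rule allI)
    fix k
    show "norm (spectral_norm (A ^\<^sub>m k)) \<le> (\<Sum>i<p. \<Sum>j<p. \<bar>(A ^\<^sub>m k) $$ (i, j)\<bar>)"
      using spectral_norm_nonneg[of "A ^\<^sub>m k", unfolded d, OF p]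
        spectral_norm_le_entries[of "A ^\<^sub>m k", unfolded d, OF p] by simp
  qed
qed

section \<open>The parameters \<tau> and \<gamma>\<close>

lemma pow_mat_add_exponents:
  assumes A: "A \<in> carrier_mat p p"
  shows "(A :: 'a :: semiring_1 mat) ^\<^sub>m (k + l) = A ^\<^sub>m k * A ^\<^sub>m l"
proof (induction l)
  case 0 then show ?case using A by simp
next
  case (Suc l)
  then show ?case using A
    by (simp add: assoc_mult_mat[OF pow_carrier_mat[OF A] pow_carrier_mat[OF A] A])
qed

text \<open>The \<open>LEAST\<close> in \<open>tau\<close> is meaningful only if some positive power
  has norm at most \<rho>; convergence of the powers to 0 supplies one.\<close>

lemma tau_props:
  assumes A: "A \<in> carrier_mat p p" and p: "0 < p" and r: "spectral_radius (map_mat complex_of_real A) < 1"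
    and \<rho>: "0 < \<rho>"
  shows "1 \<le> tau \<rho> A" "spectral_norm (A ^\<^sub>m tau \<rho> A) \<le> \<rho>"
proof -
  have "\<forall>\<^sub>F k in sequentially. spectral_norm (A ^\<^sub>m k) < \<rho>"
    using order_tendstoD(2)[OF spectral_norm_pow_tendsto_0[OF A p r] \<rho>] .
  then obtain K where "\<And>k. K \<le> k \<Longrightarrow> spectral_norm (A ^\<^sub>m k) < \<rho>"
    by (auto simp: eventually_sequentially)
  then have "1 \<le> max 1 K \<and> spectral_norm (A ^\<^sub>m max 1 K) \<le> \<rho>" by (simp add: less_imp_le)
  from LeastI[of "\<lambda>k. 1 \<le> k \<and> spectral_norm (A ^\<^sub>m k) \<le> \<rho>", OF this]
  show "1 \<le> tau \<rho> A" "spectral_norm (A ^\<^sub>m tau \<rho> A) \<le> \<rho>" unfolding tau_def by auto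
qed

text \<open>For the degenerate case without support: there \<tau> = 1, so that the bound on \<mu> is
  a multiple of \<gamma> alone.\<close>

lemma tau_zero_mat:
  assumes \<rho>: "0 < \<rho>" and p: "0 < p"
  shows "tau \<rho> (0\<^sub>m p p) = 1"
proof -
  have "spectral_norm (0\<^sub>m p p) \<le> 0"
  proof (rule spectral_norm_le)
    fix v :: "real Matrix.vec" assume "v \<in> carrier_vec (dim_col (0\<^sub>m p p :: real mat))"
    then show "vec_l2 (0\<^sub>m p p *\<^sub>v v) \<le> 0" by (simp add: vec_l2_def)
  qed (use p in auto)
  then show ?thesis unfolding tau_def using \<rho>
    by (intro Least_equality) auto
qed

lemma gam_ge:
  assumes "0 < \<rho>" "k < tau \<rho> A"
  shows "spectral_norm (A ^\<^sub>m k) \<le> \<rho> * gam \<rho> A"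
proof -
  have "spectral_norm (A ^\<^sub>m k) \<le> Max ((\<lambda>k. spectral_norm (A ^\<^sub>m k)) ` {0..tau \<rho> A - 1})"
    using assms by (intro Max_ge) auto
  then show ?thesis unfolding gam_def mult.assoc[symmetric] using assms by simp
qed

text \<open>Write k = b \<tau> + s with s < \<tau>. Each full block contributes a factor \<rho>, and
  the rest contributes \<rho> \<gamma>, because \<open>gam\<close> contains the inverse of \<rho>.
  This spare factor \<rho> covers the incomplete block: k \<le> (b + 1) \<tau>.\<close>

lemma spectral_norm_pow_le:
  assumes A: "A \<in> carrier_mat p p" and p: "0 < p" and r: "spectral_radius (map_mat complex_of_real A) < 1"
    and \<rho>: "0 < \<rho>" "\<rho> < 1"
  shows "spectral_norm (A ^\<^sub>m k) \<le> gam \<rho> A * (\<rho> powr (1 / tau \<rho> A)) ^ k"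
proof -
  let ?t = "tau \<rho> A"
  note t = tau_props[OF A p r \<rho>(1)]
  have d: "A ^\<^sub>m k \<in> carrier_mat p p" for k using A by simp
  have nn: "0 \<le> spectral_norm (A ^\<^sub>m k)" for k using p d[of k] by (intro spectral_norm_nonneg) auto
  have block: "spectral_norm (A ^\<^sub>m (b * ?t + s)) \<le> \<rho> ^ b * spectral_norm (A ^\<^sub>m s)" for b s
  proof (induction b)
    case (Suc b)
    have "A ^\<^sub>m (Suc b * ?t + s) = A ^\<^sub>m ?t * A ^\<^sub>m (b * ?t + s)"
      using pow_mat_add_exponents[OF A, of ?t "b * ?t + s"] by (simp add: ac_simps)
    then have "spectral_norm (A ^\<^sub>m (Suc b * ?t + s)) \<le> spectral_norm (A ^\<^sub>m ?t) * spectral_norm (A ^\<^sub>m (b * ?t + s))"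
      using spectral_norm_mult_le[OF d d p] by simp
    also have "\<dots> \<le> \<rho> * (\<rho> ^ b * spectral_norm (A ^\<^sub>m s))"
      using Suc t nn \<rho> by (intro mult_mono) auto
    finally show ?case by simp
  qed simp
  define b where "b = k div ?t"
  have st: "k mod ?t < ?t" using t by simp
  have kb: "k = b * ?t + k mod ?t" unfolding b_def by (rule div_mult_mod_eq[symmetric])
  define s where "s = k mod ?t"
  have kb': "k = b * ?t + s" unfolding s_def by (rule kb)
  have "spectral_norm (A ^\<^sub>m k) \<le> \<rho> ^ b * spectral_norm (A ^\<^sub>m s)"
    using block[of b s] unfolding kb'[symmetric] .
  also have "\<dots> \<le> \<rho> ^ b * (\<rho> * gam \<rho> A)"
    unfolding s_def using gam_ge[OF \<rho>(1) st] \<rho> by (intro mult_left_mono) auto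
  also have "\<dots> = gam \<rho> A * \<rho> ^ Suc b" by simp
  also have "\<dots> \<le> gam \<rho> A * (\<rho> powr (1 / ?t)) ^ k"
  proof (rule mult_left_mono)
    have "real k \<le> real ?t * real (Suc b)"
    proof -
      have "s < ?t" using st s_def by simp
      then have "k \<le> ?t * Suc b" by (subst kb') simp
      then show ?thesis by (metis of_nat_le_iff of_nat_mult)
    qed
    then have "k / ?t \<le> real (Suc b)" using t(1) by (simp add: divide_le_eq mult.commute)
    then have "\<rho> powr real (Suc b) \<le> \<rho> powr (k / ?t)" using \<rho> by (intro powr_mono') auto
    moreover have "\<rho> powr real (Suc b) = \<rho> ^ Suc b" using \<rho> by (rule_tac powr_realpow)
    moreover have "(\<rho> powr (1 / ?t)) ^ k = \<rho> powr (k / ?t)" 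
      using \<rho> powr_realpow[of "\<rho> powr (1 / ?t)" k] by (simp add: powr_powr)
    ultimately show "\<rho> ^ Suc b \<le> (\<rho> powr (1 / ?t)) ^ k" by simp
    have "0 \<le> \<rho> * gam \<rho> A" using gam_ge[OF \<rho>(1) st] nn[of "k mod ?t"] by linarith
    then show "0 \<le> gam \<rho> A" using \<rho> by (simp add: zero_le_mult_iff)
  qed
  finally show ?thesis .
qed

text \<open>The exponent 0 takes part in the maximum of \<open>gam\<close>, as \<tau> \<ge> 1, and
  the identity has norm 1.\<close>

lemma gam_ge_inverse:
  assumes A: "A \<in> carrier_mat p p" and p: "0 < p" and r: "spectral_radius (map_mat complex_of_real A) < 1"
    and \<rho>: "0 < \<rho>" "\<rho> < 1"
  shows "1 / \<rho> \<le> gam \<rho> A"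
proof -
  have "A ^\<^sub>m 0 = 1\<^sub>m p" using A by simp
  then have "1 \<le> \<rho> * gam \<rho> A"
    using gam_ge[OF \<rho>(1), of 0 A] tau_props(1)[OF A p r \<rho>(1)] spectral_norm_one[OF p] by simp
  then show ?thesis using \<rho>(1) by (simp add: divide_le_eq mult.commute)
qed

text \<open>The weighted arithmetic-geometric mean inequality for \<rho> and 1. It is used with t =
  \<tau>, to pass from the decay rate to \<tau>, and with t the order of a moment.\<close>

lemma one_minus_root_ge:
  assumes "0 < \<rho>" "\<rho> < (1::real)" "1 \<le> t"
  shows "(1 - \<rho>) / t \<le> 1 - \<rho> powr (1 / t)"
proof -
  have "\<rho> powr (1 / t) * 1 powr (1 - 1 / t) \<le> (1 / t) * \<rho> + (1 - 1 / t) * 1"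
    using assms by (intro Youngs_inequality_0) auto
  then show ?thesis by (simp add: diff_divide_distrib)
qed

section \<open>Moments of sums of independent variables\<close>

text \<open>The linear term is kept exact, so that it will vanish for a centred independent
  increment. Small t is handled by Taylor's theorem on [1/2, 3/2]; for large t the power is at most
  3^q |t|^q.\<close>

lemma powr_one_plus_le:
  fixes q t :: real
  assumes q: "2 \<le> q"
  defines "C \<equiv> 3 powr q * (1 + q\<^sup>2)"
  shows "\<bar>1 + t\<bar> powr q \<le> 1 + q * t + C * (t\<^sup>2 + \<bar>t\<bar> powr q)"
proof (cases "\<bar>t\<bar> \<le> 1/2")
  case False
  then have t: "1/2 < \<bar>t\<bar>" by simp
  have "\<bar>1 + t\<bar> powr q \<le> (3 * \<bar>t\<bar>) powr q" using t q by (intro powr_mono2) auto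
  then have 1: "\<bar>1 + t\<bar> powr q \<le> 3 powr q * \<bar>t\<bar> powr q" by (simp add: powr_mult)
  have "q * \<bar>t\<bar> \<le> q * (2 * t\<^sup>2)"
  proof (rule mult_left_mono)
    have "\<bar>t\<bar> * 1 \<le> \<bar>t\<bar> * (2 * \<bar>t\<bar>)" using t by (intro mult_left_mono) auto
    then show "\<bar>t\<bar> \<le> 2 * t\<^sup>2" by (simp add: power2_eq_square)
  qed (use q in simp)
  also have "\<dots> \<le> q\<^sup>2 * t\<^sup>2"
    using q by (simp add: power2_eq_square mult.assoc mult_right_mono mult_left_mono)
  \<comment> \<open>For |t| > 1/2 the quadratic term outweighs a negative linear one, so the
    remaining part of the right-hand side is non-negative.\<close>
  finally have 2: "0 \<le> 1 + q * t + q\<^sup>2 * t\<^sup>2" using abs_le_D2[of "q * t" "q\<^sup>2 * t\<^sup>2"] q by (simp add: abs_mult)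
  have p3: "1 \<le> 3 powr q" using q by (intro ge_one_powr_ge_zero) auto
  have "1 * (q\<^sup>2 * t\<^sup>2) \<le> 3 powr q * (q\<^sup>2 * t\<^sup>2)" using p3 by (intro mult_right_mono) auto
  moreover have "0 \<le> 3 powr q * t\<^sup>2" "0 \<le> 3 powr q * (q\<^sup>2 * \<bar>t\<bar> powr q)" by simp_all
  moreover have "C * (t\<^sup>2 + \<bar>t\<bar> powr q) = 3 powr q * t\<^sup>2 + 3 powr q * \<bar>t\<bar> powr q
    + 3 powr q * (q\<^sup>2 * t\<^sup>2) + 3 powr q * (q\<^sup>2 * \<bar>t\<bar> powr q)"
    unfolding C_def by (simp add: distrib_left distrib_right mult.assoc)
  ultimately show ?thesis using 1 2 by linarith
next
  case True
  define f where "f = (\<lambda>m::nat. if m = 0 then (\<lambda>x. x powr q) else if m = 1 then (\<lambda>x. q * x powr (q - 1))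
    else (\<lambda>x. q * (q - 1) * x powr (q - 2)) :: real \<Rightarrow> real)"
  have D: "\<forall>m x. m < 2 \<and> 1/2 \<le> x \<and> x \<le> 3/2 \<longrightarrow> DERIV (f m) x :> f (Suc m) x"
  proof (intro allI impI, elim conjE)
    fix m :: nat and x :: real assume m: "m < 2" and x: "1/2 \<le> x" "x \<le> 3/2"
    consider "m = 0" | "m = 1" using m by linarith
    then show "DERIV (f m) x :> f (Suc m) x"
    proof cases
      case 1 then show ?thesis using x unfolding f_def
        by (auto intro!: derivative_eq_intros)
    next
      case 2 
      have "q - 1 - 1 = q - 2" by simp
      with 2 show ?thesis using x unfolding f_def
        by (auto intro!: derivative_eq_intros)
    qed
  qed
  show ?thesis
  \<comment> \<open>The mean value form of Taylor's theorem needs a point different from the centre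
    1.\<close>
  proof (cases "t = 0")
    case False
    have "\<exists>s. (if 1 + t < 1 then 1 + t < s \<and> s < 1 else 1 < s \<and> s < 1 + t) \<and>
      f 0 (1 + t) = (\<Sum>m<2. f m 1 / fact m * (1 + t - 1) ^ m) + f 2 s / fact 2 * (1 + t - 1) ^ 2"
      using True False D by (intro Taylor[where a="1/2" and b="3/2"]) (auto simp: abs_if split: if_splits)
    then obtain s where s0: "if 1 + t < 1 then 1 + t < s \<and> s < 1 else 1 < s \<and> s < 1 + t"
      and eq: "f 0 (1 + t) = (\<Sum>m<2. f m 1 / fact m * (1 + t - 1) ^ m) + f 2 s / fact 2 * (1 + t - 1) ^ 2"
      by blast
    have s: "1/2 \<le> s" "s \<le> 3/2"
      using s0 True by (auto simp: abs_if split: if_splits)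
    have "(1 + t) powr q = 1 + q * t + q * (q - 1) * s powr (q - 2) / 2 * t\<^sup>2"
      using eq by (simp add: f_def numeral_2_eq_2)
    also have "\<dots> \<le> 1 + q * t + C * t\<^sup>2"
    proof -
      have "s powr (q - 2) \<le> 3 powr (q - 2)" using s q by (intro powr_mono2) auto
      also have "\<dots> \<le> 3 powr q" by (intro powr_mono) auto
      finally have "q * (q - 1) * s powr (q - 2) \<le> q\<^sup>2 * 3 powr q"
        using q by (intro mult_mono) (auto simp: power2_eq_square)
      moreover have "0 \<le> q\<^sup>2 * 3 powr q" "0 \<le> 3 powr q" by auto
      moreover have "C = 3 powr q + q\<^sup>2 * 3 powr q" unfolding C_def by (simp add: distrib_left)
      ultimately have "q * (q - 1) * s powr (q - 2) / 2 \<le> C" by linarith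
      then show ?thesis by (intro add_left_mono mult_right_mono) auto
    qed
    also have "\<dots> \<le> 1 + q * t + C * (t\<^sup>2 + \<bar>t\<bar> powr q)"
      unfolding C_def by (simp add: algebra_simps)
    finally show ?thesis using True by (simp add: abs_if split: if_splits)
  qed simp
qed

text \<open>The previous inequality at y / s, multiplied by |s|^q. The coefficient
  \<open>\<bar>s\<bar> powr q / s\<close> is sgn(s) |s|^(q-1), also at s = 0, where the quotient is
  0 by convention.\<close>

lemma abs_add_powr_le:
  fixes q s y :: real
  assumes q: "2 \<le> q"
  defines "C \<equiv> 3 powr q * (1 + q\<^sup>2)"
  shows "\<bar>s + y\<bar> powr q \<le> \<bar>s\<bar> powr q + q * (\<bar>s\<bar> powr q / s) * y
    + C * (\<bar>s\<bar> powr (q - 2) * y\<^sup>2 + \<bar>y\<bar> powr q)"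
proof (cases "s = 0")
  case True
  have p3: "1 \<le> 3 powr q" using q by (intro ge_one_powr_ge_zero) auto
  have "1 * 1 \<le> C" unfolding C_def using p3 by (intro mult_mono) auto
  then have "1 * \<bar>y\<bar> powr q \<le> C * \<bar>y\<bar> powr q" by (intro mult_right_mono) auto
  then show ?thesis using True by simp
next
  case False
  have "\<bar>s + y\<bar> = \<bar>s\<bar> * \<bar>1 + y / s\<bar>" using False by (simp add: abs_mult[symmetric] field_simps)
  then have "\<bar>s + y\<bar> powr q = \<bar>s\<bar> powr q * \<bar>1 + y / s\<bar> powr q" by (simp add: powr_mult)
  also have "\<dots> \<le> \<bar>s\<bar> powr q * (1 + q * (y / s) + C * ((y / s)\<^sup>2 + \<bar>y / s\<bar> powr q))"
    unfolding C_def by (intro mult_left_mono powr_one_plus_le q) auto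
  also have "\<dots> = \<bar>s\<bar> powr q + q * (\<bar>s\<bar> powr q / s) * y
    + C * (\<bar>s\<bar> powr q / s\<^sup>2 * y\<^sup>2 + \<bar>s\<bar> powr q * (\<bar>y\<bar> / \<bar>s\<bar>) powr q)"
    by (simp add: algebra_simps power_divide)
  also have "\<bar>s\<bar> powr q * (\<bar>y\<bar> / \<bar>s\<bar>) powr q = \<bar>y\<bar> powr q"
    using False by (simp add: powr_divide)
  also have "\<bar>s\<bar> powr q / s\<^sup>2 = \<bar>s\<bar> powr (q - 2)"
    using False by (simp add: powr_diff)
  finally show ?thesis .
qed

text \<open>With W = (V + b^2)^(q/2 - 1) the right-hand side is W V + W b^2. Here W dominates both
  V^(q/2 - 1) and b^(q-2), so W b^2 is at least each of the two terms in the bracket, hence at least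
  their mean. This is how the bound grows when a summand is added to the Rosenthal-type
  induction.\<close>

lemma powr_add_ge:
  fixes V b q :: real
  assumes q: "2 \<le> q" and V: "0 < V" and b: "0 \<le> b"
  shows "V powr (q / 2) + (V powr ((q - 2) / 2) * b\<^sup>2 + b powr q) / 2 \<le> (V + b\<^sup>2) powr (q / 2)"
proof -
  have pos: "0 < V + b\<^sup>2" using V by (simp add: add_pos_nonneg)
  let ?W = "(V + b\<^sup>2) powr (q / 2 - 1)"
  have split: "(V + b\<^sup>2) powr (q / 2) = ?W * V + ?W * b\<^sup>2"
  proof -
    have "(V + b\<^sup>2) powr (q / 2) = ?W * (V + b\<^sup>2)" using pos by (simp add: powr_diff)
    then show ?thesis by (simp only: distrib_left)
  qed
  have 1: "V powr (q / 2 - 1) \<le> ?W" using V q by (intro powr_mono2) auto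
  then have "V powr (q / 2 - 1) * V \<le> ?W * V" using V by (intro mult_right_mono) auto
  then have a: "V powr (q / 2) \<le> ?W * V" using V by (simp add: powr_diff)
  have b1: "V powr ((q - 2) / 2) * b\<^sup>2 \<le> ?W * b\<^sup>2"
    using 1 by (intro mult_right_mono) (auto simp: diff_divide_distrib)
  have "b powr q \<le> ?W * b\<^sup>2"
  proof (cases "b = 0")
    case False
    have "(b\<^sup>2) powr (q / 2 - 1) \<le> ?W" using V q by (intro powr_mono2) auto
    then have "(b\<^sup>2) powr (q / 2 - 1) * b\<^sup>2 \<le> ?W * b\<^sup>2" by (intro mult_right_mono) auto
    moreover have "(b\<^sup>2) powr (q / 2 - 1) * b\<^sup>2 = b powr q"
      using False b by (simp add: powr_diff powr_powr flip: powr_numeral)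
    ultimately show ?thesis by simp
  qed simp
  have avg: "x + (y + z) / 2 \<le> P + Q" if "x \<le> P" "y \<le> Q" "z \<le> Q" for x y z P Q :: real
    using that by (simp add: field_simps)
  show ?thesis unfolding split by (rule avg) fact+
qed

text \<open>Jensen's inequality for a concave power, proved from the tangent at w; the tangent also
  yields integrability and allows any upper bound w of the mean.\<close>

lemma (in prob_space) expectation_powr_le:
  fixes U :: "'a \<Rightarrow> real" and w \<alpha> :: real
  assumes int: "integrable M U" and U: "\<And>\<omega>. \<omega> \<in> space M \<Longrightarrow> 0 \<le> U \<omega>" and w: "0 < w" "expectation U \<le> w"
    and a: "0 \<le> \<alpha>" "\<alpha> \<le> 1"
  shows "integrable M (\<lambda>\<omega>. U \<omega> powr \<alpha>)" "expectation (\<lambda>\<omega>. U \<omega> powr \<alpha>) \<le> w powr \<alpha>"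
proof -
  have pt: "u powr \<alpha> \<le> w powr \<alpha> * (\<alpha> * (u / w) + (1 - \<alpha>))" if "0 \<le> u" for u :: real
  proof (cases "u = 0")
    case False
    then have "(u / w) powr \<alpha> * 1 powr (1 - \<alpha>) \<le> \<alpha> * (u / w) + (1 - \<alpha>) * 1"
      using that w a by (intro Youngs_inequality_0) auto
    then have "w powr \<alpha> * (u / w) powr \<alpha> \<le> w powr \<alpha> * (\<alpha> * (u / w) + (1 - \<alpha>))"
      by (intro mult_left_mono) auto
    then show ?thesis using w that False by (simp add: powr_divide)
  qed (use a in simp)
  have int2: "integrable M (\<lambda>\<omega>. w powr \<alpha> * (\<alpha> * (U \<omega> / w) + (1 - \<alpha>)))"
    using int by (auto intro!: Bochner_Integration.integrable_add)
  have [measurable]: "U \<in> borel_measurable M" using int by simp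
  show i: "integrable M (\<lambda>\<omega>. U \<omega> powr \<alpha>)"
    by (rule Bochner_Integration.integrable_bound[OF int2]) (use pt U in \<open>auto intro!: AE_I2 order_trans[OF _ abs_ge_self]\<close>)
  have "expectation (\<lambda>\<omega>. U \<omega> powr \<alpha>) \<le> expectation (\<lambda>\<omega>. w powr \<alpha> * (\<alpha> * (U \<omega> / w) + (1 - \<alpha>)))"
    using i int2 pt U by (intro integral_mono) auto
  also have "\<dots> = w powr \<alpha> * (\<alpha> * (expectation U / w) + (1 - \<alpha>))"
    using int by (subst integral_mult_right_zero, subst Bochner_Integration.integral_add) (auto simp: prob_space)
  also have "\<dots> \<le> w powr \<alpha> * (\<alpha> * 1 + (1 - \<alpha>))"
    using w a by (intro mult_left_mono add_right_mono) auto
  finally show "expectation (\<lambda>\<omega>. U \<omega> powr \<alpha>) \<le> w powr \<alpha>" by simp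
qed

lemma powr_le_one_plus:
  assumes "0 \<le> (x::real)" "0 \<le> r" "r \<le> q" shows "x powr r \<le> 1 + x powr q"
proof (cases "x \<le> 1")
  case True
  have "x powr r \<le> 1 powr r" using assms True by (intro powr_mono2) auto
  then show ?thesis using powr_ge_zero[of x q] unfolding powr_one_eq_one by linarith
next
  case False
  then have "x powr r \<le> x powr q" using assms by (intro powr_mono) auto
  then show ?thesis by simp
qed

lemma (in prob_space) integrable_powr_smaller:
  assumes "integrable M (\<lambda>\<omega>. \<bar>Y \<omega>\<bar> powr q)" "Y \<in> borel_measurable M" "0 \<le> r" "r \<le> q"
  shows "integrable M (\<lambda>\<omega>. \<bar>Y \<omega> :: real\<bar> powr r)"
proof (rule Bochner_Integration.integrable_bound)
  show "integrable M (\<lambda>\<omega>. 1 + \<bar>Y \<omega>\<bar> powr q)" using assms by auto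
qed (use assms in \<open>auto intro!: AE_I2 powr_le_one_plus order_trans[OF powr_le_one_plus[of _ r q]]\<close>)

lemma abs_add_powr_le_two:
  assumes "0 \<le> (q::real)" shows "\<bar>x + y\<bar> powr q \<le> 2 powr q * (\<bar>x\<bar> powr q + \<bar>y\<bar> powr q)"
proof -
  have "\<bar>x + y\<bar> powr q \<le> (2 * max \<bar>x\<bar> \<bar>y\<bar>) powr q" using assms by (intro powr_mono2) auto
  also have "\<dots> = 2 powr q * (max \<bar>x\<bar> \<bar>y\<bar>) powr q" by (simp add: powr_mult)
  also have "\<dots> \<le> 2 powr q * (\<bar>x\<bar> powr q + \<bar>y\<bar> powr q)" by (intro mult_left_mono) (auto simp: max_def)
  finally show ?thesis .
qed

text \<open>The constant \<open>(2 C) powr (q / 2)\<close> is the one for which the inductive step closes.\<close>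

lemma (in prob_space) moment_sum_indep_le:
  fixes X :: "'i \<Rightarrow> 'a \<Rightarrow> real" and b :: "'i \<Rightarrow> real"
  assumes q: "2 \<le> q" and fin: "finite F" and ind: "indep_vars (\<lambda>_. borel) X F"
    and int: "\<And>k. k \<in> F \<Longrightarrow> integrable M (\<lambda>\<omega>. \<bar>X k \<omega>\<bar> powr q)"
    and mean: "\<And>k. k \<in> F \<Longrightarrow> expectation (X k) = 0"
    and var: "\<And>k. k \<in> F \<Longrightarrow> expectation (\<lambda>\<omega>. (X k \<omega>)\<^sup>2) \<le> (b k)\<^sup>2"
    and mom: "\<And>k. k \<in> F \<Longrightarrow> expectation (\<lambda>\<omega>. \<bar>X k \<omega>\<bar> powr q) \<le> m * b k powr q"
    and b: "\<And>k. k \<in> F \<Longrightarrow> 0 \<le> b k" and m: "1 \<le> m"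
  defines "C \<equiv> 3 powr q * (1 + q\<^sup>2)"
  shows "integrable M (\<lambda>\<omega>. \<bar>\<Sum>k\<in>F. X k \<omega>\<bar> powr q) \<and>
    expectation (\<lambda>\<omega>. \<bar>\<Sum>k\<in>F. X k \<omega>\<bar> powr q) \<le> (2 * C) powr (q / 2) * m * (\<Sum>k\<in>F. (b k)\<^sup>2) powr (q / 2)"
  using fin ind int mean var mom b
proof (induction F rule: finite_induct)
  case empty then show ?case by simp
next
  case (insert x F)
  let ?K = "(2 * C) powr (q / 2)"
  let ?S = "\<lambda>\<omega>. \<Sum>k\<in>F. X k \<omega>" and ?V = "\<Sum>k\<in>F. (b k)\<^sup>2"
  have p3: "1 \<le> 3 powr q" using q by (intro ge_one_powr_ge_zero) auto
  have "1 * 1 \<le> C" unfolding C_def using p3 by (intro mult_mono) auto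
  then have C1: "1 \<le> C" by simp
  have rv: "X k \<in> borel_measurable M" if "k \<in> insert x F" for k
    using insert.prems(1) that unfolding indep_vars_def by blast
  then have [measurable]: "X x \<in> borel_measurable M" "?S \<in> borel_measurable M" by auto
  have IH: "integrable M (\<lambda>\<omega>. \<bar>?S \<omega>\<bar> powr q)" "expectation (\<lambda>\<omega>. \<bar>?S \<omega>\<bar> powr q) \<le> ?K * m * ?V powr (q / 2)"
    using insert.IH indep_vars_subset[OF insert.prems(1), of F] insert.prems by auto
  have ind: "indep_var borel (X x) borel ?S"
    using insert by (intro indep_vars_sum) auto
  have ix: "integrable M (\<lambda>\<omega>. \<bar>X x \<omega>\<bar> powr q)" using insert.prems by auto
  have inti: "integrable M (\<lambda>\<omega>. \<bar>?S \<omega> + X x \<omega>\<bar> powr q)"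
  proof (rule Bochner_Integration.integrable_bound)
    show "integrable M (\<lambda>\<omega>. 2 powr q * (\<bar>?S \<omega>\<bar> powr q + \<bar>X x \<omega>\<bar> powr q))"
      using IH(1) ix by auto
  qed (use abs_add_powr_le_two q in auto)
  have bx: "0 \<le> b x" using insert.prems by auto
  have sumeq: "(\<Sum>k\<in>insert x F. X k \<omega>) = ?S \<omega> + X x \<omega>" for \<omega>
    using insert by (simp add: add.commute)
  have sumeq2: "(\<Sum>k\<in>insert x F. (b k)\<^sup>2) = ?V + (b x)\<^sup>2"
    using insert by (simp add: add.commute)
  have V0: "0 \<le> ?V" by (simp add: sum_nonneg)
  have K1: "1 \<le> ?K" using C1 q by (intro ge_one_powr_ge_zero) auto
  have main: "expectation (\<lambda>\<omega>. \<bar>?S \<omega> + X x \<omega>\<bar> powr q) \<le> ?K * m * (?V + (b x)\<^sup>2) powr (q / 2)"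
  \<comment> \<open>If V = 0 the earlier partial sum is almost surely 0. Otherwise its q-th moment
    has a positive bound, which the tangent argument for the moment of order q - 2 requires.\<close>
  proof (cases "?V = 0")
    case True
    have "expectation (\<lambda>\<omega>. \<bar>?S \<omega>\<bar> powr q) = 0"
      using IH(2) True by (intro antisym) (auto simp: integral_nonneg)
    then have "AE \<omega> in M. \<bar>?S \<omega>\<bar> powr q = 0"
      using integral_nonneg_eq_0_iff_AE[OF IH(1)] by simp
    then have "AE \<omega> in M. \<bar>?S \<omega> + X x \<omega>\<bar> powr q = \<bar>X x \<omega>\<bar> powr q" by eventually_elim simp
    then have "expectation (\<lambda>\<omega>. \<bar>?S \<omega> + X x \<omega>\<bar> powr q) = expectation (\<lambda>\<omega>. \<bar>X x \<omega>\<bar> powr q)"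
      by (intro integral_cong_AE) auto
    also have "\<dots> \<le> 1 * (m * b x powr q)" using insert.prems by auto
    also have "\<dots> \<le> ?K * (m * b x powr q)" using K1 m by (intro mult_right_mono) auto
    also have "b x powr q = ((b x)\<^sup>2) powr (q / 2)"
      using bx by (cases "b x = 0") (simp_all add: powr_powr flip: powr_numeral)
    finally show ?thesis using True by (simp add: mult.assoc)
  next
    case False
    then have V: "0 < ?V" using V0 by simp
    let ?\<phi> = "\<lambda>s::real. q * (\<bar>s\<bar> powr q / s)"
    have xint: "integrable M (X x)" 
      using integrable_powr_smaller[OF ix, of 1] q by (subst integrable_abs_iff[symmetric]) auto
    have x2int: "integrable M (\<lambda>\<omega>. (X x \<omega>)\<^sup>2)"
      using integrable_powr_smaller[OF ix, of 2] q by (simp add: powr_numeral)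
    have S1: "integrable M (\<lambda>\<omega>. ?\<phi> (?S \<omega>))"
    proof (rule Bochner_Integration.integrable_bound)
      show "integrable M (\<lambda>\<omega>. q * \<bar>?S \<omega>\<bar> powr (q - 1))"
        using integrable_powr_smaller[OF IH(1), of "q - 1"] q by auto
      have "\<bar>?\<phi> s\<bar> \<le> q * \<bar>s\<bar> powr (q - 1)" for s :: real
        using q by (cases "s = 0") (auto simp: abs_mult powr_diff)
      then show "AE \<omega> in M. norm (?\<phi> (?S \<omega>)) \<le> norm (q * \<bar>?S \<omega>\<bar> powr (q - 1))"
        using q by (auto intro!: AE_I2)
    qed simp
    have S2: "integrable M (\<lambda>\<omega>. \<bar>?S \<omega>\<bar> powr (q - 2))"
      using integrable_powr_smaller[OF IH(1), of "q - 2"] q by auto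
    have ind1: "indep_var borel (X x) borel (\<lambda>\<omega>. ?\<phi> (?S \<omega>))"
      using indep_var_compose[OF ind, of "\<lambda>x. x" borel ?\<phi> borel] by (simp add: comp_def)
    have ind2: "indep_var borel (\<lambda>\<omega>. (X x \<omega>)\<^sup>2) borel (\<lambda>\<omega>. \<bar>?S \<omega>\<bar> powr (q - 2))"
      using indep_var_compose[OF ind, of "\<lambda>x. x\<^sup>2" borel "\<lambda>s. \<bar>s\<bar> powr (q - 2)" borel] by (simp add: comp_def)
    note i1 = indep_var_integrable[OF ind1 xint S1] and i2 = indep_var_integrable[OF ind2 x2int S2]
    let ?E2 = "expectation (\<lambda>\<omega>. \<bar>?S \<omega>\<bar> powr (q - 2))"
    have "expectation (\<lambda>\<omega>. \<bar>?S \<omega> + X x \<omega>\<bar> powr q) \<le>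
      expectation (\<lambda>\<omega>. \<bar>?S \<omega>\<bar> powr q + X x \<omega> * ?\<phi> (?S \<omega>) + C * ((X x \<omega>)\<^sup>2 * \<bar>?S \<omega>\<bar> powr (q - 2) + \<bar>X x \<omega>\<bar> powr q))"
      using inti IH(1) i1 i2 ix abs_add_powr_le[OF q, of "?S _" "X x _"] unfolding C_def
      by (intro integral_mono) (auto simp: ac_simps)
    also have "\<dots> = expectation (\<lambda>\<omega>. \<bar>?S \<omega>\<bar> powr q) + expectation (\<lambda>\<omega>. X x \<omega> * ?\<phi> (?S \<omega>))
       + C * (expectation (\<lambda>\<omega>. (X x \<omega>)\<^sup>2 * \<bar>?S \<omega>\<bar> powr (q - 2)) + expectation (\<lambda>\<omega>. \<bar>X x \<omega>\<bar> powr q))"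
      using IH(1) i1 i2 ix by (simp add: mult.assoc)
    \<comment> \<open>The first-order term disappears by independence and zero mean.\<close>
    also have "expectation (\<lambda>\<omega>. X x \<omega> * ?\<phi> (?S \<omega>)) = 0"
      using indep_var_lebesgue_integral[OF ind1 xint S1] insert.prems by simp
    also have "expectation (\<lambda>\<omega>. (X x \<omega>)\<^sup>2 * \<bar>?S \<omega>\<bar> powr (q - 2)) = ?E2 * expectation (\<lambda>\<omega>. (X x \<omega>)\<^sup>2)"
      using indep_var_lebesgue_integral[OF ind2 x2int S2] by simp
    finally have step: "expectation (\<lambda>\<omega>. \<bar>?S \<omega> + X x \<omega>\<bar> powr q) \<le> expectation (\<lambda>\<omega>. \<bar>?S \<omega>\<bar> powr q) + 0 +
      C * (?E2 * expectation (\<lambda>\<omega>. (X x \<omega>)\<^sup>2) + expectation (\<lambda>\<omega>. \<bar>X x \<omega>\<bar> powr q))" .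
    define w where "w = ?K * m * ?V powr (q / 2)"
    have w: "0 < w" using K1 m V unfolding w_def by (intro mult_pos_pos) auto
    let ?\<alpha> = "(q - 2) / q"
    have "expectation (\<lambda>\<omega>. (\<bar>?S \<omega>\<bar> powr q) powr ?\<alpha>) \<le> w powr ?\<alpha>"
      by (rule expectation_powr_le(2)[OF IH(1) _ w IH(2)[folded w_def]]) (use q in auto)
    then have "?E2 \<le> w powr ?\<alpha>" using q by (simp add: powr_powr)
    also have "w powr ?\<alpha> = ?K powr ?\<alpha> * m powr ?\<alpha> * ?V powr ((q - 2) / 2)"
      unfolding w_def using q by (simp add: powr_mult powr_powr)
    also have "\<dots> \<le> ?K powr ?\<alpha> * m powr 1 * ?V powr ((q - 2) / 2)"
      using m q by (intro mult_right_mono mult_left_mono powr_mono) auto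
    \<comment> \<open>As \<open>?K\<close> to the power 2 / q is 2 C, the exponent 1 - 2 / q gains
      the factor 1 / (2 C). It cancels the C of the pointwise inequality and leaves the 1/2 of
      \<open>powr_add_ge\<close>.\<close>
    also have "?K powr ?\<alpha> = ?K / (2 * C)"
      using q C1 by (simp add: powr_powr diff_divide_distrib powr_diff)
    finally have E2: "?E2 \<le> ?K / (2 * C) * m * ?V powr ((q - 2) / 2)" using m by simp
    have "?E2 * expectation (\<lambda>\<omega>. (X x \<omega>)\<^sup>2) \<le> ?K / (2 * C) * m * ?V powr ((q - 2) / 2) * (b x)\<^sup>2"
      using E2 insert.prems K1 C1 m by (intro mult_mono) auto
    moreover have "expectation (\<lambda>\<omega>. \<bar>X x \<omega>\<bar> powr q) \<le> ?K / (2 * C) * m * b x powr q"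
    proof -
      have "(2 * C) powr 1 \<le> ?K" using C1 q by (intro powr_mono) auto
      then have "1 \<le> ?K / (2 * C)" using C1 by simp
      then have "1 * (m * b x powr q) \<le> ?K / (2 * C) * (m * b x powr q)" using m by (intro mult_right_mono) auto
      moreover have "expectation (\<lambda>\<omega>. \<bar>X x \<omega>\<bar> powr q) \<le> m * b x powr q" using insert.prems by simp
      ultimately show ?thesis by (simp add: mult.assoc)
    qed
    ultimately have "C * (?E2 * expectation (\<lambda>\<omega>. (X x \<omega>)\<^sup>2) + expectation (\<lambda>\<omega>. \<bar>X x \<omega>\<bar> powr q))
      \<le> C * (?K / (2 * C) * m * ?V powr ((q - 2) / 2) * (b x)\<^sup>2 + ?K / (2 * C) * m * b x powr q)"
      using C1 by (intro mult_left_mono add_mono) auto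
    also have "\<dots> = ?K * m * ((?V powr ((q - 2) / 2) * (b x)\<^sup>2 + b x powr q) / 2)"
      using C1 by (simp add: field_simps)
    finally have "expectation (\<lambda>\<omega>. \<bar>?S \<omega> + X x \<omega>\<bar> powr q) \<le>
      ?K * m * (?V powr (q / 2) + (?V powr ((q - 2) / 2) * (b x)\<^sup>2 + b x powr q) / 2)"
      using step IH(2) unfolding distrib_left[of "?K * m" "?V powr (q / 2)"] by linarith
    also have "\<dots> \<le> ?K * m * (?V + (b x)\<^sup>2) powr (q / 2)"
      using powr_add_ge[OF q V bx] K1 m by (intro mult_left_mono) auto
    finally show ?thesis .
  qed
  show ?case unfolding sumeq sumeq2 using inti main by simp
qed

section \<open>A moment generating function bound\<close>

text \<open>Convexity of the power with the geometric weights \<open>(1 - \<kappa>) \<kappa>\<^sup>m\<close>, which sum to less than 1.\<close>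

lemma sum_power_le_weighted:
  fixes D :: "nat \<Rightarrow> real"
  assumes D: "\<And>m. m < N \<Longrightarrow> 0 \<le> D m" and \<kappa>: "0 < \<kappa>" "\<kappa> < 1"
  shows "(\<Sum>m<N. D m) ^ Suc r \<le> (\<Sum>m<N. D m ^ Suc r / ((1 - \<kappa>) * \<kappa> ^ m) ^ r)"
proof (cases "N = 0")
  case False
  let ?w = "\<lambda>m. (1 - \<kappa>) * \<kappa> ^ m"
  define W where "W = (\<Sum>m<N. ?w m)"
  have wpos: "0 < ?w m" for m using \<kappa> by simp
  have Wpos: "0 < W" unfolding W_def using False wpos by (intro sum_pos) auto
  have W1: "W \<le> 1" unfolding W_def
    using \<kappa> by (simp add: sum_distrib_left[symmetric] sum_gp_strict)
  let ?y = "\<lambda>m. D m / ?w m"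
  have conv: "convex_on {0::real..} (\<lambda>x. x ^ Suc r)"
  proof (cases "even (Suc r)")
    case True then show ?thesis by (rule convex_on_subset[OF convex_power_even]) auto
  next
    case False then show ?thesis by (rule convex_power_odd)
  qed
  \<comment> \<open>Jensen needs weights of total mass 1, hence the division by W; undoing it leaves
    a factor W^r \<le> 1.\<close>
  have "(\<Sum>m<N. (?w m / W) *\<^sub>R ?y m) ^ Suc r \<le> (\<Sum>m<N. (?w m / W) * ?y m ^ Suc r)"
  proof (rule convex_on_sum[OF _ _ conv])
    show "(\<Sum>m<N. ?w m / W) = 1" using Wpos by (simp add: W_def sum_divide_distrib[symmetric])
    show "0 \<le> ?w m / W" for m using wpos[of m] Wpos by simp
    show "?y m \<in> {0..}" if "m \<in> {..<N}" for m using D[of m] wpos[of m] that by simp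
  qed (use False in auto)
  moreover have "(\<Sum>m<N. (?w m / W) *\<^sub>R ?y m) = (\<Sum>m<N. D m) / W"
  proof -
    have "(?w m / W) *\<^sub>R ?y m = D m / W" for m using \<kappa> by simp
    then show ?thesis by (simp only: sum_divide_distrib)
  qed
  moreover have "(\<Sum>m<N. (?w m / W) * ?y m ^ Suc r) = (\<Sum>m<N. D m ^ Suc r / ?w m ^ r) / W"
  proof -
    have "(?w m / W) * ?y m ^ Suc r = D m ^ Suc r / ?w m ^ r / W" for m
      using \<kappa> unfolding power_divide by simp
    then show ?thesis by (simp only: sum_divide_distrib)
  qed
  ultimately have "((\<Sum>m<N. D m) / W) ^ Suc r \<le> (\<Sum>m<N. D m ^ Suc r / ?w m ^ r) / W" by simp
  then have "(\<Sum>m<N. D m) ^ Suc r \<le> W ^ r * (\<Sum>m<N. D m ^ Suc r / ?w m ^ r)"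
    using Wpos by (simp add: power_divide field_simps)
  also have "\<dots> \<le> 1 * (\<Sum>m<N. D m ^ Suc r / ?w m ^ r)"
  proof (rule mult_right_mono)
    show "W ^ r \<le> 1" using W1 Wpos by (intro power_le_one) auto
    show "0 \<le> (\<Sum>m<N. D m ^ Suc r / ?w m ^ r)"
      using D wpos by (intro sum_nonneg divide_nonneg_nonneg zero_le_power) (auto intro: less_imp_le)
  qed
  finally show ?thesis by simp
qed simp

text \<open>Keep only the term of degree r in the series of exp r.\<close>

lemma power_self_le_fact_exp: "real r ^ r \<le> fact r * exp (real r)"
proof -
  have "real r ^ r / fact r \<le> exp (real r)"
  proof -
    have "(\<lambda>n. real r ^ n / fact n) sums exp (real r)"
      using exp_converges[of "real r"] by (simp add: divide_inverse mult.commute)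
    then have "(\<Sum>n\<in>{r}. real r ^ n / fact n) \<le> exp (real r)"
      by (metis (no_types, lifting) divide_nonneg_pos fact_gt_zero finite.emptyI finite.insertI of_nat_0_le_iff
          sum_le_suminf sums_summable sums_unique zero_le_power)
    then show ?thesis by simp
  qed
  then show ?thesis by (simp add: divide_le_eq mult.commute)
qed

lemma (in finite_measure) integrable_bounded:
  assumes "f \<in> borel_measurable M" "\<And>x. x \<in> space M \<Longrightarrow> \<bar>f x\<bar> \<le> (B::real)"
  shows "integrable M f"
  using assms by (intro integrable_const_bound[of _ B]) auto

text \<open>Only second moments decay, so a power of order k + 2 is bounded by B^k times a square.
  The decay \<rho>^(2m) of the squares has to pay for the geometric weights of the convexity
  inequality and still leave a summable sequence.\<close>

lemma (in prob_space) moment_sum_geometric_le: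
  fixes D :: "nat \<Rightarrow> 'a \<Rightarrow> real"
  assumes [measurable]: "\<And>m. D m \<in> borel_measurable M"
    and D: "\<And>m w. w \<in> space M \<Longrightarrow> 0 \<le> D m w" "\<And>m w. w \<in> space M \<Longrightarrow> D m w \<le> B"
    and D2: "\<And>m. m < N \<Longrightarrow> expectation (\<lambda>w. (D m w)\<^sup>2) \<le> V * \<rho> ^ (2 * m)"
    and \<rho>: "0 < \<rho>" "\<rho> < 1" and V: "0 \<le> V" and B: "0 \<le> B"
  shows "expectation (\<lambda>w. (\<Sum>m<N. D m w) ^ (k + 2)) \<le> (real (k + 2) / (1 - \<rho>)) ^ (k + 2) * B ^ k * V"
proof -
  let ?r = "k + 2"
  \<comment> \<open>The weight ratio is the r-th root of \<rho>: slow enough that r - 1 weights cost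
    less than \<rho>^m, while 1 - \<kappa> is still at least (1 - \<rho>) / r. This is the origin of
    the factor r^r.\<close>
  define \<kappa> where "\<kappa> = \<rho> powr (1 / real ?r)"
  have \<kappa>: "0 < \<kappa>" "\<kappa> < 1" unfolding \<kappa>_def using \<rho> powr_less_mono2[of "1 / real ?r" \<rho> 1] by auto
  have \<kappa>r: "\<kappa> ^ ?r = \<rho>" unfolding \<kappa>_def using \<rho> by (subst powr_power) auto
  have lower: "(1 - \<rho>) / real ?r \<le> 1 - \<kappa>" unfolding \<kappa>_def using \<rho> by (intro one_minus_root_ge) auto
  let ?c = "real ?r / (1 - \<rho>)"
  have c: "1 / (1 - \<kappa>) \<le> ?c" using lower \<rho> \<kappa> by (simp add: field_simps)
  have c1: "1 \<le> ?c" using \<rho> by (simp add: field_simps)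
  have int: "integrable M (\<lambda>w. D m w ^ j)" for m j
    using D B by (intro integrable_bounded[of _ "B ^ j"]) (auto simp: power_mono)
  have int2: "integrable M (\<lambda>w. (\<Sum>m<N. D m w) ^ j)" for j
    using D B by (intro integrable_bounded[of _ "(\<Sum>m<N. B) ^ j"])
      (auto simp: abs_of_nonneg sum_nonneg simp flip: power_abs sum_constant intro!: power_mono sum_mono)
  have "expectation (\<lambda>w. (\<Sum>m<N. D m w) ^ ?r) \<le>
      expectation (\<lambda>w. \<Sum>m<N. D m w ^ ?r / ((1 - \<kappa>) * \<kappa> ^ m) ^ (k + 1))"
  proof (rule integral_mono[OF int2])
    show "integrable M (\<lambda>w. \<Sum>m<N. D m w ^ ?r / ((1 - \<kappa>) * \<kappa> ^ m) ^ (k + 1))"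
      by (intro Bochner_Integration.integrable_sum integrable_divide int)
    have "Suc (k + 1) = ?r" by simp
    then show "(\<Sum>m<N. D m w) ^ ?r \<le> (\<Sum>m<N. D m w ^ ?r / ((1 - \<kappa>) * \<kappa> ^ m) ^ (k + 1))"
      if "w \<in> space M" for w
      using sum_power_le_weighted[OF _ \<kappa>, of N "\<lambda>m. D m w" "k + 1"] D[OF that] by presburger
  qed
  also have "\<dots> = (\<Sum>m<N. expectation (\<lambda>w. D m w ^ ?r) / ((1 - \<kappa>) * \<kappa> ^ m) ^ (k + 1))"
    by (subst Bochner_Integration.integral_sum) (rule integrable_divide int integral_divide_zero sum.cong refl)+
  also have "\<dots> \<le> (\<Sum>m<N. ?c ^ (k + 1) * B ^ k * V * \<rho> ^ m)"
  proof (rule sum_mono)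
    fix m assume m: "m \<in> {..<N}"
    have "expectation (\<lambda>w. D m w ^ ?r) \<le> expectation (\<lambda>w. B ^ k * (D m w)\<^sup>2)"
    proof (rule integral_mono)
      show "integrable M (\<lambda>w. D m w ^ ?r)" "integrable M (\<lambda>w. B ^ k * (D m w)\<^sup>2)"
        by (rule int, rule integrable_mult_right, rule int)
      show "D m w ^ ?r \<le> B ^ k * (D m w)\<^sup>2" if "w \<in> space M" for w
        unfolding power_add using D[OF that, of m] by (intro mult_right_mono power_mono) auto
    qed
    also have "\<dots> \<le> B ^ k * (V * \<rho> ^ (2 * m))"
      using D2[of m] m B by (simp add: mult_left_mono)
    finally have 1: "expectation (\<lambda>w. D m w ^ ?r) \<le> B ^ k * (V * \<rho> ^ (2 * m))" .
    have "expectation (\<lambda>w. D m w ^ ?r) / ((1 - \<kappa>) * \<kappa> ^ m) ^ (k + 1)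
        \<le> B ^ k * (V * \<rho> ^ (2 * m)) / ((1 - \<kappa>) * \<kappa> ^ m) ^ (k + 1)"
      using 1 \<kappa> by (intro divide_right_mono) auto
    also have "\<dots> = (1 / (1 - \<kappa>)) ^ (k + 1) * (B ^ k * V * (\<rho> ^ (2 * m) / (\<kappa> ^ m) ^ (k + 1)))"
    proof -
      have "b * (v * p) / (c * d) ^ j = (1 / c) ^ j * (b * v * (p / d ^ j))" for b v p c d :: real and j
        by (simp add: power_mult_distrib power_one_over)
      then show ?thesis .
    qed
    \<comment> \<open>One of the two factors \<rho>^m equals (\<kappa>^m)^(k+2) and pays for the
      weights; the other one makes the sum over m converge.\<close>
    also have "\<rho> ^ (2 * m) / (\<kappa> ^ m) ^ (k + 1) = \<rho> ^ m * \<kappa> ^ m"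
    proof -
      have "\<rho> ^ m = (\<kappa> ^ m) ^ (k + 1) * \<kappa> ^ m"
        unfolding \<kappa>r[symmetric] by (simp add: power_mult[symmetric] power_add[symmetric] algebra_simps)
      then have "\<rho> ^ (2 * m) = \<rho> ^ m * ((\<kappa> ^ m) ^ (k + 1) * \<kappa> ^ m)" 
        by (simp add: mult_2 power_add)
      then show ?thesis using \<kappa> by simp
    qed
    also have "(1 / (1 - \<kappa>)) ^ (k + 1) * (B ^ k * V * (\<rho> ^ m * \<kappa> ^ m)) \<le> ?c ^ (k + 1) * (B ^ k * V * (\<rho> ^ m * 1))"
      using c c1 \<kappa> \<rho> B V by (intro mult_mono power_mono mult_left_mono power_le_one) auto
    finally show "expectation (\<lambda>w. D m w ^ ?r) / ((1 - \<kappa>) * \<kappa> ^ m) ^ (k + 1) \<le> ?c ^ (k + 1) * B ^ k * V * \<rho> ^ m"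
      by (simp add: mult.assoc)
  qed
  also have "\<dots> = ?c ^ (k + 1) * B ^ k * V * (\<Sum>m<N. \<rho> ^ m)" by (simp add: sum_distrib_left)
  also have "\<dots> \<le> ?c ^ (k + 1) * B ^ k * V * ?c"
  proof (rule mult_left_mono)
    have "(\<Sum>m<N. \<rho> ^ m) \<le> 1 / (1 - \<rho>)" using \<rho> by (simp add: sum_gp_strict divide_right_mono)
    also have "\<dots> \<le> ?c" using \<rho> by (intro divide_right_mono) auto
    finally show "(\<Sum>m<N. \<rho> ^ m) \<le> ?c" .
  qed (use \<rho> B V in auto)
  also have "\<dots> = ?c ^ ?r * B ^ k * V" by simp
  finally show ?thesis .
qed

lemma exp_minus_sums: "(\<lambda>k. (y::real) ^ (k + 2) / fact (k + 2)) sums (exp y - 1 - y)"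
proof -
  have "(\<lambda>n. y ^ n / fact n) sums exp y"
    using exp_converges[of y] by (simp add: divide_inverse mult.commute)
  from sums_split_initial_segment[OF this, of 2] show ?thesis by (simp add: numeral_2_eq_2 diff_diff_eq)
qed

text \<open>The terms of degree at least 2 are compared one by one, while the linear term keeps its
  sign.\<close>

lemma exp_le_of_abs_le:
  assumes "\<bar>y\<bar> \<le> (d::real)" shows "exp y \<le> 1 + y + (exp d - 1 - d)"
proof -
  have "exp y - 1 - y \<le> exp d - 1 - d"
  proof (rule sums_le[OF _ exp_minus_sums exp_minus_sums])
    fix k
    have "y ^ (k + 2) \<le> \<bar>y\<bar> ^ (k + 2)" by (metis abs_ge_self power_abs)
    also have "\<dots> \<le> d ^ (k + 2)" using assms by (intro power_mono) auto
    finally show "y ^ (k + 2) / fact (k + 2) \<le> d ^ (k + 2) / fact (k + 2)" by (intro divide_right_mono) auto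
  qed
  then show ?thesis by simp
qed

text \<open>Integrate the exponential series from degree 2 on, term by term, which non-negativity
  permits. After r^r \<le> r! e^r the moment bounds form a geometric series of ratio \<theta> e B /
  (1 - \<rho>), at most 1/2 by the condition on \<theta>; this is the leading factor 2.\<close>

lemma (in prob_space) exp_sum_geometric_le:
  fixes D :: "nat \<Rightarrow> 'a \<Rightarrow> real"
  assumes [measurable]: "\<And>m. D m \<in> borel_measurable M"
    and D: "\<And>m w. w \<in> space M \<Longrightarrow> 0 \<le> D m w" "\<And>m w. w \<in> space M \<Longrightarrow> D m w \<le> B"
    and D2: "\<And>m. m < N \<Longrightarrow> expectation (\<lambda>w. (D m w)\<^sup>2) \<le> V * \<rho> ^ (2 * m)"
    and \<rho>: "0 < \<rho>" "\<rho> < 1" and V: "0 \<le> V" and B: "0 \<le> B"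
    and \<theta>: "0 \<le> \<theta>" "2 * exp 1 * \<theta> * B \<le> 1 - \<rho>"
  defines "S \<equiv> \<lambda>w. \<theta> * (\<Sum>m<N. D m w)"
  shows "expectation (\<lambda>w. exp (S w) - 1 - S w) \<le> 2 * (\<theta> * exp 1 / (1 - \<rho>))\<^sup>2 * V"
proof -
  let ?a = "\<theta> * exp 1 / (1 - \<rho>)"
  have a0: "0 \<le> ?a" using \<theta> \<rho> by simp
  have aB: "?a * B \<le> 1 / 2" "0 \<le> ?a * B" using \<theta> \<rho> B by (auto simp: field_simps)
  have [measurable]: "S \<in> borel_measurable M" unfolding S_def by simp
  have S: "0 \<le> S w" "S w \<le> \<theta> * (real N * B)" if "w \<in> space M" for w
    using D[OF that] \<theta> sum_bounded_above[of "{..<N}" "\<lambda>m. D m w" B] unfolding S_def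
    by (auto simp: sum_nonneg intro!: mult_left_mono)
  have intS: "integrable M (\<lambda>w. S w ^ j / fact j)" for j
    using S by (intro integrable_bounded[of _ "(\<theta> * (real N * B)) ^ j / fact j"])
      (auto simp: power_mono divide_right_mono)
  have mom: "expectation (\<lambda>w. S w ^ (k + 2) / fact (k + 2)) \<le> ?a\<^sup>2 * V * (?a * B) ^ k" for k
  proof -
    have split2: "(t / c) ^ (k + 2) * (B ^ k * V) * e ^ (k + 2) = (t * e / c)\<^sup>2 * V * (t * e / c * B) ^ k"
      for t c e :: real
      by (cases "c = 0") (simp_all add: power_add power_mult_distrib power_divide power2_eq_square field_simps)
    have split: "a ^ n * ((b / c) ^ n * x * y) / d = (a / c) ^ n * (x * y) * (b ^ n / d)"
      for a b c d x y :: real and n by (simp add: power_divide)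
    have "expectation (\<lambda>w. S w ^ (k + 2) / fact (k + 2)) = \<theta> ^ (k + 2) * expectation (\<lambda>w. (\<Sum>m<N. D m w) ^ (k + 2)) / fact (k + 2)"
      unfolding S_def power_mult_distrib by simp
    also have "\<dots> \<le> \<theta> ^ (k + 2) * ((real (k + 2) / (1 - \<rho>)) ^ (k + 2) * B ^ k * V) / fact (k + 2)"
      using \<theta> by (intro divide_right_mono mult_left_mono moment_sum_geometric_le[OF _ D D2 \<rho> V B]) auto
    also have "\<dots> = (\<theta> / (1 - \<rho>)) ^ (k + 2) * (B ^ k * V) * (real (k + 2) ^ (k + 2) / fact (k + 2))"
      by (rule split)
    also have "\<dots> \<le> (\<theta> / (1 - \<rho>)) ^ (k + 2) * (B ^ k * V) * exp (real (k + 2))"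
      using power_self_le_fact_exp[of "k + 2"] \<theta> \<rho> B V 
      by (intro mult_left_mono) (auto simp: divide_le_eq mult.commute)
    also have "exp (real (k + 2)) = exp 1 ^ (k + 2)" using exp_of_nat_mult[of "k + 2" "1::real"] by simp
    also have "(\<theta> / (1 - \<rho>)) ^ (k + 2) * (B ^ k * V) * exp 1 ^ (k + 2) = ?a\<^sup>2 * V * (?a * B) ^ k"
      by (rule split2)
    finally show ?thesis .
  qed
  have geo: "(\<lambda>k. ?a\<^sup>2 * V * (?a * B) ^ k) sums (?a\<^sup>2 * V * (1 / (1 - ?a * B)))"
  proof (intro sums_mult geometric_sums)
    show "norm (?a * B) < 1" unfolding real_norm_def abs_of_nonneg[OF aB(2)] using aB(1) by linarith
  qed
  have nn: "exp y - 1 - y \<ge> 0" for y :: real using exp_ge_add_one_self[of y] by linarith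
  have "ennreal (expectation (\<lambda>w. exp (S w) - 1 - S w)) = (\<integral>\<^sup>+w. ennreal (exp (S w) - 1 - S w) \<partial>M)"
  proof (rule nn_integral_eq_integral[symmetric])
    have "integrable M (\<lambda>w. exp (S w))"
      using S by (intro integrable_bounded[of _ "exp (\<theta> * (real N * B))"]) auto
    moreover have "integrable M S" using intS[of 1] by simp
    ultimately show "integrable M (\<lambda>w. exp (S w) - 1 - S w)" by simp
  qed (use nn in auto)
  also have "\<dots> = (\<integral>\<^sup>+w. (\<Sum>k. ennreal (S w ^ (k + 2) / fact (k + 2))) \<partial>M)"
    using S by (intro nn_integral_cong suminf_ennreal_eq[symmetric] exp_minus_sums) auto
  also have "\<dots> = (\<Sum>k. \<integral>\<^sup>+w. ennreal (S w ^ (k + 2) / fact (k + 2)) \<partial>M)"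
    by (rule nn_integral_suminf) auto
  also have "\<dots> = (\<Sum>k. ennreal (expectation (\<lambda>w. S w ^ (k + 2) / fact (k + 2))))"
    using S by (intro suminf_cong nn_integral_eq_integral intS) auto
  also have "\<dots> \<le> (\<Sum>k. ennreal (?a\<^sup>2 * V * (?a * B) ^ k))"
    using mom by (intro suminf_le summableI ennreal_leI) auto
  also have "\<dots> = ennreal (?a\<^sup>2 * V * (1 / (1 - ?a * B)))"
    using V aB by (intro suminf_ennreal_eq geo) auto
  finally have *: "ennreal (expectation (\<lambda>w. exp (S w) - 1 - S w)) \<le> ennreal (?a\<^sup>2 * V * (1 / (1 - ?a * B)))" .
  have inv: "0 \<le> 1 / (1 - x)" "1 / (1 - x) \<le> 2" if "x \<le> 1 / 2" for x :: real
    using that by (auto simp: field_simps)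
  have "expectation (\<lambda>w. exp (S w) - 1 - S w) \<le> ?a\<^sup>2 * V * (1 / (1 - ?a * B))"
    using * V inv(1)[OF aB(1)] by (subst (asm) ennreal_le_iff) (auto intro!: mult_nonneg_nonneg simp del: times_divide_eq_right)
  also have "\<dots> \<le> ?a\<^sup>2 * V * 2"
    using inv(2)[OF aB(1)] V by (intro mult_left_mono) auto
  finally show ?thesis by (simp add: mult_ac)
qed

text \<open>By Jensen, the centred variable may be replaced by the difference of two independent copies.\<close>

lemma (in prob_space) centred_mgf_le:
  fixes f :: "'a \<Rightarrow> real" and u :: "nat \<Rightarrow> 'a \<Rightarrow> real"
  assumes [measurable]: "f \<in> borel_measurable M" "\<And>m. u m \<in> borel_measurable M"
    and f: "\<And>z. z \<in> space M \<Longrightarrow> \<bar>f z\<bar> \<le> F"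
    and u: "\<And>m z. z \<in> space M \<Longrightarrow> 0 \<le> u m z"
    and diff: "\<And>z z'. z \<in> space M \<Longrightarrow> z' \<in> space M \<Longrightarrow> \<bar>f z - f z'\<bar> \<le> (\<Sum>m<N. min B (u m z + u m z'))"
    and int: "\<And>m. m < N \<Longrightarrow> integrable M (\<lambda>z. (u m z)\<^sup>2)"
    and u2: "\<And>m. m < N \<Longrightarrow> expectation (\<lambda>z. (u m z)\<^sup>2) \<le> V * \<rho> ^ (2 * m)"
    and \<rho>: "0 < \<rho>" "\<rho> < 1" and V: "0 \<le> V" and B: "0 \<le> B"
    and \<theta>: "0 \<le> \<theta>" "2 * exp 1 * \<theta> * B \<le> 1 - \<rho>"
  shows "expectation (\<lambda>z. exp (\<theta> * (f z - expectation f))) \<le> exp (8 * (\<theta> * exp 1 / (1 - \<rho>))\<^sup>2 * V)"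
proof -
  interpret P: pair_prob_space M M ..
  let ?P = "M \<Otimes>\<^sub>M M"
  define D where "D = (\<lambda>m w. min B (u m (fst w) + u m (snd w)))"
  have [measurable]: "D m \<in> borel_measurable ?P" for m unfolding D_def by simp
  have D: "0 \<le> D m w" "D m w \<le> B" if "w \<in> space ?P" for m w
    using that u B by (auto simp: D_def space_pair_measure)
  have fstE: "integrable ?P (\<lambda>w. h (fst w))" "integral\<^sup>L ?P (\<lambda>w. h (fst w)) = expectation h"
    and sndE: "integrable ?P (\<lambda>w. h (snd w))" "integral\<^sup>L ?P (\<lambda>w. h (snd w)) = expectation h"
    if h: "integrable M h" for h :: "'a \<Rightarrow> real"
  proof -
    have d: "distr ?P M fst = M" by (rule distr_pair_fst)
    have d2: "distr ?P M snd = M" 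
    proof -
      have "distr ?P M snd = distr (distr ?P ?P (\<lambda>(x, y). (y, x))) M fst"
        by (subst distr_distr) (auto simp: comp_def case_prod_beta)
      also have "\<dots> = M" using P.distr_pair_swap d by simp
      finally show ?thesis .
    qed
    have [measurable]: "h \<in> borel_measurable M" using h by simp
    show "integrable ?P (\<lambda>w. h (fst w))" using h by (subst integrable_distr_eq[of fst ?P M h, symmetric]) (auto simp: d)
    show "integrable ?P (\<lambda>w. h (snd w))" using h by (subst integrable_distr_eq[of snd ?P M h, symmetric]) (auto simp: d2)
    show "integral\<^sup>L ?P (\<lambda>w. h (fst w)) = expectation h" using integral_distr[of fst ?P M h] by (simp add: d)
    show "integral\<^sup>L ?P (\<lambda>w. h (snd w)) = expectation h" using integral_distr[of snd ?P M h] by (simp add: d2)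
  qed
  have D2: "integral\<^sup>L ?P (\<lambda>w. (D m w)\<^sup>2) \<le> (4 * V) * \<rho> ^ (2 * m)" if m: "m < N" for m
  proof -
    have "integral\<^sup>L ?P (\<lambda>w. (D m w)\<^sup>2) \<le> integral\<^sup>L ?P (\<lambda>w. 2 * (u m (fst w))\<^sup>2 + 2 * (u m (snd w))\<^sup>2)"
    proof (rule integral_mono)
      show "integrable ?P (\<lambda>w. (D m w)\<^sup>2)"
        using D by (intro P.P.integrable_bounded[of _ "B\<^sup>2"]) (auto simp: power_mono)
      show "integrable ?P (\<lambda>w. 2 * (u m (fst w))\<^sup>2 + 2 * (u m (snd w))\<^sup>2)"
        using fstE(1)[OF int[OF m]] sndE(1)[OF int[OF m]] by simp
      fix w assume w: "w \<in> space ?P"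
      have "(D m w)\<^sup>2 \<le> (u m (fst w) + u m (snd w))\<^sup>2"
        using D(1)[OF w, of m] by (intro power_mono) (auto simp: D_def)
      also have "\<dots> \<le> 2 * (u m (fst w))\<^sup>2 + 2 * (u m (snd w))\<^sup>2"
        using sum_squares_bound[of "u m (fst w)" "u m (snd w)"] by (simp add: power2_sum)
      finally show "(D m w)\<^sup>2 \<le> 2 * (u m (fst w))\<^sup>2 + 2 * (u m (snd w))\<^sup>2" .
    qed
    also have "\<dots> = 4 * expectation (\<lambda>z. (u m z)\<^sup>2)"
      using fstE[OF int[OF m]] sndE[OF int[OF m]] by simp
    finally show ?thesis using u2[OF m] by simp
  qed
  let ?S = "\<lambda>w. \<theta> * (\<Sum>m<N. D m w)"
  \<comment> \<open>The 8 of the conclusion is this 2 times the 4 lost in squaring the sum of two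
    copies.\<close>
  have "integral\<^sup>L ?P (\<lambda>w. exp (?S w) - 1 - ?S w) \<le> 2 * (\<theta> * exp 1 / (1 - \<rho>))\<^sup>2 * (4 * V)"
    using V by (intro P.P.exp_sum_geometric_le[OF _ D D2 \<rho> _ B \<theta>]) auto
  then have psi: "integral\<^sup>L ?P (\<lambda>w. exp (?S w) - 1 - ?S w) \<le> 8 * (\<theta> * exp 1 / (1 - \<rho>))\<^sup>2 * V" by simp
  let ?c = "expectation f"
  have intf: "integrable M f" using f by (intro integrable_bounded[of _ F]) auto
  have inte: "integrable M (\<lambda>z. exp (\<sigma> * (f z - ?c)))" if "\<bar>\<sigma>\<bar> \<le> \<theta>" for \<sigma>
  proof (rule integrable_bounded[of _ "exp (\<theta> * (F + \<bar>?c\<bar>))"])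
    fix z assume "z \<in> space M"
    then have "\<bar>f z - ?c\<bar> \<le> F + \<bar>?c\<bar>" using f[of z] by linarith
    then have "\<bar>\<sigma> * (f z - ?c)\<bar> \<le> \<theta> * (F + \<bar>?c\<bar>)" unfolding abs_mult using that by (intro mult_mono) auto
    then show "\<bar>exp (\<sigma> * (f z - ?c))\<bar> \<le> exp (\<theta> * (F + \<bar>?c\<bar>))" by simp
  qed simp
  have ip: "integrable M (\<lambda>z. exp (\<theta> * (f z - ?c)))" using inte[of \<theta>] \<theta> by simp
  have im: "integrable M (\<lambda>z. exp (- \<theta> * (f z - ?c)))" using inte[of "-\<theta>"] \<theta> by simp
  have "1 = expectation (\<lambda>z. 1 + - \<theta> * (f z - ?c))" using intf by (simp add: prob_space)
  also have "\<dots> \<le> expectation (\<lambda>z. exp (- \<theta> * (f z - ?c)))"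
    using intf im by (intro integral_mono exp_ge_add_one_self) auto
  \<comment> \<open>Multiplying by this factor turns the moment generating function into that of a
    difference of two independent copies.\<close>
  finally have one: "1 \<le> expectation (\<lambda>z. exp (- \<theta> * (f z - ?c)))" .
  have S: "0 \<le> (\<Sum>m<N. D m w)" "(\<Sum>m<N. D m w) \<le> real N * B" if "w \<in> space ?P" for w
    using D[OF that] sum_bounded_above[of "{..<N}" "\<lambda>m. D m w" B] by (auto simp: sum_nonneg)
  have "integrable ?P (\<lambda>w. exp (?S w))"
    using S \<theta> by (intro P.P.integrable_bounded[of _ "exp (\<theta> * (real N * B))"]) (auto intro: mult_left_mono)
  moreover have "integrable ?P (\<lambda>w. \<Sum>m<N. D m w)"
    using S by (intro P.P.integrable_bounded[of _ "real N * B"]) auto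
  ultimately have psint: "integrable ?P (\<lambda>w. exp (?S w) - 1 - ?S w)"
    by (intro Bochner_Integration.integrable_diff integrable_mult_right) auto
  have fint: "integrable ?P (\<lambda>w. \<theta> * (f (fst w) - f (snd w)))"
    using fstE(1)[OF intf] sndE(1)[OF intf] by auto
  have fzero: "integral\<^sup>L ?P (\<lambda>w. \<theta> * (f (fst w) - f (snd w))) = 0"
    using fstE[OF intf] sndE[OF intf] by simp
  have "expectation (\<lambda>z. exp (\<theta> * (f z - ?c))) * 1 \<le>
      expectation (\<lambda>z. exp (\<theta> * (f z - ?c))) * expectation (\<lambda>z. exp (- \<theta> * (f z - ?c)))"
    using one by (intro mult_left_mono) (auto intro: integral_nonneg)
  also have "\<dots> = integral\<^sup>L ?P (\<lambda>w. exp (\<theta> * (f (fst w) - ?c)) * exp (- \<theta> * (f (snd w) - ?c)))"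
  proof -
    have "integrable ?P (\<lambda>w. exp (\<theta> * (f (fst w) - ?c)) * exp (- \<theta> * (f (snd w) - ?c)))"
    proof (rule P.P.integrable_bounded[of _ "exp (\<theta> * (2 * F))"])
      fix w assume "w \<in> space ?P"
      then have "f (fst w) - f (snd w) \<le> 2 * F" using f[of "fst w"] f[of "snd w"] by (auto simp: space_pair_measure)
      then have "\<theta> * (f (fst w) - ?c) + - \<theta> * (f (snd w) - ?c) \<le> \<theta> * (2 * F)"
        using \<theta> mult_left_mono[of "f (fst w) - f (snd w)" "2 * F" \<theta>] by (simp add: algebra_simps)
      then show "\<bar>exp (\<theta> * (f (fst w) - ?c)) * exp (- \<theta> * (f (snd w) - ?c))\<bar> \<le> exp (\<theta> * (2 * F))"
        unfolding exp_add[symmetric] by simp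
    qed simp
    from P.integral_fst'[OF this] show ?thesis by simp
  qed
  also have "\<dots> = integral\<^sup>L ?P (\<lambda>w. exp (\<theta> * (f (fst w) - f (snd w))))"
    by (simp add: exp_add[symmetric] algebra_simps)
  \<comment> \<open>The first-order term stays signed, so that by symmetry it integrates to 0; only
    the higher orders are replaced by those of the dominating sum.\<close>
  also have "\<dots> \<le> integral\<^sup>L ?P (\<lambda>w. 1 + \<theta> * (f (fst w) - f (snd w)) + (exp (?S w) - 1 - ?S w))"
  proof (rule integral_mono)
    show "integrable ?P (\<lambda>w. 1 + \<theta> * (f (fst w) - f (snd w)) + (exp (?S w) - 1 - ?S w))"
      using fint psint by (intro Bochner_Integration.integrable_add) auto
    show "integrable ?P (\<lambda>w. exp (\<theta> * (f (fst w) - f (snd w))))"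
    proof (rule P.P.integrable_bounded[of _ "exp (\<theta> * (2 * F))"])
      fix w assume "w \<in> space ?P"
      then have "f (fst w) - f (snd w) \<le> 2 * F" using f[of "fst w"] f[of "snd w"] by (auto simp: space_pair_measure)
      then show "\<bar>exp (\<theta> * (f (fst w) - f (snd w)))\<bar> \<le> exp (\<theta> * (2 * F))"
        using \<theta> by (simp add: mult_left_mono)
    qed simp
    fix w assume w: "w \<in> space ?P"
    have "\<bar>f (fst w) - f (snd w)\<bar> \<le> (\<Sum>m<N. D m w)"
      using diff[of "fst w" "snd w"] w by (auto simp: D_def space_pair_measure)
    then have "\<bar>\<theta> * (f (fst w) - f (snd w))\<bar> \<le> ?S w"
      using \<theta> by (simp add: abs_mult mult_left_mono)
    then show "exp (\<theta> * (f (fst w) - f (snd w))) \<le> 1 + \<theta> * (f (fst w) - f (snd w)) + (exp (?S w) - 1 - ?S w)"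
      by (rule exp_le_of_abs_le)
  qed
  also have "\<dots> = 1 + integral\<^sup>L ?P (\<lambda>w. exp (?S w) - 1 - ?S w)"
  proof -
    have "integral\<^sup>L ?P (\<lambda>w. 1 + g w + h w) = 1 + integral\<^sup>L ?P g + integral\<^sup>L ?P h"
      if "integrable ?P g" "integrable ?P h" for g h :: "'a \<times> 'a \<Rightarrow> real"
      using that by (simp add: P.P.prob_space)
    from this[OF fint psint] fzero show ?thesis by linarith
  qed
  also have "\<dots> \<le> 1 + 8 * (\<theta> * exp 1 / (1 - \<rho>))\<^sup>2 * V" using psi by simp
  also have "\<dots> \<le> exp (8 * (\<theta> * exp 1 / (1 - \<rho>))\<^sup>2 * V)" by (rule exp_ge_add_one_self)
  finally show ?thesis by simp
qed

section \<open>Concentration for linear autoregressive chains\<close>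

text \<open>Conditioning by Fubini: Y is integrated out with X fixed. Independence is expressed
  through the joint law because X will be a whole history and Y a single innovation vector, which
  have different types.\<close>

lemma (in prob_space) nn_integral_product_law:
  assumes [measurable]: "X \<in> M \<rightarrow>\<^sub>M S" "Y \<in> M \<rightarrow>\<^sub>M T"
    and d: "distr M S X \<Otimes>\<^sub>M distr M T Y = distr M (S \<Otimes>\<^sub>M T) (\<lambda>x. (X x, Y x))"
    and [measurable]: "F \<in> borel_measurable (S \<Otimes>\<^sub>M T)"
  shows "(\<integral>\<^sup>+\<omega>. F (X \<omega>, Y \<omega>) \<partial>M) = (\<integral>\<^sup>+\<omega>. (\<integral>\<^sup>+y. F (X \<omega>, y) \<partial>distr M T Y) \<partial>M)"
proof -
  interpret Y: prob_space "distr M T Y" by (rule prob_space_distr) simp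
  have "(\<integral>\<^sup>+\<omega>. F (X \<omega>, Y \<omega>) \<partial>M) = (\<integral>\<^sup>+z. F z \<partial>(distr M S X \<Otimes>\<^sub>M distr M T Y))"
    unfolding d by (subst nn_integral_distr) auto
  also have "\<dots> = (\<integral>\<^sup>+x. (\<integral>\<^sup>+y. F (x, y) \<partial>distr M T Y) \<partial>distr M S X)"
    by (subst Y.nn_integral_fst[symmetric]) auto
  also have "\<dots> = (\<integral>\<^sup>+\<omega>. (\<integral>\<^sup>+y. F (X \<omega>, y) \<partial>distr M T Y) \<partial>M)"
    by (subst nn_integral_distr) auto
  finally show ?thesis .
qed

lemma (in prob_space) integral_product_law:
  fixes F :: "_ \<Rightarrow> real"
  assumes [measurable]: "X \<in> M \<rightarrow>\<^sub>M S" "Y \<in> M \<rightarrow>\<^sub>M T"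
    and d: "distr M S X \<Otimes>\<^sub>M distr M T Y = distr M (S \<Otimes>\<^sub>M T) (\<lambda>x. (X x, Y x))"
    and [measurable]: "F \<in> borel_measurable (S \<Otimes>\<^sub>M T)"
    and F: "\<And>z. z \<in> space (S \<Otimes>\<^sub>M T) \<Longrightarrow> \<bar>F z\<bar> \<le> B"
  shows "(\<integral>\<omega>. F (X \<omega>, Y \<omega>) \<partial>M) = (\<integral>\<omega>. (\<integral>y. F (X \<omega>, y) \<partial>distr M T Y) \<partial>M)"
proof -
  interpret Y: prob_space "distr M T Y" by (rule prob_space_distr) simp
  interpret X: prob_space "distr M S X" by (rule prob_space_distr) simp
  interpret XY: pair_prob_space "distr M S X" "distr M T Y" ..
  have "(\<integral>\<omega>. F (X \<omega>, Y \<omega>) \<partial>M) = (\<integral>z. F z \<partial>(distr M S X \<Otimes>\<^sub>M distr M T Y))"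
    unfolding d by (subst integral_distr) auto
  also have "\<dots> = (\<integral>x. (\<integral>y. F (x, y) \<partial>distr M T Y) \<partial>distr M S X)"
    using F by (intro XY.integral_fst'[symmetric] XY.P.integrable_bounded[of _ B]) (auto simp: space_pair_measure)
  also have "\<dots> = (\<integral>\<omega>. (\<integral>y. F (X \<omega>, y) \<partial>distr M T Y) \<partial>M)"
    by (subst integral_distr) auto
  finally show ?thesis .
qed

section \<open>Linear autoregressive chains and the propagation of perturbations\<close>

abbreviation vspace :: "nat \<Rightarrow> (nat \<Rightarrow> real) measure" where
  "vspace p \<equiv> \<Pi>\<^sub>M _\<in>{..<p}. borel"

text \<open>The restriction to \<open>{..<p}\<close> makes the new state an element of the product
  space \<open>vspace p\<close>.\<close>

definition var_step :: "nat \<Rightarrow> (nat \<Rightarrow> nat \<Rightarrow> real) \<Rightarrow> (nat \<Rightarrow> real) \<Rightarrow> (nat \<Rightarrow> real) \<Rightarrow> nat \<Rightarrow> real" where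
  "var_step p a x e = (\<lambda>i\<in>{..<p}. (\<Sum>k<p. a i k * x k) + e i)"

lemma measurable_var_step [measurable (raw)]:
  assumes [measurable]: "f \<in> N \<rightarrow>\<^sub>M vspace p" "g \<in> N \<rightarrow>\<^sub>M vspace p"
  shows "(\<lambda>x. var_step p a (f x) (g x)) \<in> N \<rightarrow>\<^sub>M vspace p"
  unfolding var_step_def
proof (rule measurable_restrict)
  fix i assume i: "i \<in> {..<p}"
  have [measurable]: "(\<lambda>x. f x k) \<in> borel_measurable N" "(\<lambda>x. g x k) \<in> borel_measurable N" if "k < p" for k
    using that measurable_compose[OF assms(1) measurable_component_singleton[of k "{..<p}" "\<lambda>_. borel"]]
      measurable_compose[OF assms(2) measurable_component_singleton[of k "{..<p}" "\<lambda>_. borel"]] by auto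
  show "(\<lambda>x. (\<Sum>k<p. a i k * f x k) + g x i) \<in> borel_measurable N"
    using i by (intro borel_measurable_add borel_measurable_sum borel_measurable_times) auto
qed

text \<open>The abstract chain: \<open>c m\<close> is the m-th power of the transition matrix
  \<open>a\<close>, and \<open>e l\<close> drives the step from l to l + 1. Independence is required
  from the whole history up to l, because the partial sums in the exponent depend on all of it. The
  bounds \<open>G\<close> and \<open>G0\<close> are separate since the initial state carries the
  accumulated noise of the past.\<close>

locale var_chain = prob_space M for M :: "'a measure" +
  fixes p :: nat and a :: "nat \<Rightarrow> nat \<Rightarrow> real" and c :: "nat \<Rightarrow> nat \<Rightarrow> nat \<Rightarrow> real"
    and \<eta> :: "(nat \<Rightarrow> real) measure" and x e :: "nat \<Rightarrow> 'a \<Rightarrow> nat \<Rightarrow> real"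
    and \<rho> G G0 :: real
  assumes c_0: "\<And>i k. i < p \<Longrightarrow> k < p \<Longrightarrow> c 0 i k = (if i = k then 1 else 0)"
    and c_Suc: "\<And>m i l. i < p \<Longrightarrow> l < p \<Longrightarrow> c (Suc m) i l = (\<Sum>k<p. c m i k * a k l)"
    and x_meas [measurable]: "\<And>l. x l \<in> M \<rightarrow>\<^sub>M vspace p"
    and x_step: "\<And>l \<omega>. \<omega> \<in> space M \<Longrightarrow> x (Suc l) \<omega> = var_step p a (x l \<omega>) (e l \<omega>)"
    and e_meas [measurable]: "\<And>l. e l \<in> M \<rightarrow>\<^sub>M vspace p"
    and indep: "\<And>l. distr M (\<Pi>\<^sub>M _\<in>{..l}. vspace p) (\<lambda>\<omega>. \<lambda>i\<in>{..l}. x i \<omega>) \<Otimes>\<^sub>M distr M (vspace p) (e l)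
      = distr M ((\<Pi>\<^sub>M _\<in>{..l}. vspace p) \<Otimes>\<^sub>M vspace p) (\<lambda>\<omega>. (\<lambda>i\<in>{..l}. x i \<omega>, e l \<omega>))"
    and e_distr: "\<And>l. distr M (vspace p) (e l) = \<eta>"
    and \<rho>: "0 < \<rho>" "\<rho> < 1" and G0: "0 \<le> G0"
    and e_moment: "\<And>m i. i < p \<Longrightarrow> integrable \<eta> (\<lambda>y. (\<Sum>l<p. c m i l * y l)\<^sup>2) \<and>
      (\<integral>y. (\<Sum>l<p. c m i l * y l)\<^sup>2 \<partial>\<eta>) \<le> G * \<rho> ^ (2 * m)"
    and x_moment: "\<And>m i. i < p \<Longrightarrow> integrable M (\<lambda>\<omega>. (\<Sum>l<p. c m i l * x 0 \<omega> l)\<^sup>2) \<and>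
      expectation (\<lambda>\<omega>. (\<Sum>l<p. c m i l * x 0 \<omega> l)\<^sup>2) \<le> G0 * \<rho> ^ (2 * m)"
begin

lemma prob_space_\<eta>: "prob_space \<eta>"
  unfolding e_distr[of 0, symmetric] by (rule prob_space_distr) simp

sublocale \<eta>: prob_space \<eta> by (rule prob_space_\<eta>)

lemma sets_\<eta> [measurable_cong, simp]: "sets \<eta> = sets (vspace p)"
  unfolding e_distr[of 0, symmetric] by simp

lemma space_\<eta> [simp]: "space \<eta> = space (vspace p)"
  by (rule sets_eq_imp_space_eq) simp

text \<open>The effect on coordinate i, m steps later, of a perturbation d of the state.\<close>

definition R :: "nat \<Rightarrow> nat \<Rightarrow> (nat \<Rightarrow> real) \<Rightarrow> real" where
  "R m i d = (\<Sum>l<p. c m i l * d l)"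

lemma R_measurable [measurable]: "R m i \<in> borel_measurable (vspace p)"
  unfolding R_def by (intro borel_measurable_sum borel_measurable_times measurable_component_singleton) auto

lemma R_0: "i < p \<Longrightarrow> R 0 i d = d i"
  unfolding R_def using c_0 by (simp add: if_distrib[of "\<lambda>z. z * _"] cong: if_cong)

lemma R_diff: "R m i (\<lambda>l. d l - d' l) = R m i d - R m i d'"
  unfolding R_def by (simp add: right_diff_distrib sum_subtractf)

lemma R_Suc: 
  assumes i: "i < p" shows "R (Suc m) i d = R m i (\<lambda>k. \<Sum>l<p. a k l * d l)"
proof -
  have "R (Suc m) i d = (\<Sum>l<p. \<Sum>k<p. c m i k * (a k l * d l))"
    unfolding R_def using i c_Suc by (simp add: sum_distrib_right mult.assoc)
  also have "\<dots> = (\<Sum>k<p. \<Sum>l<p. c m i k * (a k l * d l))" by (rule sum.swap)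
  finally show ?thesis unfolding R_def by (simp add: sum_distrib_left)
qed

lemma R_cong: "(\<And>l. l < p \<Longrightarrow> d l = d' l) \<Longrightarrow> R m i d = R m i d'"
  unfolding R_def by (intro sum.cong) auto

text \<open>Coupling: two chains driven by the same innovation differ by a linear image of the
  earlier difference, as the noise cancels.\<close>

lemma R_step_same_noise:
  assumes "i < p"
  shows "R m i (var_step p a z y) - R m i (var_step p a z' y) = R (Suc m) i z - R (Suc m) i z'"
proof -
  have "R m i (var_step p a z y) - R m i (var_step p a z' y) = R m i (\<lambda>k. \<Sum>l<p. a k l * (z l - z' l))"
    unfolding R_diff[symmetric] by (rule R_cong) (simp add: var_step_def right_diff_distrib sum_subtractf)
  also have "\<dots> = R (Suc m) i (\<lambda>l. z l - z' l)" using R_Suc[OF assms] by simp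
  finally show ?thesis unfolding R_diff .
qed

lemma R_step_same_state:
  "R m i (var_step p a z y) - R m i (var_step p a z y') = R m i y - R m i y'"
  unfolding R_diff[symmetric] by (rule R_cong) (simp add: var_step_def)

end

text \<open>The Lipschitz condition is general enough for both lags: a product z_j z_k of one state
  and a product z_j y_k of consecutive states. The bound is B / 2, so that differences are at most
  B.\<close>

locale var_chain_fun = var_chain +
  fixes g :: "(nat \<Rightarrow> real) \<Rightarrow> (nat \<Rightarrow> real) \<Rightarrow> real" and j k :: nat and B \<nu> :: real
  assumes jk: "j < p" "k < p"
    and g_meas: "(\<lambda>(z, y). g z y) \<in> borel_measurable (vspace p \<Otimes>\<^sub>M vspace p)"
    and g_bound: "\<And>z y. \<bar>g z y\<bar> \<le> B / 2"
    and g_lip: "\<And>z y z' y'. \<bar>g z y - g z' y'\<bar> \<le> \<nu> * (\<bar>z j - z' j\<bar> + \<bar>z k - z' k\<bar> + \<bar>y k - y' k\<bar>)"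
    and \<nu>: "0 \<le> \<nu>"
begin

lemma g_measurable [measurable (raw)]:
  assumes "f1 \<in> N \<rightarrow>\<^sub>M vspace p" "f2 \<in> N \<rightarrow>\<^sub>M vspace p"
  shows "(\<lambda>x. g (f1 x) (f2 x)) \<in> borel_measurable N"
  using measurable_compose[OF measurable_Pair[OF assms] g_meas] by simp

lemma B_nonneg: "0 \<le> B" using g_bound[of undefined undefined] by linarith

text \<open>\<open>h m z\<close> is the conditional mean of the summand \<open>m\<close> steps ahead given the current state \<open>z\<close>, and \<open>W\<close> below
  collects everything that depends on the next innovation.\<close>

fun h :: "nat \<Rightarrow> (nat \<Rightarrow> real) \<Rightarrow> real" where
  "h 0 z = (\<integral>y. g z (var_step p a z y) \<partial>\<eta>)"
| "h (Suc m) z = (\<integral>y. h m (var_step p a z y) \<partial>\<eta>)"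

lemma h_measurable [measurable]: "h m \<in> borel_measurable (vspace p)"
proof (induction m)
  case 0
  have "(\<lambda>z. \<integral>y. g z (var_step p a z y) \<partial>\<eta>) \<in> borel_measurable (vspace p)"
    by (rule \<eta>.borel_measurable_lebesgue_integral) (simp add: split_beta')
  then show ?case by (simp cong: measurable_cong)
next
  case (Suc m)
  note [measurable] = Suc
  have "(\<lambda>z. \<integral>y. h m (var_step p a z y) \<partial>\<eta>) \<in> borel_measurable (vspace p)"
    by (rule \<eta>.borel_measurable_lebesgue_integral) (simp add: split_beta')
  then show ?case by (simp cong: measurable_cong)
qed

lemma abs_integral_\<eta>_le:
  fixes b :: real
  assumes [measurable]: "f \<in> borel_measurable (vspace p)" and f: "\<And>y. y \<in> space (vspace p) \<Longrightarrow> \<bar>f y\<bar> \<le> b"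
  shows "integrable \<eta> f" "\<bar>\<integral>y. f y \<partial>\<eta>\<bar> \<le> b"
proof -
  show i: "integrable \<eta> f" using f by (intro \<eta>.integrable_bounded[of _ b]) auto
  have "\<bar>\<integral>y. f y \<partial>\<eta>\<bar> \<le> (\<integral>y. \<bar>f y\<bar> \<partial>\<eta>)" by (rule integral_abs_bound)
  also have "\<dots> \<le> (\<integral>y. b \<partial>\<eta>)" using i f by (intro integral_mono) auto
  finally show "\<bar>\<integral>y. f y \<partial>\<eta>\<bar> \<le> b" by (simp add: \<eta>.prob_space del: space_\<eta>)
qed

lemma var_step_space: "var_step p a z y \<in> space (vspace p)"
  by (auto simp: var_step_def space_PiM)

lemma abs_h_le: "z \<in> space (vspace p) \<Longrightarrow> \<bar>h m z\<bar> \<le> B / 2"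
proof (induction m arbitrary: z)
  case 0
  show ?case unfolding h.simps
  proof (rule abs_integral_\<eta>_le(2))
    show "(\<lambda>y. g z (var_step p a z y)) \<in> borel_measurable (vspace p)" using 0 by simp
  qed (rule g_bound)
next
  case (Suc m)
  show ?case unfolding h.simps
  proof (rule abs_integral_\<eta>_le(2))
    show "(\<lambda>y. h m (var_step p a z y)) \<in> borel_measurable (vspace p)" using Suc(2) by simp
  qed (rule Suc(1)[OF var_step_space])
qed

lemma h_step_integrable:
  assumes z: "z \<in> space (vspace p)"
  shows "integrable \<eta> (\<lambda>y. h m (var_step p a z y))" "integrable \<eta> (\<lambda>y. g z (var_step p a z y))"
proof -
  show "integrable \<eta> (\<lambda>y. h m (var_step p a z y))"
    using z abs_h_le[OF var_step_space] by (intro abs_integral_\<eta>_le(1)[of _ "B / 2"]) auto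
  show "integrable \<eta> (\<lambda>y. g z (var_step p a z y))"
    using z g_bound by (intro abs_integral_\<eta>_le(1)[of _ "B / 2"]) auto
qed

text \<open>Both starting points are advanced with the same innovation, so each integration turns
  \<open>R m\<close> into \<open>R (Suc m)\<close>. The third term is one step later because g also
  looks at the successor state.\<close>

lemma h_lip:
  assumes "z \<in> space (vspace p)" "z' \<in> space (vspace p)"
  shows "\<bar>h m z - h m z'\<bar> \<le> \<nu> * (\<bar>R m j z - R m j z'\<bar> + \<bar>R m k z - R m k z'\<bar> + \<bar>R (Suc m) k z - R (Suc m) k z'\<bar>)"
  using assms
proof (induction m arbitrary: z z')
  case 0
  note i = h_step_integrable(2)[OF 0(1)] h_step_integrable(2)[OF 0(2)]
  have "\<bar>h 0 z - h 0 z'\<bar> = \<bar>\<integral>y. g z (var_step p a z y) - g z' (var_step p a z' y) \<partial>\<eta>\<bar>"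
    using i by simp
  also have "\<dots> \<le> \<nu> * (\<bar>R 0 j z - R 0 j z'\<bar> + \<bar>R 0 k z - R 0 k z'\<bar> + \<bar>R (Suc 0) k z - R (Suc 0) k z'\<bar>)"
  proof (rule abs_integral_\<eta>_le(2))
    fix y
    show "\<bar>g z (var_step p a z y) - g z' (var_step p a z' y)\<bar> \<le> \<nu> * (\<bar>R 0 j z - R 0 j z'\<bar> + \<bar>R 0 k z - R 0 k z'\<bar> + \<bar>R (Suc 0) k z - R (Suc 0) k z'\<bar>)"
      using g_lip[of z "var_step p a z y" z' "var_step p a z' y"]
      unfolding R_0[OF jk(1)] R_0[OF jk(2)] R_step_same_noise[OF jk(2), of 0 z y z', unfolded R_0[OF jk(2)], symmetric] .
    show "(\<lambda>y. g z (var_step p a z y) - g z' (var_step p a z' y)) \<in> borel_measurable (vspace p)"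
      using 0 by (intro borel_measurable_diff g_measurable measurable_var_step measurable_const) auto
  qed
  finally show ?case .
next
  case (Suc m)
  note i = h_step_integrable(1)[OF Suc(2)] h_step_integrable(1)[OF Suc(3)]
  have "\<bar>h (Suc m) z - h (Suc m) z'\<bar> = \<bar>\<integral>y. h m (var_step p a z y) - h m (var_step p a z' y) \<partial>\<eta>\<bar>"
    using i by simp
  also have "\<dots> \<le> \<nu> * (\<bar>R (Suc m) j z - R (Suc m) j z'\<bar> + \<bar>R (Suc m) k z - R (Suc m) k z'\<bar> + \<bar>R (Suc (Suc m)) k z - R (Suc (Suc m)) k z'\<bar>)"
  proof (rule abs_integral_\<eta>_le(2))
    fix y
    show "\<bar>h m (var_step p a z y) - h m (var_step p a z' y)\<bar> \<le> \<nu> * (\<bar>R (Suc m) j z - R (Suc m) j z'\<bar> + \<bar>R (Suc m) k z - R (Suc m) k z'\<bar> + \<bar>R (Suc (Suc m)) k z - R (Suc (Suc m)) k z'\<bar>)"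
      using Suc(1)[OF var_step_space[of z y] var_step_space[of z' y]]
      unfolding R_step_same_noise[OF jk(1)] R_step_same_noise[OF jk(2)] .
    show "(\<lambda>y. h m (var_step p a z y) - h m (var_step p a z' y)) \<in> borel_measurable (vspace p)"
      using Suc(2,3) by (intro borel_measurable_diff measurable_compose[OF _ h_measurable] measurable_var_step measurable_const) auto
  qed
  finally show ?case .
qed

lemma sum3_sq_le: "(u + v + w)\<^sup>2 \<le> 3 * (u\<^sup>2 + v\<^sup>2 + (w::real)\<^sup>2)"
proof -
  have "0 \<le> (u - v)\<^sup>2 + (v - w)\<^sup>2 + (u - w)\<^sup>2" by simp
  then show ?thesis by (simp add: power2_eq_square algebra_simps)
qed

text \<open>The 9 is a factor 3 from squaring a sum of three terms, times the three terms; the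
  additional \<rho>^2 of the latest one is dropped.\<close>

lemma triple_moment:
  assumes "prob_space N" and sN [measurable_cong]: "sets N = sets (vspace p)"
    and mom: "\<And>m i. i < p \<Longrightarrow> integrable N (\<lambda>y. (R m i y)\<^sup>2) \<and> (\<integral>y. (R m i y)\<^sup>2 \<partial>N) \<le> H * \<rho> ^ (2 * m)"
  shows "integrable N (\<lambda>y. (\<nu> * (\<bar>R m j y\<bar> + \<bar>R m k y\<bar> + \<bar>R (Suc m) k y\<bar>))\<^sup>2)"
    and "(\<integral>y. (\<nu> * (\<bar>R m j y\<bar> + \<bar>R m k y\<bar> + \<bar>R (Suc m) k y\<bar>))\<^sup>2 \<partial>N) \<le> 9 * \<nu>\<^sup>2 * H * \<rho> ^ (2 * m)"
proof -
  interpret N: prob_space N by fact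
  let ?f = "\<lambda>y. (\<nu> * (\<bar>R m j y\<bar> + \<bar>R m k y\<bar> + \<bar>R (Suc m) k y\<bar>))\<^sup>2"
  let ?g = "\<lambda>y. \<nu>\<^sup>2 * (3 * ((R m j y)\<^sup>2 + (R m k y)\<^sup>2 + (R (Suc m) k y)\<^sup>2))"
  have le: "?f y \<le> ?g y" for y
    using sum3_sq_le[of "\<bar>R m j y\<bar>" "\<bar>R m k y\<bar>" "\<bar>R (Suc m) k y\<bar>"] by (simp add: power_mult_distrib mult_left_mono)
  have int: "integrable N ?g" using mom jk by (intro integrable_mult_right Bochner_Integration.integrable_add) auto
  show i: "integrable N ?f"
    by (rule Bochner_Integration.integrable_bound[OF int]) (use le in \<open>auto intro: order_trans[OF _ abs_ge_self]\<close>)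
  have H: "0 \<le> H * \<rho> ^ (2 * m)" 
  proof -
    have "0 \<le> (\<integral>y. (R m j y)\<^sup>2 \<partial>N)" by simp
    then show ?thesis using mom[OF jk(1), of m] by linarith
  qed
  have "(\<integral>y. ?f y \<partial>N) \<le> (\<integral>y. ?g y \<partial>N)" using i int le by (intro integral_mono) auto
  also have "\<dots> = \<nu>\<^sup>2 * (3 * ((\<integral>y. (R m j y)\<^sup>2 \<partial>N) + (\<integral>y. (R m k y)\<^sup>2 \<partial>N) + (\<integral>y. (R (Suc m) k y)\<^sup>2 \<partial>N)))"
    using mom jk by (simp add: Bochner_Integration.integral_add)
  also have "\<dots> \<le> \<nu>\<^sup>2 * (3 * (H * \<rho> ^ (2 * m) + H * \<rho> ^ (2 * m) + H * \<rho> ^ (2 * m)))"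
  proof (intro mult_left_mono add_mono)
    have "(\<integral>y. (R (Suc m) k y)\<^sup>2 \<partial>N) \<le> H * \<rho> ^ (2 * Suc m)" using mom[OF jk(2)] by blast
    also have "\<dots> = \<rho>\<^sup>2 * (H * \<rho> ^ (2 * m))" by (simp add: power2_eq_square)
    also have "\<dots> \<le> 1 * (H * \<rho> ^ (2 * m))" using \<rho> H by (intro mult_right_mono power_le_one) auto
    finally show "(\<integral>y. (R (Suc m) k y)\<^sup>2 \<partial>N) \<le> H * \<rho> ^ (2 * m)" by simp
  qed (use mom jk in auto)
  finally show "(\<integral>y. ?f y \<partial>N) \<le> 9 * \<nu>\<^sup>2 * H * \<rho> ^ (2 * m)" by simp
qed


definition W :: "nat \<Rightarrow> (nat \<Rightarrow> real) \<Rightarrow> (nat \<Rightarrow> real) \<Rightarrow> real" where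
  "W N z y = g z (var_step p a z y) + (\<Sum>m<N. h m (var_step p a z y))"

lemma W_measurable [measurable (raw)]:
  assumes [measurable]: "f1 \<in> N' \<rightarrow>\<^sub>M vspace p" "f2 \<in> N' \<rightarrow>\<^sub>M vspace p"
  shows "(\<lambda>x. W N (f1 x) (f2 x)) \<in> borel_measurable N'"
  unfolding W_def by measurable

text \<open>The martingale property: averaging over the next innovation turns g into
  \<open>h 0\<close> and each \<open>h m\<close> into \<open>h (Suc m)\<close>.\<close>

lemma integral_W:
  assumes z: "z \<in> space (vspace p)"
  shows "(\<integral>y. W N z y \<partial>\<eta>) = (\<Sum>m<Suc N. h m z)"
proof -
  have "(\<integral>y. W N z y \<partial>\<eta>) = h 0 z + (\<Sum>m<N. h (Suc m) z)"
    unfolding W_def using h_step_integrable[OF z]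
    by (subst Bochner_Integration.integral_add) (auto intro: Bochner_Integration.integrable_sum simp: Bochner_Integration.integral_sum)
  then show ?thesis by (simp only: sum.lessThan_Suc_shift)
qed

text \<open>The exponent of \<open>centred_mgf_le\<close> for the variance parameter 9 \<nu>^2 H of
  \<open>triple_moment\<close>.\<close>

definition mgf_rate :: "real \<Rightarrow> real \<Rightarrow> real" where
  "mgf_rate \<theta> H = 8 * (\<theta> * exp 1 / (1 - \<rho>))\<^sup>2 * (9 * \<nu>\<^sup>2 * H)"

lemma W_mgf_le:
  assumes z: "z \<in> space (vspace p)" and \<theta>: "0 \<le> \<theta>" "2 * exp 1 * \<theta> * B \<le> 1 - \<rho>"
  shows "(\<integral>y. exp (\<theta> * (W N z y - (\<integral>y. W N z y \<partial>\<eta>))) \<partial>\<eta>) \<le> exp (mgf_rate \<theta> (G / \<rho>\<^sup>2))"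
proof -
  have G: "0 \<le> G"
  proof -
    have "0 \<le> (\<integral>y. (R 0 j y)\<^sup>2 \<partial>\<eta>)" by simp
    moreover have "(\<integral>y. (R 0 j y)\<^sup>2 \<partial>\<eta>) \<le> G" using e_moment[OF jk(1), of 0] unfolding R_def[symmetric] by simp
    ultimately show ?thesis by linarith
  qed
  \<comment> \<open>Slot 0 belongs to g, which sees the new state only through coordinate k, and
    slot m + 1 to \<open>h m\<close>. This shift by one step is paid for by dividing G by
    \<rho>^2.\<close>
  define u where "u = (\<lambda>m y. case m of 0 \<Rightarrow> \<nu> * \<bar>R 0 k y\<bar>
    | Suc m \<Rightarrow> \<nu> * (\<bar>R m j y\<bar> + \<bar>R m k y\<bar> + \<bar>R (Suc m) k y\<bar>))"
  have mom: "integrable \<eta> (\<lambda>y. (R m i y)\<^sup>2) \<and> (\<integral>y. (R m i y)\<^sup>2 \<partial>\<eta>) \<le> G * \<rho> ^ (2 * m)" if "i < p" for m i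
    using e_moment[OF that] unfolding R_def .
  have u2: "integrable \<eta> (\<lambda>y. (u m y)\<^sup>2)" "(\<integral>y. (u m y)\<^sup>2 \<partial>\<eta>) \<le> 9 * \<nu>\<^sup>2 * (G / \<rho>\<^sup>2) * \<rho> ^ (2 * m)" for m
  proof -
    show "integrable \<eta> (\<lambda>y. (u m y)\<^sup>2)"
    proof (cases m)
      case 0 then show ?thesis using mom[OF jk(2), of 0] by (simp add: u_def power_mult_distrib)
    next
      case (Suc m') then show ?thesis using triple_moment(1)[OF prob_space_\<eta> sets_\<eta> mom, of m'] by (simp add: u_def)
    qed
    show "(\<integral>y. (u m y)\<^sup>2 \<partial>\<eta>) \<le> 9 * \<nu>\<^sup>2 * (G / \<rho>\<^sup>2) * \<rho> ^ (2 * m)"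
    proof (cases m)
      case 0
      have "(\<integral>y. (u m y)\<^sup>2 \<partial>\<eta>) = \<nu>\<^sup>2 * (\<integral>y. (R 0 k y)\<^sup>2 \<partial>\<eta>)" using 0 by (simp add: u_def power_mult_distrib)
      also have "\<dots> \<le> \<nu>\<^sup>2 * G" using mom[OF jk(2), of 0] by (intro mult_left_mono) auto
      also have "\<dots> \<le> \<nu>\<^sup>2 * (9 * (G / \<rho>\<^sup>2))"
      proof (intro mult_left_mono)
        have "1 * G \<le> (1 / \<rho>\<^sup>2) * G" using \<rho> G by (intro mult_right_mono) (auto simp: power_le_one)
        then show "G \<le> 9 * (G / \<rho>\<^sup>2)" using G by simp
      qed simp
      finally show ?thesis using 0 by (simp add: mult_ac)
    next
      case (Suc m')
      have "(\<integral>y. (u m y)\<^sup>2 \<partial>\<eta>) \<le> 9 * \<nu>\<^sup>2 * G * \<rho> ^ (2 * m')"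
        using triple_moment(2)[OF prob_space_\<eta> sets_\<eta> mom, of m'] Suc by (simp add: u_def)
      also have "\<dots> = 9 * \<nu>\<^sup>2 * (G / \<rho>\<^sup>2) * \<rho> ^ (2 * m)"
        using \<rho> Suc by (simp add: power2_eq_square)
      finally show ?thesis .
    qed
  qed
  show ?thesis unfolding mgf_rate_def
  proof (rule \<eta>.centred_mgf_le[where u=u and F="B / 2 + real N * (B / 2)" and N="Suc N" and B=B])
    show "W N z \<in> borel_measurable \<eta>" using z by simp
    show "u m \<in> borel_measurable \<eta>" for m
      by (cases m) (auto simp: u_def)
    show "0 \<le> u m y" for m y using \<nu> by (cases m) (auto simp: u_def)
    show "\<bar>W N z y\<bar> \<le> B / 2 + real N * (B / 2)" for y
    proof -
      have "\<bar>\<Sum>m<N. h m (var_step p a z y)\<bar> \<le> (\<Sum>m<N. B / 2)"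
        by (rule order_trans[OF sum_abs]) (intro sum_mono abs_h_le var_step_space)
      moreover have "\<bar>g z (var_step p a z y)\<bar> \<le> B / 2" by (rule g_bound)
      ultimately show ?thesis unfolding W_def by simp
    qed
    show "\<bar>W N z y - W N z y'\<bar> \<le> (\<Sum>m<Suc N. min B (u m y + u m y'))" for y y'
    proof -
      let ?s = "var_step p a z y" and ?s' = "var_step p a z y'"
      have tri: "\<bar>s - t\<bar> \<le> B" if "\<bar>s\<bar> \<le> B / 2" "\<bar>t\<bar> \<le> B / 2" for s t :: real
        using that abs_triangle_ineq4[of s t] by linarith
      have "\<bar>g z ?s - g z ?s'\<bar> \<le> \<nu> * \<bar>R 0 k ?s - R 0 k ?s'\<bar>"
        using g_lip[of z ?s z ?s'] R_0[OF jk(2)] by simp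
      also have "\<dots> = \<nu> * \<bar>R 0 k y - R 0 k y'\<bar>" unfolding R_step_same_state ..
      also have "\<dots> \<le> \<nu> * (\<bar>R 0 k y\<bar> + \<bar>R 0 k y'\<bar>)" using \<nu> by (intro mult_left_mono) auto
      finally have g: "\<bar>g z ?s - g z ?s'\<bar> \<le> min B (u 0 y + u 0 y')"
        using tri[OF g_bound g_bound] by (simp add: u_def distrib_left)
      have hm: "\<bar>h m ?s - h m ?s'\<bar> \<le> min B (u (Suc m) y + u (Suc m) y')" for m
      proof -
        have "\<bar>h m ?s - h m ?s'\<bar> \<le> \<nu> * (\<bar>R m j y - R m j y'\<bar> + \<bar>R m k y - R m k y'\<bar> + \<bar>R (Suc m) k y - R (Suc m) k y'\<bar>)"
          using h_lip[OF var_step_space var_step_space, of m z y z y'] unfolding R_step_same_state .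
        also have "\<dots> \<le> \<nu> * ((\<bar>R m j y\<bar> + \<bar>R m j y'\<bar>) + (\<bar>R m k y\<bar> + \<bar>R m k y'\<bar>) + (\<bar>R (Suc m) k y\<bar> + \<bar>R (Suc m) k y'\<bar>))"
          using \<nu> by (intro mult_left_mono add_mono abs_triangle_ineq4) auto
        also have "\<dots> = u (Suc m) y + u (Suc m) y'" by (simp add: u_def algebra_simps)
        finally show ?thesis using tri[OF abs_h_le[OF var_step_space] abs_h_le[OF var_step_space]] by simp
      qed
      have "W N z y - W N z y' = (g z ?s - g z ?s') + (\<Sum>m<N. h m ?s - h m ?s')"
        unfolding W_def by (simp add: sum_subtractf)
      then have "\<bar>W N z y - W N z y'\<bar> \<le> \<bar>g z ?s - g z ?s'\<bar> + (\<Sum>m<N. \<bar>h m ?s - h m ?s'\<bar>)"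
        using sum_abs[of "\<lambda>m. h m ?s - h m ?s'" "{..<N}"] by linarith
      also have "\<dots> \<le> min B (u 0 y + u 0 y') + (\<Sum>m<N. min B (u (Suc m) y + u (Suc m) y'))"
        using g hm by (intro add_mono sum_mono) auto
      finally show ?thesis by (simp only: sum.lessThan_Suc_shift)
    qed
    show "0 \<le> 9 * \<nu>\<^sup>2 * (G / \<rho>\<^sup>2)" using G by simp
  qed (use u2 \<rho> B_nonneg \<theta> in auto)
qed

text \<open>The same estimate with the initial state as the random variable. The successor state is
  already integrated out in \<open>h 0\<close>, so no slot is shifted and \<open>G0\<close> is not
  divided by \<rho>^2.\<close>

lemma initial_mgf_le:
  assumes \<theta>: "0 \<le> \<theta>" "2 * exp 1 * \<theta> * B \<le> 1 - \<rho>"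
  shows "expectation (\<lambda>\<omega>. exp (\<theta> * ((\<Sum>m<n. h m (x 0 \<omega>)) - expectation (\<lambda>\<omega>. \<Sum>m<n. h m (x 0 \<omega>)))))
    \<le> exp (mgf_rate \<theta> G0)"
proof -
  define u where "u = (\<lambda>m \<omega>. \<nu> * (\<bar>R m j (x 0 \<omega>)\<bar> + \<bar>R m k (x 0 \<omega>)\<bar> + \<bar>R (Suc m) k (x 0 \<omega>)\<bar>))"
  let ?N = "distr M (vspace p) (x 0)"
  have mom: "integrable ?N (\<lambda>y. (R m i y)\<^sup>2) \<and> (\<integral>y. (R m i y)\<^sup>2 \<partial>?N) \<le> G0 * \<rho> ^ (2 * m)" if "i < p" for m i
    using x_moment[OF that] by (subst integral_distr integrable_distr_eq; simp add: R_def[symmetric])+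
  have t: "integrable ?N (\<lambda>y. (\<nu> * (\<bar>R m j y\<bar> + \<bar>R m k y\<bar> + \<bar>R (Suc m) k y\<bar>))\<^sup>2)"
    "(\<integral>y. (\<nu> * (\<bar>R m j y\<bar> + \<bar>R m k y\<bar> + \<bar>R (Suc m) k y\<bar>))\<^sup>2 \<partial>?N) \<le> 9 * \<nu>\<^sup>2 * G0 * \<rho> ^ (2 * m)" for m
    by (rule triple_moment(1)[OF prob_space_distr[OF x_meas] sets_distr], erule mom,
        rule triple_moment(2)[OF prob_space_distr[OF x_meas] sets_distr], erule mom)
  have sp: "x 0 \<omega> \<in> space (vspace p)" if "\<omega> \<in> space M" for \<omega>
    using measurable_space[OF x_meas that] .
  have u2: "integrable M (\<lambda>\<omega>. (u m \<omega>)\<^sup>2)" "expectation (\<lambda>\<omega>. (u m \<omega>)\<^sup>2) \<le> 9 * \<nu>\<^sup>2 * G0 * \<rho> ^ (2 * m)" for m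
    unfolding u_def
    by (subst integrable_distr_eq[symmetric, OF x_meas], simp, rule t,
        subst integral_distr[symmetric, OF x_meas], simp, rule t)
  show ?thesis unfolding mgf_rate_def
  proof (rule centred_mgf_le[where u=u and F="real n * (B / 2)" and N=n and B=B])
    show "u m \<in> borel_measurable M" for m unfolding u_def by measurable
    show "0 \<le> u m \<omega>" for m \<omega> using \<nu> by (auto simp: u_def)
    show "\<bar>\<Sum>m<n. h m (x 0 \<omega>)\<bar> \<le> real n * (B / 2)" if "\<omega> \<in> space M" for \<omega>
    proof -
      have "\<bar>\<Sum>m<n. h m (x 0 \<omega>)\<bar> \<le> (\<Sum>m<n. B / 2)"
        by (rule order_trans[OF sum_abs]) (intro sum_mono abs_h_le sp that)
      then show ?thesis by simp
    qed
    show "\<bar>(\<Sum>m<n. h m (x 0 \<omega>)) - (\<Sum>m<n. h m (x 0 \<omega>'))\<bar> \<le> (\<Sum>m<n. min B (u m \<omega> + u m \<omega>'))"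
      if \<omega>: "\<omega> \<in> space M" "\<omega>' \<in> space M" for \<omega> \<omega>'
    proof -
      have tri: "\<bar>s - t\<bar> \<le> B" if "\<bar>s\<bar> \<le> B / 2" "\<bar>t\<bar> \<le> B / 2" for s t :: real
        using that abs_triangle_ineq4[of s t] by linarith
      have hm: "\<bar>h m (x 0 \<omega>) - h m (x 0 \<omega>')\<bar> \<le> min B (u m \<omega> + u m \<omega>')" for m
      proof -
        let ?y = "x 0 \<omega>" and ?y' = "x 0 \<omega>'"
        have "\<bar>h m ?y - h m ?y'\<bar> \<le> \<nu> * (\<bar>R m j ?y - R m j ?y'\<bar> + \<bar>R m k ?y - R m k ?y'\<bar> + \<bar>R (Suc m) k ?y - R (Suc m) k ?y'\<bar>)"
          by (rule h_lip[OF sp[OF \<omega>(1)] sp[OF \<omega>(2)]])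
        also have "\<dots> \<le> \<nu> * ((\<bar>R m j ?y\<bar> + \<bar>R m j ?y'\<bar>) + (\<bar>R m k ?y\<bar> + \<bar>R m k ?y'\<bar>) + (\<bar>R (Suc m) k ?y\<bar> + \<bar>R (Suc m) k ?y'\<bar>))"
          using \<nu> by (intro mult_left_mono add_mono abs_triangle_ineq4) auto
        also have "\<dots> = u m \<omega> + u m \<omega>'" by (simp add: u_def algebra_simps)
        finally show ?thesis using tri[OF abs_h_le[OF sp[OF \<omega>(1)]] abs_h_le[OF sp[OF \<omega>(2)]]] by simp
      qed
      have "\<bar>(\<Sum>m<n. h m (x 0 \<omega>)) - (\<Sum>m<n. h m (x 0 \<omega>'))\<bar> \<le> (\<Sum>m<n. \<bar>h m (x 0 \<omega>) - h m (x 0 \<omega>')\<bar>)"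
        unfolding sum_subtractf[symmetric] by (rule sum_abs)
      also have "\<dots> \<le> (\<Sum>m<n. min B (u m \<omega> + u m \<omega>'))" by (intro sum_mono hm)
      finally show ?thesis .
    qed
    show "0 \<le> 9 * \<nu>\<^sup>2 * G0" using G0 by simp
  qed (use u2 \<rho> B_nonneg \<theta> in \<open>auto simp: u_def\<close>)
qed

section \<open>From one martingale step to the exponential tail bound\<close>

definition Z :: "nat \<Rightarrow> 'a \<Rightarrow> real" where
  "Z l \<omega> = (\<Sum>i<l. g (x i \<omega>) (x (Suc i) \<omega>))"

lemma x_space: "\<omega> \<in> space M \<Longrightarrow> x l \<omega> \<in> space (vspace p)"
  using measurable_space[OF x_meas] .

lemma history_measurable [measurable]: "(\<lambda>\<omega>. \<lambda>i\<in>{..l}. x i \<omega>) \<in> M \<rightarrow>\<^sub>M (\<Pi>\<^sub>M _\<in>{..l}. vspace p)"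
  by (rule measurable_restrict) simp

text \<open>Given the history, the exponent at time l + 1 is a constant plus \<theta> times
  \<open>W\<close>. The mean of \<open>W\<close> over the innovation is the sum of conditional means
  at time l, and the fluctuation around it costs one factor from \<open>W_mgf_le\<close>.\<close>

lemma mgf_step:
  assumes l: "l < n" and \<theta>: "0 \<le> \<theta>" "2 * exp 1 * \<theta> * B \<le> 1 - \<rho>"
  shows "(\<integral>\<^sup>+\<omega>. ennreal (exp (\<theta> * (Z (Suc l) \<omega> + (\<Sum>m<n - Suc l. h m (x (Suc l) \<omega>)) - b))) \<partial>M)
    \<le> ennreal (exp (mgf_rate \<theta> (G / \<rho>\<^sup>2))) * (\<integral>\<^sup>+\<omega>. ennreal (exp (\<theta> * (Z l \<omega> + (\<Sum>m<n - l. h m (x l \<omega>)) - b))) \<partial>M)"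
proof -
  let ?H = "\<Pi>\<^sub>M _\<in>{..l}. vspace p"
  let ?hist = "\<lambda>\<omega>. \<lambda>i\<in>{..l}. x i \<omega>"
  let ?N = "n - Suc l"
  have Suc_N: "Suc ?N = n - l" using l by simp
  define F where "F = (\<lambda>z::(nat \<Rightarrow> nat \<Rightarrow> real) \<times> (nat \<Rightarrow> real).
    ennreal (exp (\<theta> * ((\<Sum>i<l. g (fst z i) (fst z (Suc i))) + W ?N (fst z l) (snd z) - b))))"
  have comp [measurable]: "(\<lambda>z. fst z i) \<in> ?H \<Otimes>\<^sub>M vspace p \<rightarrow>\<^sub>M vspace p" if "i \<le> l" for i
    using that by (intro measurable_compose[OF measurable_fst measurable_component_singleton]) auto
  have Fm: "F \<in> borel_measurable (?H \<Otimes>\<^sub>M vspace p)"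
    unfolding F_def
    by (intro measurable_compose[OF _ measurable_ennreal] borel_measurable_exp borel_measurable_times borel_measurable_diff
        borel_measurable_add borel_measurable_sum g_measurable W_measurable comp measurable_snd borel_measurable_const) auto
  have "(\<integral>\<^sup>+\<omega>. ennreal (exp (\<theta> * (Z (Suc l) \<omega> + (\<Sum>m<n - Suc l. h m (x (Suc l) \<omega>)) - b))) \<partial>M)
      = (\<integral>\<^sup>+\<omega>. F (?hist \<omega>, e l \<omega>) \<partial>M)"
  proof (rule nn_integral_cong)
    fix \<omega> assume "\<omega> \<in> space M"
    then show "ennreal (exp (\<theta> * (Z (Suc l) \<omega> + (\<Sum>m<n - Suc l. h m (x (Suc l) \<omega>)) - b))) = F (?hist \<omega>, e l \<omega>)"
      unfolding F_def Z_def W_def by (simp add: x_step add.assoc)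
  qed
  also have "\<dots> = (\<integral>\<^sup>+\<omega>. (\<integral>\<^sup>+y. F (?hist \<omega>, y) \<partial>\<eta>) \<partial>M)"
    by (subst nn_integral_product_law[OF history_measurable e_meas indep Fm]) (simp add: e_distr)
  also have "\<dots> \<le> (\<integral>\<^sup>+\<omega>. ennreal (exp (mgf_rate \<theta> (G / \<rho>\<^sup>2))) *
      ennreal (exp (\<theta> * (Z l \<omega> + (\<Sum>m<n - l. h m (x l \<omega>)) - b))) \<partial>M)"
  proof (rule nn_integral_mono)
    fix \<omega> assume \<omega>: "\<omega> \<in> space M"
    let ?z = "x l \<omega>" and ?I = "\<integral>y. W ?N (x l \<omega>) y \<partial>\<eta>"
    note z = x_space[OF \<omega>, of l]
    have Wb: "\<bar>W ?N ?z y\<bar> \<le> B / 2 + real ?N * (B / 2)" for y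
    proof -
      have "\<bar>\<Sum>m<?N. h m (var_step p a ?z y)\<bar> \<le> (\<Sum>m<?N. B / 2)"
        by (rule order_trans[OF sum_abs]) (intro sum_mono abs_h_le var_step_space)
      moreover have "\<bar>g ?z (var_step p a ?z y)\<bar> \<le> B / 2" by (rule g_bound)
      ultimately show ?thesis unfolding W_def by simp
    qed
    have int: "integrable \<eta> (\<lambda>y. exp (\<theta> * (W ?N ?z y - ?I)))"
    proof (rule \<eta>.integrable_bounded[of _ "exp (\<theta> * (B / 2 + real ?N * (B / 2) - ?I))"])
      show "(\<lambda>y. exp (\<theta> * (W ?N ?z y - ?I))) \<in> borel_measurable \<eta>" using z by simp
      show "\<bar>exp (\<theta> * (W ?N ?z y - ?I))\<bar> \<le> exp (\<theta> * (B / 2 + real ?N * (B / 2) - ?I))" for y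
        using Wb[of y] \<theta>(1) by (simp add: mult_left_mono)
    qed
    have "F (?hist \<omega>, y) = ennreal (exp (\<theta> * (Z l \<omega> + ?I - b))) * ennreal (exp (\<theta> * (W ?N ?z y - ?I)))" for y
      unfolding F_def Z_def by (simp add: ennreal_mult[symmetric] exp_add[symmetric] algebra_simps)
    then have "(\<integral>\<^sup>+y. F (?hist \<omega>, y) \<partial>\<eta>) = ennreal (exp (\<theta> * (Z l \<omega> + ?I - b))) * (\<integral>\<^sup>+y. ennreal (exp (\<theta> * (W ?N ?z y - ?I))) \<partial>\<eta>)"
      using int by (simp add: nn_integral_cmult)
    also have "\<dots> = ennreal (exp (\<theta> * (Z l \<omega> + ?I - b))) * ennreal (\<integral>y. exp (\<theta> * (W ?N ?z y - ?I)) \<partial>\<eta>)"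
      using int by (subst nn_integral_eq_integral) auto
    also have "\<dots> \<le> ennreal (exp (\<theta> * (Z l \<omega> + ?I - b))) * ennreal (exp (mgf_rate \<theta> (G / \<rho>\<^sup>2)))"
      by (intro mult_left_mono ennreal_leI W_mgf_le z \<theta>) auto
    also have "?I = (\<Sum>m<n - l. h m ?z)" using integral_W[OF z, of ?N] unfolding Suc_N .
    also note mult.commute
    finally show "(\<integral>\<^sup>+y. F (?hist \<omega>, y) \<partial>\<eta>) \<le> ennreal (exp (mgf_rate \<theta> (G / \<rho>\<^sup>2))) *
      ennreal (exp (\<theta> * (Z l \<omega> + (\<Sum>m<n - l. h m ?z) - b)))" .
  qed
  also have "\<dots> = ennreal (exp (mgf_rate \<theta> (G / \<rho>\<^sup>2))) *
      (\<integral>\<^sup>+\<omega>. ennreal (exp (\<theta> * (Z l \<omega> + (\<Sum>m<n - l. h m (x l \<omega>)) - b))) \<partial>M)"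
    by (intro nn_integral_cmult) (unfold Z_def, measurable)
  finally show ?thesis .
qed

text \<open>The tower property, one innovation at a time.\<close>

lemma expectation_h: "expectation (\<lambda>\<omega>. h m (x l \<omega>)) = expectation (\<lambda>\<omega>. g (x (l + m) \<omega>) (x (Suc (l + m)) \<omega>))"
proof (induction m arbitrary: l)
  let ?H = "\<lambda>l. \<Pi>\<^sub>M _\<in>{..l}. vspace p"
  let ?hist = "\<lambda>l \<omega>. \<lambda>i\<in>{..l}. x i \<omega>"
  have comp: "(\<lambda>z. fst z l) \<in> ?H l \<Otimes>\<^sub>M vspace p \<rightarrow>\<^sub>M vspace p" for l :: nat
    by (intro measurable_compose[OF measurable_fst measurable_component_singleton]) auto
  have compsp: "fst z l \<in> space (vspace p)" if "z \<in> space (?H l \<Otimes>\<^sub>M vspace p)" for z and l :: nat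
    using measurable_space[OF comp that] .
  {
    case 0
    have "expectation (\<lambda>\<omega>. g (x l \<omega>) (x (Suc l) \<omega>)) =
        expectation (\<lambda>\<omega>. (\<lambda>z. g (fst z l) (var_step p a (fst z l) (snd z))) (?hist l \<omega>, e l \<omega>))"
      by (intro Bochner_Integration.integral_cong) (auto simp: x_step)
    also have "\<dots> = expectation (\<lambda>\<omega>. \<integral>y. (\<lambda>z. g (fst z l) (var_step p a (fst z l) (snd z))) (?hist l \<omega>, y) \<partial>\<eta>)"
      by (rule integral_product_law[OF history_measurable e_meas indep, unfolded e_distr, of _ _ "B / 2"],
          intro g_measurable measurable_var_step comp measurable_snd, rule g_bound)
    finally show ?case by simp
  next
    case (Suc m)
    have "expectation (\<lambda>\<omega>. h m (x (Suc l) \<omega>)) =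
        expectation (\<lambda>\<omega>. (\<lambda>z. h m (var_step p a (fst z l) (snd z))) (?hist l \<omega>, e l \<omega>))"
      by (intro Bochner_Integration.integral_cong) (auto simp: x_step)
    also have "\<dots> = expectation (\<lambda>\<omega>. \<integral>y. (\<lambda>z. h m (var_step p a (fst z l) (snd z))) (?hist l \<omega>, y) \<partial>\<eta>)"
      by (rule integral_product_law[OF history_measurable e_meas indep, unfolded e_distr, of _ _ "B / 2"],
          intro measurable_compose[OF _ h_measurable] measurable_var_step comp measurable_snd,
          rule abs_h_le[OF var_step_space])
    finally show ?case using Suc[of "Suc l"] by simp
  }
qed

text \<open>Iterating the step from l = n, where no conditional mean is left, down to l = 0 leaves a
  function of the initial state alone, whose mean is the centring constant by
  \<open>expectation_h\<close>.\<close>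

lemma mgf_le:
  assumes \<theta>: "0 \<le> \<theta>" "2 * exp 1 * \<theta> * B \<le> 1 - \<rho>"
  shows "(\<integral>\<^sup>+\<omega>. ennreal (exp (\<theta> * (Z n \<omega> - (\<Sum>i<n. expectation (\<lambda>\<omega>. g (x i \<omega>) (x (Suc i) \<omega>)))))) \<partial>M)
    \<le> ennreal (exp (real n * mgf_rate \<theta> (G / \<rho>\<^sup>2) + mgf_rate \<theta> G0))"
proof -
  let ?r = "mgf_rate \<theta> (G / \<rho>\<^sup>2)"
  define b where "b = (\<Sum>i<n. expectation (\<lambda>\<omega>. g (x i \<omega>) (x (Suc i) \<omega>)))"
  have hint: "integrable M (\<lambda>\<omega>. h m (x 0 \<omega>))" for m
    by (rule integrable_bounded[of _ "B / 2"], measurable, rule abs_h_le[OF x_space])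
  have b: "expectation (\<lambda>\<omega>. \<Sum>m<n. h m (x 0 \<omega>)) = b"
    unfolding b_def using hint expectation_h[of _ 0] by (simp add: Bochner_Integration.integral_sum)
  have "(\<integral>\<^sup>+\<omega>. ennreal (exp (\<theta> * (Z l \<omega> + (\<Sum>m<n - l. h m (x l \<omega>)) - b))) \<partial>M)
    \<le> ennreal (exp (real l * ?r)) * (\<integral>\<^sup>+\<omega>. ennreal (exp (\<theta> * ((\<Sum>m<n. h m (x 0 \<omega>)) - b))) \<partial>M)" if "l \<le> n" for l
    using that
  proof (induction l)
    case 0 then show ?case by (simp add: Z_def)
  next
    case (Suc l)
    have "(\<integral>\<^sup>+\<omega>. ennreal (exp (\<theta> * (Z (Suc l) \<omega> + (\<Sum>m<n - Suc l. h m (x (Suc l) \<omega>)) - b))) \<partial>M)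
      \<le> ennreal (exp ?r) * (\<integral>\<^sup>+\<omega>. ennreal (exp (\<theta> * (Z l \<omega> + (\<Sum>m<n - l. h m (x l \<omega>)) - b))) \<partial>M)"
      using Suc by (intro mgf_step \<theta>) auto
    also have "\<dots> \<le> ennreal (exp ?r) * (ennreal (exp (real l * ?r)) * (\<integral>\<^sup>+\<omega>. ennreal (exp (\<theta> * ((\<Sum>m<n. h m (x 0 \<omega>)) - b))) \<partial>M))"
      using Suc by (intro mult_left_mono) auto
    also have "\<dots> = ennreal (exp (real (Suc l) * ?r)) * (\<integral>\<^sup>+\<omega>. ennreal (exp (\<theta> * ((\<Sum>m<n. h m (x 0 \<omega>)) - b))) \<partial>M)"
      by (simp add: mult.assoc[symmetric] ennreal_mult[symmetric] exp_add[symmetric] distrib_right)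
    finally show ?case .
  qed
  from this[of n] have "(\<integral>\<^sup>+\<omega>. ennreal (exp (\<theta> * (Z n \<omega> - b))) \<partial>M)
    \<le> ennreal (exp (real n * ?r)) * (\<integral>\<^sup>+\<omega>. ennreal (exp (\<theta> * ((\<Sum>m<n. h m (x 0 \<omega>)) - b))) \<partial>M)" by simp
  also have "(\<integral>\<^sup>+\<omega>. ennreal (exp (\<theta> * ((\<Sum>m<n. h m (x 0 \<omega>)) - b))) \<partial>M) =
      ennreal (expectation (\<lambda>\<omega>. exp (\<theta> * ((\<Sum>m<n. h m (x 0 \<omega>)) - b))))"
  proof (rule nn_integral_eq_integral)
    show "integrable M (\<lambda>\<omega>. exp (\<theta> * ((\<Sum>m<n. h m (x 0 \<omega>)) - b)))"
    proof (rule integrable_bounded[of _ "exp (\<theta> * (real n * (B / 2) - b))"])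
      fix \<omega> assume \<omega>: "\<omega> \<in> space M"
      have "(\<Sum>m<n. h m (x 0 \<omega>)) \<le> (\<Sum>m<n. B / 2)"
        using abs_h_le[OF x_space[OF \<omega>]] abs_le_D1 by (intro sum_mono) blast
      then show "\<bar>exp (\<theta> * ((\<Sum>m<n. h m (x 0 \<omega>)) - b))\<bar> \<le> exp (\<theta> * (real n * (B / 2) - b))"
        using \<theta>(1) by (simp add: mult_left_mono)
    qed simp
  qed simp
  also have "\<dots> \<le> ennreal (exp (mgf_rate \<theta> G0))"
    using initial_mgf_le[OF \<theta>, of n] unfolding b by (intro ennreal_leI)
  finally show ?thesis unfolding b_def[symmetric]
    by (simp add: ennreal_mult[symmetric] exp_add[symmetric] mult_left_mono)
qed

lemma Z_measurable [measurable]: "Z n \<in> borel_measurable M"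
  unfolding Z_def by measurable

text \<open>Markov's inequality for the exponential.\<close>

lemma upper_tail:
  assumes \<theta>: "0 \<le> \<theta>" "2 * exp 1 * \<theta> * B \<le> 1 - \<rho>"
  shows "prob {\<omega> \<in> space M. (\<Sum>i<n. expectation (\<lambda>\<omega>. g (x i \<omega>) (x (Suc i) \<omega>))) + s \<le> Z n \<omega>}
    \<le> exp (real n * mgf_rate \<theta> (G / \<rho>\<^sup>2) + mgf_rate \<theta> G0 - \<theta> * s)"
proof -
  let ?b = "\<Sum>i<n. expectation (\<lambda>\<omega>. g (x i \<omega>) (x (Suc i) \<omega>))"
  let ?E = "{\<omega> \<in> space M. ?b + s \<le> Z n \<omega>}"
  have E: "?E \<in> sets M" by measurable
  have "ennreal (exp (\<theta> * s)) * emeasure M ?E = (\<integral>\<^sup>+\<omega>. ennreal (exp (\<theta> * s)) * indicator ?E \<omega> \<partial>M)"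
    using E by (simp add: nn_integral_cmult_indicator)
  also have "\<dots> \<le> (\<integral>\<^sup>+\<omega>. ennreal (exp (\<theta> * (Z n \<omega> - ?b))) \<partial>M)"
    using \<theta>(1) by (intro nn_integral_mono) (auto simp: indicator_def intro!: ennreal_leI mult_left_mono)
  also have "\<dots> \<le> ennreal (exp (real n * mgf_rate \<theta> (G / \<rho>\<^sup>2) + mgf_rate \<theta> G0))" by (rule mgf_le[OF \<theta>])
  finally have "exp (\<theta> * s) * prob ?E \<le> exp (real n * mgf_rate \<theta> (G / \<rho>\<^sup>2) + mgf_rate \<theta> G0)"
    unfolding emeasure_eq_measure by (simp add: ennreal_mult[symmetric])
  then show ?thesis by (simp add: exp_diff field_simps)
qed

end

section \<open>The stationary VAR(1) process\<close>

lemma (in prob_space) integrable_powr_sum: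
  fixes Y :: "'i \<Rightarrow> 'a \<Rightarrow> real"
  assumes "finite S" "0 \<le> q" "\<And>k. k \<in> S \<Longrightarrow> Y k \<in> borel_measurable M"
    and "\<And>k. k \<in> S \<Longrightarrow> integrable M (\<lambda>\<omega>. \<bar>Y k \<omega>\<bar> powr q)"
  shows "integrable M (\<lambda>\<omega>. \<bar>\<Sum>k\<in>S. Y k \<omega>\<bar> powr q)"
  using assms
proof (induction S rule: finite_induct)
  case (insert k S)
  have [measurable]: "Y k \<in> borel_measurable M" "(\<lambda>\<omega>. \<Sum>k\<in>S. Y k \<omega>) \<in> borel_measurable M"
    using insert by auto
  show ?case
  proof (rule Bochner_Integration.integrable_bound)
    show "integrable M (\<lambda>\<omega>. 2 powr q * (\<bar>Y k \<omega>\<bar> powr q + \<bar>\<Sum>k\<in>S. Y k \<omega>\<bar> powr q))"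
      using insert by auto
  qed (use insert abs_add_powr_le_two in auto)
qed auto

text \<open>The constant \<open>(2 * C) powr (q / 2)\<close> of \<open>moment_sum_indep_le\<close>,
  at the exponent r.\<close>

definition rosenthal_const :: "real \<Rightarrow> real" where
  "rosenthal_const r = (2 * (3 powr r * (1 + r\<^sup>2))) powr (r / 2)"

lemma rosenthal_const_pos: "0 < rosenthal_const r"
proof -
  have "0 < 3 powr r * (1 + r\<^sup>2)" by (intro mult_pos_pos) (auto simp: add_pos_nonneg)
  then show ?thesis unfolding rosenthal_const_def powr_gt_zero by linarith
qed

text \<open>One sample size at a time. Constants found here serve all n only if they are built from
  M, \<epsilon>, q and \<open>\<rho>\<^sub>0\<close>.\<close>

locale var_process = prob_space M for M :: "'a measure" +
  fixes \<epsilon> :: "int \<Rightarrow> nat \<Rightarrow> 'a \<Rightarrow> real" and p :: nat and A :: "real mat" and X :: "int \<Rightarrow> 'a \<Rightarrow> real vec"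
    and \<mu> \<rho>\<^sub>0 q :: real
  assumes rho0: "0 < \<rho>\<^sub>0" "\<rho>\<^sub>0 < 1"
    and innov_iid: "iid M \<epsilon>"
    and p_pos: "0 < p"
    and A_dim: "A \<in> carrier_mat p p"
    and A_radius: "spectral_radius (map_mat complex_of_real A) < 1"
    and VAR: "stationary_VAR1 M p A \<epsilon> X"
    and mean: "\<And>i j. (\<integral>\<omega>. \<epsilon> i j \<omega> \<partial>M) = 0"
    and var: "\<And>i j. (\<integral>\<omega>. (\<epsilon> i j \<omega>)\<^sup>2 \<partial>M) = 1"
    and q: "2 < q"
    and moment: "max_coord_moment M q p X \<mu>"
begin

definition c :: "nat \<Rightarrow> nat \<Rightarrow> nat \<Rightarrow> real" where "c m i k = (A ^\<^sub>m m) $$ (i, k)"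
definition a :: "nat \<Rightarrow> nat \<Rightarrow> real" where "a i k = A $$ (i, k)"
definition \<gamma> :: real where "\<gamma> = gam \<rho>\<^sub>0 A"
definition \<tau> :: real where "\<tau> = real (tau \<rho>\<^sub>0 A)"
definition \<rho> :: real where "\<rho> = \<rho>\<^sub>0 powr (1 / \<tau>)"
text \<open>The added 1 lets this number dominate the moments of all orders between 0 and q. It
  involves neither the dimension nor the transition matrix.\<close>

definition mom :: real where "mom = 1 + expectation (\<lambda>\<omega>. \<bar>\<epsilon> 0 0 \<omega>\<bar> powr q)"

lemma \<tau>_ge_1: "1 \<le> \<tau>"
  using tau_props(1)[OF A_dim p_pos A_radius rho0(1)] by (simp add: \<tau>_def)

lemma \<rho>_bounds: "0 < \<rho>" "\<rho> < 1" "\<rho>\<^sub>0 \<le> \<rho>"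
proof -
  show "0 < \<rho>" using rho0 by (simp add: \<rho>_def)
  have "\<rho>\<^sub>0 powr (1 / \<tau>) < 1 powr (1 / \<tau>)" using rho0 \<tau>_ge_1 by (intro powr_less_mono2) auto
  then show "\<rho> < 1" by (simp add: \<rho>_def)
  have "\<rho>\<^sub>0 powr 1 \<le> \<rho>\<^sub>0 powr (1 / \<tau>)" using rho0 \<tau>_ge_1 by (intro powr_mono') auto
  then show "\<rho>\<^sub>0 \<le> \<rho>" using rho0 by (simp add: \<rho>_def)
qed

lemma inverse_one_minus_\<rho>: "1 / (1 - \<rho>) \<le> \<tau> / (1 - \<rho>\<^sub>0)"
proof -
  have "(1 - \<rho>\<^sub>0) / \<tau> \<le> 1 - \<rho>" unfolding \<rho>_def using rho0 \<tau>_ge_1 by (intro one_minus_root_ge) auto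
  then show ?thesis using \<rho>_bounds \<tau>_ge_1 rho0 by (simp add: field_simps)
qed

lemma \<gamma>_ge: "1 / \<rho>\<^sub>0 \<le> \<gamma>" "1 \<le> \<gamma>"
proof -
  show "1 / \<rho>\<^sub>0 \<le> \<gamma>" unfolding \<gamma>_def by (rule gam_ge_inverse[OF A_dim p_pos A_radius rho0])
  moreover have "1 \<le> 1 / \<rho>\<^sub>0" using rho0 by simp
  ultimately show "1 \<le> \<gamma>" by linarith
qed

lemma decay_nonneg: "0 \<le> \<gamma> * \<rho> ^ m"
proof (rule mult_nonneg_nonneg)
  show "0 \<le> \<gamma>" using \<gamma>_ge(2) by linarith
  show "0 \<le> \<rho> ^ m" using \<rho>_bounds(1) by simp
qed

lemma c_zero: "i < p \<Longrightarrow> k < p \<Longrightarrow> c 0 i k = (if i = k then 1 else 0)"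
  unfolding c_def using A_dim by simp

lemma c_Suc: "i < p \<Longrightarrow> l < p \<Longrightarrow> c (Suc m) i l = (\<Sum>k<p. c m i k * a k l)"
  unfolding c_def a_def using A_dim pow_carrier_mat[OF A_dim, of m]
  by (auto simp: scalar_prod_def lessThan_atLeast0 intro!: sum.cong)

lemma row_sq_le: "i < p \<Longrightarrow> (\<Sum>k<p. (c m i k)\<^sup>2) \<le> (\<gamma> * \<rho> ^ m)\<^sup>2"
proof -
  assume i: "i < p"
  have "(\<Sum>k<p. (c m i k)\<^sup>2) \<le> (spectral_norm (A ^\<^sub>m m))\<^sup>2"
    unfolding c_def by (rule row_sq_le_spectral_norm[OF pow_carrier_mat[OF A_dim] i])
  also have "\<dots> \<le> (\<gamma> * \<rho> ^ m)\<^sup>2"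
    using spectral_norm_pow_le[OF A_dim p_pos A_radius rho0, of m] spectral_norm_nonneg[of "A ^\<^sub>m m"]
      pow_carrier_mat[OF A_dim, of m] p_pos
    unfolding \<gamma>_def \<rho>_def \<tau>_def by (intro power_mono) auto
  finally show ?thesis .
qed

lemma abs_c_le: "i < p \<Longrightarrow> k < p \<Longrightarrow> \<bar>c m i k\<bar> \<le> \<gamma> * \<rho> ^ m"
proof -
  assume i: "i < p" "k < p"
  have "(c m i k)\<^sup>2 \<le> (\<Sum>k<p. (c m i k)\<^sup>2)" using i by (intro member_le_sum) auto
  also note row_sq_le[OF i(1)]
  finally have "\<bar>c m i k\<bar>\<^sup>2 \<le> (\<gamma> * \<rho> ^ m)\<^sup>2" by simp
  then show ?thesis using decay_nonneg by (rule power2_le_imp_le)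
qed

lemma X_measurable [measurable]: "j < p \<Longrightarrow> (\<lambda>\<omega>. X i \<omega> $ j) \<in> borel_measurable M"
  using VAR unfolding stationary_VAR1_def by blast

lemma X_carrier: "\<omega> \<in> space M \<Longrightarrow> X i \<omega> \<in> carrier_vec p"
  using VAR unfolding stationary_VAR1_def by blast

lemma X_recursion: "AE \<omega> in M. \<forall>j<p. X i \<omega> $ j = (\<Sum>k<p. a j k * X (i - 1) \<omega> $ k) + \<epsilon> i j \<omega>"
proof -
  have "AE \<omega> in M. X i \<omega> = A *\<^sub>v X (i - 1) \<omega> + Matrix.vec p (\<lambda>j. \<epsilon> i j \<omega>)"
    using VAR unfolding stationary_VAR1_def by blast
  then show ?thesis
  proof (rule AE_mp, intro AE_I2 impI allI)
    fix \<omega> j assume \<omega>: "\<omega> \<in> space M" and eq: "X i \<omega> = A *\<^sub>v X (i - 1) \<omega> + Matrix.vec p (\<lambda>j. \<epsilon> i j \<omega>)" and j: "j < p"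
    have "(A *\<^sub>v X (i - 1) \<omega>) $ j = (\<Sum>k<p. a j k * X (i - 1) \<omega> $ k)"
      using A_dim X_carrier[OF \<omega>, of "i - 1"] j by (auto simp: a_def scalar_prod_def lessThan_atLeast0 intro!: sum.cong)
    then show "X i \<omega> $ j = (\<Sum>k<p. a j k * X (i - 1) \<omega> $ k) + \<epsilon> i j \<omega>"
      using j A_dim by (subst eq) simp
  qed
qed

lemma X_powr_integrable: "j < p \<Longrightarrow> integrable M (\<lambda>\<omega>. \<bar>X i \<omega> $ j\<bar> powr q)"
  using moment unfolding max_coord_moment_def by blast

lemma \<epsilon>_indep: "indep_vars (\<lambda>_. borel) (\<lambda>(i, j). \<epsilon> i j) UNIV"
  using innov_iid unfolding iid_def by blast

lemma \<epsilon>_distr: "distr M borel (\<epsilon> i j) = distr M borel (\<epsilon> 0 0)"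
  using innov_iid unfolding iid_def by blast

lemma \<epsilon>_measurable [measurable]: "\<epsilon> i j \<in> borel_measurable M"
proof -
  have "random_variable borel ((\<lambda>(i, j). \<epsilon> i j) (i, j))"
    using \<epsilon>_indep unfolding indep_vars_def by blast
  then show ?thesis by simp
qed

lemma integrable_\<epsilon>_iff:
  fixes f :: "real \<Rightarrow> real"
  assumes [measurable]: "f \<in> borel_measurable borel"
  shows "integrable M (\<lambda>\<omega>. f (\<epsilon> i j \<omega>)) \<longleftrightarrow> integrable M (\<lambda>\<omega>. f (\<epsilon> 0 0 \<omega>))"
    "expectation (\<lambda>\<omega>. f (\<epsilon> i j \<omega>)) = expectation (\<lambda>\<omega>. f (\<epsilon> 0 0 \<omega>))"
proof -
  have "integrable (distr M borel (\<epsilon> i j)) f = integrable (distr M borel (\<epsilon> 0 0)) f"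
    by (subst \<epsilon>_distr) (rule refl)
  then show "integrable M (\<lambda>\<omega>. f (\<epsilon> i j \<omega>)) \<longleftrightarrow> integrable M (\<lambda>\<omega>. f (\<epsilon> 0 0 \<omega>))"
    by (simp add: integrable_distr_eq)
  have "integral\<^sup>L (distr M borel (\<epsilon> i j)) f = integral\<^sup>L (distr M borel (\<epsilon> 0 0)) f"
    by (subst \<epsilon>_distr) (rule refl)
  then show "expectation (\<lambda>\<omega>. f (\<epsilon> i j \<omega>)) = expectation (\<lambda>\<omega>. f (\<epsilon> 0 0 \<omega>))"
    by (simp add: integral_distr)
qed

text \<open>The moment hypothesis concerns the process; the innovation inherits it as X_0 - A
  X_(-1).\<close>

lemma \<epsilon>_powr_integrable: "integrable M (\<lambda>\<omega>. \<bar>\<epsilon> i j \<omega>\<bar> powr q)"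
proof -
  have i1: "integrable M (\<lambda>\<omega>. \<bar>\<Sum>k<p. - a 0 k * X (- 1) \<omega> $ k\<bar> powr q)"
    using X_powr_integrable q by (intro integrable_powr_sum) (auto simp: abs_mult powr_mult)
  have i2: "integrable M (\<lambda>\<omega>. \<bar>X 0 \<omega> $ 0\<bar> powr q)" using X_powr_integrable p_pos by blast
  have [measurable]: "(\<lambda>\<omega>. X 0 \<omega> $ 0) \<in> borel_measurable M" "(\<lambda>\<omega>. \<Sum>k<p. - a 0 k * X (- 1) \<omega> $ k) \<in> borel_measurable M"
    using p_pos by auto
  have i3: "integrable M (\<lambda>\<omega>. \<bar>X 0 \<omega> $ 0 + (\<Sum>k<p. - a 0 k * X (- 1) \<omega> $ k)\<bar> powr q)"
  proof (rule Bochner_Integration.integrable_bound)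
    show "integrable M (\<lambda>\<omega>. 2 powr q * (\<bar>X 0 \<omega> $ 0\<bar> powr q + \<bar>\<Sum>k<p. - a 0 k * X (- 1) \<omega> $ k\<bar> powr q))"
      using i1 i2 by auto
  qed (use q abs_add_powr_le_two in auto)
  have "AE \<omega> in M. \<bar>X 0 \<omega> $ 0 + (\<Sum>k<p. - a 0 k * X (- 1) \<omega> $ k)\<bar> powr q = \<bar>\<epsilon> 0 0 \<omega>\<bar> powr q"
    using X_recursion[of 0] by eventually_elim (use p_pos in \<open>auto simp: sum_negf\<close>)
  then have "integrable M (\<lambda>\<omega>. \<bar>\<epsilon> 0 0 \<omega>\<bar> powr q)"
    using i3 by (subst integrable_cong_AE[symmetric]) auto
  then show ?thesis using integrable_\<epsilon>_iff(1)[of "\<lambda>x. \<bar>x\<bar> powr q" i j] by simp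
qed

lemma \<epsilon>_powr_moment: "0 \<le> r \<Longrightarrow> r \<le> q \<Longrightarrow> integrable M (\<lambda>\<omega>. \<bar>\<epsilon> i j \<omega>\<bar> powr r)"
  "0 \<le> r \<Longrightarrow> r \<le> q \<Longrightarrow> expectation (\<lambda>\<omega>. \<bar>\<epsilon> i j \<omega>\<bar> powr r) \<le> mom"
proof -
  assume r: "0 \<le> r" "r \<le> q"
  show i: "integrable M (\<lambda>\<omega>. \<bar>\<epsilon> i j \<omega>\<bar> powr r)"
    by (rule integrable_powr_smaller[OF \<epsilon>_powr_integrable _ r]) simp
  have "expectation (\<lambda>\<omega>. \<bar>\<epsilon> i j \<omega>\<bar> powr r) \<le> expectation (\<lambda>\<omega>. 1 + \<bar>\<epsilon> i j \<omega>\<bar> powr q)"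
    using i \<epsilon>_powr_integrable r by (intro integral_mono powr_le_one_plus) auto
  also have "\<dots> = mom" 
    unfolding mom_def using \<epsilon>_powr_integrable integrable_\<epsilon>_iff(2)[of "\<lambda>x. \<bar>x\<bar> powr q" i j] by (simp add: prob_space)
  finally show "expectation (\<lambda>\<omega>. \<bar>\<epsilon> i j \<omega>\<bar> powr r) \<le> mom" .
qed

lemma mom_ge_1: "1 \<le> mom" unfolding mom_def by simp

lemma \<epsilon>_sq_integrable: "integrable M (\<lambda>\<omega>. (\<epsilon> i j \<omega>)\<^sup>2)"
  using \<epsilon>_powr_moment(1)[of 2 i j] q by simp

lemma \<epsilon>_integrable: "integrable M (\<epsilon> i j)"
  using \<epsilon>_powr_moment(1)[of 1 i j] q by (subst integrable_abs_iff[symmetric]) auto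

lemma noise_moment:
  fixes w :: "int \<times> nat \<Rightarrow> real"
  assumes F: "finite F" and r: "2 \<le> r" "r \<le> q"
  shows "integrable M (\<lambda>\<omega>. \<bar>\<Sum>z\<in>F. w z * \<epsilon> (fst z) (snd z) \<omega>\<bar> powr r)"
    "expectation (\<lambda>\<omega>. \<bar>\<Sum>z\<in>F. w z * \<epsilon> (fst z) (snd z) \<omega>\<bar> powr r) \<le> rosenthal_const r * mom * (\<Sum>z\<in>F. (w z)\<^sup>2) powr (r / 2)"
proof -
  have ind: "indep_vars (\<lambda>_. borel) (\<lambda>z \<omega>. w z * (case z of (i, j) \<Rightarrow> \<epsilon> i j) \<omega>) F"
    by (rule indep_vars_compose2[OF indep_vars_subset[OF \<epsilon>_indep]]) auto
  then have ind: "indep_vars (\<lambda>_. borel) (\<lambda>z \<omega>. w z * \<epsilon> (fst z) (snd z) \<omega>) F"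
    by (simp add: case_prod_beta)
  have "integrable M (\<lambda>\<omega>. \<bar>\<Sum>z\<in>F. w z * \<epsilon> (fst z) (snd z) \<omega>\<bar> powr r) \<and>
    expectation (\<lambda>\<omega>. \<bar>\<Sum>z\<in>F. w z * \<epsilon> (fst z) (snd z) \<omega>\<bar> powr r) \<le>
      (2 * (3 powr r * (1 + r\<^sup>2))) powr (r / 2) * mom * (\<Sum>z\<in>F. (\<bar>w z\<bar>)\<^sup>2) powr (r / 2)"
  proof (rule moment_sum_indep_le[OF r(1) F ind])
    fix z assume "z \<in> F"
    show "integrable M (\<lambda>\<omega>. \<bar>w z * \<epsilon> (fst z) (snd z) \<omega>\<bar> powr r)"
      using \<epsilon>_powr_moment(1) r by (simp add: abs_mult powr_mult)
    show "expectation (\<lambda>\<omega>. w z * \<epsilon> (fst z) (snd z) \<omega>) = 0" using mean by simp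
    show "expectation (\<lambda>\<omega>. (w z * \<epsilon> (fst z) (snd z) \<omega>)\<^sup>2) \<le> \<bar>w z\<bar>\<^sup>2" using var by (simp add: power_mult_distrib)
    show "expectation (\<lambda>\<omega>. \<bar>w z * \<epsilon> (fst z) (snd z) \<omega>\<bar> powr r) \<le> mom * \<bar>w z\<bar> powr r"
      using \<epsilon>_powr_moment(2)[of r "fst z" "snd z"] r 
      by (simp add: abs_mult powr_mult mult.commute[of mom] mult_left_mono)
  qed (use mom_ge_1 in auto)
  then show "integrable M (\<lambda>\<omega>. \<bar>\<Sum>z\<in>F. w z * \<epsilon> (fst z) (snd z) \<omega>\<bar> powr r)"
    "expectation (\<lambda>\<omega>. \<bar>\<Sum>z\<in>F. w z * \<epsilon> (fst z) (snd z) \<omega>\<bar> powr r) \<le> rosenthal_const r * mom * (\<Sum>z\<in>F. (w z)\<^sup>2) powr (r / 2)"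
    unfolding rosenthal_const_def by auto
qed

section \<open>Moving average expansion of A^m X_i: noise part \<open>ma\<close>, remainder
  \<open>rem\<close>\<close>

definition ma :: "nat \<Rightarrow> int \<Rightarrow> nat \<Rightarrow> nat \<Rightarrow> 'a \<Rightarrow> real" where
  "ma m i j N \<omega> = (\<Sum>t<N. \<Sum>k<p. c (m + t) j k * \<epsilon> (i - int t) k \<omega>)"

definition rem :: "nat \<Rightarrow> int \<Rightarrow> nat \<Rightarrow> nat \<Rightarrow> 'a \<Rightarrow> real" where
  "rem m i j N \<omega> = (\<Sum>k<p. c (m + N) j k * X (i - int N) \<omega> $ k)"

lemma rem_measurable [measurable]: "rem m i j N \<in> borel_measurable M"
  unfolding rem_def by measurable

lemma ma_measurable [measurable]: "ma m i j N \<in> borel_measurable M"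
  unfolding ma_def by measurable

text \<open>Unrolling the recursion once more replaces the state in the remainder. One null set
  serves all times, since these are countably many.\<close>

lemma ma_expansion:
  assumes j: "j < p"
  shows "AE \<omega> in M. \<forall>N. (\<Sum>k<p. c m j k * X i \<omega> $ k) = ma m i j N \<omega> + rem m i j N \<omega>"
proof -
  have "AE \<omega> in M. \<forall>i. \<forall>j<p. X i \<omega> $ j = (\<Sum>k<p. a j k * X (i - 1) \<omega> $ k) + \<epsilon> i j \<omega>"
    by (subst AE_all_countable) (use X_recursion in blast)
  then show ?thesis
  proof (rule AE_mp, intro AE_I2 impI allI)
    fix \<omega> N assume rec: "\<forall>i. \<forall>j<p. X i \<omega> $ j = (\<Sum>k<p. a j k * X (i - 1) \<omega> $ k) + \<epsilon> i j \<omega>"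
    show "(\<Sum>k<p. c m j k * X i \<omega> $ k) = ma m i j N \<omega> + rem m i j N \<omega>"
    proof (induction N)
      case 0 then show ?case by (simp add: ma_def rem_def)
    next
      case (Suc N)
      let ?i = "i - int N"
      have "rem m i j N \<omega> = (\<Sum>k<p. c (m + N) j k * ((\<Sum>l<p. a k l * X (?i - 1) \<omega> $ l) + \<epsilon> ?i k \<omega>))"
        unfolding rem_def
      proof (rule sum.cong[OF refl])
        fix k assume "k \<in> {..<p}"
        then have "X ?i \<omega> $ k = (\<Sum>l<p. a k l * X (?i - 1) \<omega> $ l) + \<epsilon> ?i k \<omega>" using rec by blast
        then show "c (m + N) j k * X ?i \<omega> $ k = c (m + N) j k * ((\<Sum>l<p. a k l * X (?i - 1) \<omega> $ l) + \<epsilon> ?i k \<omega>)" by simp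
      qed
      also have "\<dots> = (\<Sum>k<p. \<Sum>l<p. c (m + N) j k * (a k l * X (?i - 1) \<omega> $ l)) + (\<Sum>k<p. c (m + N) j k * \<epsilon> ?i k \<omega>)"
        by (simp add: distrib_left sum.distrib sum_distrib_left)
      also have "(\<Sum>k<p. \<Sum>l<p. c (m + N) j k * (a k l * X (?i - 1) \<omega> $ l)) =
          (\<Sum>l<p. \<Sum>k<p. c (m + N) j k * (a k l * X (?i - 1) \<omega> $ l))" by (rule sum.swap)
      also have "\<dots> = rem m i j (Suc N) \<omega>"
        unfolding rem_def
      proof (rule sum.cong[OF refl])
        fix l assume "l \<in> {..<p}"
        then have "c (m + Suc N) j l = (\<Sum>k<p. c (m + N) j k * a k l)" using c_Suc[OF j] by simp
        then show "(\<Sum>k<p. c (m + N) j k * (a k l * X (?i - 1) \<omega> $ l)) = c (m + Suc N) j l * X (i - int (Suc N)) \<omega> $ l"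
          by (simp add: sum_distrib_right mult.assoc algebra_simps(2) diff_diff_eq add.commute)
      qed
      finally show ?case using Suc by (simp add: ma_def)
    qed
  qed
qed

lemma abs_rem_le: "j < p \<Longrightarrow> \<bar>rem m i j N \<omega>\<bar> \<le> \<gamma> * \<rho> ^ (m + N) * (\<Sum>k<p. \<bar>X (i - int N) \<omega> $ k\<bar>)"
  unfolding rem_def sum_distrib_left
  by (rule order_trans[OF sum_abs], rule sum_mono) (auto simp: abs_mult intro!: mult_right_mono abs_c_le)

lemma powr_sum_le:
  fixes y :: "nat \<Rightarrow> real"
  assumes "\<And>k. k < p \<Longrightarrow> 0 \<le> y k" "0 \<le> r"
  shows "(\<Sum>k<p. y k) powr r \<le> real p powr r * (\<Sum>k<p. y k powr r)"
proof -
  obtain k where k: "k < p" "\<And>l. l < p \<Longrightarrow> y l \<le> y k"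
  proof -
    have "Max (y ` {..<p}) \<in> y ` {..<p}" using p_pos by (intro Max_in) auto
    then obtain k where "k < p" "y k = Max (y ` {..<p})" by auto
    then show ?thesis using that[of k] by (metis Max_ge finite_imageI finite_lessThan imageI lessThan_iff)
  qed
  have "(\<Sum>k<p. y k) \<le> real p * y k" using sum_bounded_above[of "{..<p}" y "y k"] k by simp
  then have "(\<Sum>k<p. y k) powr r \<le> (real p * y k) powr r" using assms by (intro powr_mono2 sum_nonneg) auto
  also have "\<dots> = real p powr r * y k powr r" using assms(1)[OF k(1)] by (simp add: powr_mult)
  also have "\<dots> \<le> real p powr r * (\<Sum>k<p. y k powr r)"
    using k by (intro mult_left_mono member_le_sum[of k "{..<p}" "\<lambda>k. y k powr r"]) auto
  finally show ?thesis .
qed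

lemma mu_nonneg: "0 \<le> \<mu>"
proof -
  have "Max ((\<lambda>j. Lq_norm M q (\<lambda>\<omega>. X 0 \<omega> $ j)) ` {..<p}) = \<mu>" using moment unfolding max_coord_moment_def by blast
  moreover have "Lq_norm M q (\<lambda>\<omega>. X 0 \<omega> $ 0) \<le> Max ((\<lambda>j. Lq_norm M q (\<lambda>\<omega>. X 0 \<omega> $ j)) ` {..<p})"
    using p_pos by (intro Max_ge) auto
  moreover have "0 \<le> Lq_norm M q (\<lambda>\<omega>. X 0 \<omega> $ 0)" unfolding Lq_norm_def by simp
  ultimately show ?thesis by linarith
qed

lemma X_powr_moment_le: "j < p \<Longrightarrow> expectation (\<lambda>\<omega>. \<bar>X i \<omega> $ j\<bar> powr q) \<le> \<mu> powr q"
proof -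
  assume j: "j < p"
  have "Max ((\<lambda>j. Lq_norm M q (\<lambda>\<omega>. X i \<omega> $ j)) ` {..<p}) = \<mu>" using moment unfolding max_coord_moment_def by blast
  then have "Lq_norm M q (\<lambda>\<omega>. X i \<omega> $ j) \<le> \<mu>" using j by (metis (no_types, lifting) Max_ge finite_imageI finite_lessThan imageI lessThan_iff)
  then have "Lq_norm M q (\<lambda>\<omega>. X i \<omega> $ j) powr q \<le> \<mu> powr q" using q unfolding Lq_norm_def by (intro powr_mono2) auto
  then show ?thesis unfolding Lq_norm_def using q by (simp add: powr_powr integral_nonneg)
qed

lemma X_powr_moment: 
  assumes "j < p" "0 \<le> r" "r \<le> q"
  shows "integrable M (\<lambda>\<omega>. \<bar>X i \<omega> $ j\<bar> powr r)" "expectation (\<lambda>\<omega>. \<bar>X i \<omega> $ j\<bar> powr r) \<le> 1 + \<mu> powr q"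
proof -
  have [measurable]: "(\<lambda>\<omega>. X i \<omega> $ j) \<in> borel_measurable M" using assms by simp
  show i: "integrable M (\<lambda>\<omega>. \<bar>X i \<omega> $ j\<bar> powr r)"
    by (rule integrable_powr_smaller[OF X_powr_integrable _ assms(2,3)]) (use assms in auto)
  have "expectation (\<lambda>\<omega>. \<bar>X i \<omega> $ j\<bar> powr r) \<le> expectation (\<lambda>\<omega>. 1 + \<bar>X i \<omega> $ j\<bar> powr q)"
    using i X_powr_integrable[OF assms(1)] assms by (intro integral_mono powr_le_one_plus) auto
  also have "\<dots> \<le> 1 + \<mu> powr q" using X_powr_integrable[OF assms(1)] X_powr_moment_le[OF assms(1), of i] by (simp add: prob_space)
  finally show "expectation (\<lambda>\<omega>. \<bar>X i \<omega> $ j\<bar> powr r) \<le> 1 + \<mu> powr q" .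
qed

text \<open>The dependence on p is wasteful but harmless: the remainder is only sent to 0 as N
  grows, with p fixed.\<close>

lemma rem_moment:
  assumes j: "j < p" and r: "0 \<le> r" "r \<le> q"
  shows "integrable M (\<lambda>\<omega>. \<bar>rem m i j N \<omega>\<bar> powr r)"
    "expectation (\<lambda>\<omega>. \<bar>rem m i j N \<omega>\<bar> powr r) \<le> (\<gamma> * \<rho> ^ (m + N)) powr r * (real p powr r * (real p * (1 + \<mu> powr q)))"
proof -
  let ?b = "\<lambda>\<omega>. (\<gamma> * \<rho> ^ (m + N)) powr r * (real p powr r * (\<Sum>k<p. \<bar>X (i - int N) \<omega> $ k\<bar> powr r))"
  have le: "\<bar>rem m i j N \<omega>\<bar> powr r \<le> ?b \<omega>" for \<omega>
  proof -
    have "\<bar>rem m i j N \<omega>\<bar> powr r \<le> (\<gamma> * \<rho> ^ (m + N) * (\<Sum>k<p. \<bar>X (i - int N) \<omega> $ k\<bar>)) powr r"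
      using r by (intro powr_mono2 abs_rem_le j) auto
    also have "\<dots> = (\<gamma> * \<rho> ^ (m + N)) powr r * (\<Sum>k<p. \<bar>X (i - int N) \<omega> $ k\<bar>) powr r"
      by (subst powr_mult) (auto simp: sum_nonneg decay_nonneg)
    also have "\<dots> \<le> ?b \<omega>" using r by (intro mult_left_mono powr_sum_le) auto
    finally show ?thesis .
  qed
  have int: "integrable M ?b" using X_powr_moment(1) r by (intro integrable_mult_right Bochner_Integration.integrable_sum) auto
  show i: "integrable M (\<lambda>\<omega>. \<bar>rem m i j N \<omega>\<bar> powr r)"
    by (rule Bochner_Integration.integrable_bound[OF int]) (use le in \<open>auto intro: order_trans[OF _ abs_ge_self]\<close>)
  have "expectation (\<lambda>\<omega>. \<bar>rem m i j N \<omega>\<bar> powr r) \<le> expectation ?b" using i int le by (intro integral_mono) auto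
  also have "\<dots> = (\<gamma> * \<rho> ^ (m + N)) powr r * (real p powr r * (\<Sum>k<p. expectation (\<lambda>\<omega>. \<bar>X (i - int N) \<omega> $ k\<bar> powr r)))"
    using X_powr_moment(1) r by (simp add: Bochner_Integration.integral_sum)
  also have "\<dots> \<le> (\<gamma> * \<rho> ^ (m + N)) powr r * (real p powr r * (real p * (1 + \<mu> powr q)))"
    using X_powr_moment(2) r sum_bounded_above[of "{..<p}" "\<lambda>k. expectation (\<lambda>\<omega>. \<bar>X (i - int N) \<omega> $ k\<bar> powr r)" "1 + \<mu> powr q"]
    by (intro mult_left_mono) auto
  finally show "expectation (\<lambda>\<omega>. \<bar>rem m i j N \<omega>\<bar> powr r) \<le> (\<gamma> * \<rho> ^ (m + N)) powr r * (real p powr r * (real p * (1 + \<mu> powr q)))" .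
qed

text \<open>The squared coefficients of the innovations of one time add up to a squared row norm, at
  most (\<gamma> \<rho>^(m+t))^2, so no factor p arises; the sum over t is geometric.\<close>

lemma ma_moment:
  assumes j: "j < p" and r: "2 \<le> r" "r \<le> q"
  shows "integrable M (\<lambda>\<omega>. \<bar>ma m i j N \<omega>\<bar> powr r)"
    "expectation (\<lambda>\<omega>. \<bar>ma m i j N \<omega>\<bar> powr r) \<le> rosenthal_const r * mom * (\<gamma>\<^sup>2 * \<rho> ^ (2 * m) / (1 - \<rho>)) powr (r / 2)"
proof -
  let ?f = "\<lambda>(t, k). (i - int t, k)"
  let ?T = "{..<N} \<times> {..<p}"
  define w where "w = (\<lambda>z :: int \<times> nat. c (m + nat (i - fst z)) j (snd z))"
  have inj: "inj_on ?f ?T" by (auto simp: inj_on_def)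
  have eq: "ma m i j N \<omega> = (\<Sum>z\<in>?f ` ?T. w z * \<epsilon> (fst z) (snd z) \<omega>)" for \<omega>
    unfolding ma_def by (subst sum.reindex[OF inj]) (simp add: sum.cartesian_product w_def case_prod_beta)
  have "(\<Sum>z\<in>?f ` ?T. (w z)\<^sup>2) = (\<Sum>t<N. \<Sum>k<p. (c (m + t) j k)\<^sup>2)"
    by (subst sum.reindex[OF inj]) (simp add: sum.cartesian_product w_def case_prod_beta)
  also have "\<dots> \<le> (\<Sum>t<N. (\<gamma> * \<rho> ^ (m + t))\<^sup>2)" by (intro sum_mono row_sq_le j)
  also have "\<dots> = \<gamma>\<^sup>2 * \<rho> ^ (2 * m) * (\<Sum>t<N. (\<rho>\<^sup>2) ^ t)"
    unfolding sum_distrib_left by (intro sum.cong) (auto simp: power_mult_distrib power_add power_mult[symmetric] mult_ac)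
  also have "\<dots> \<le> \<gamma>\<^sup>2 * \<rho> ^ (2 * m) * (1 / (1 - \<rho>))"
  proof (rule mult_left_mono)
    have "\<rho>\<^sup>2 \<le> \<rho>" using \<rho>_bounds by (simp add: power2_eq_square mult_left_le)
    then have "(\<Sum>t<N. (\<rho>\<^sup>2) ^ t) \<le> (\<Sum>t<N. \<rho> ^ t)" by (intro sum_mono power_mono) auto
    also have "\<dots> \<le> 1 / (1 - \<rho>)" using \<rho>_bounds by (simp add: sum_gp_strict divide_right_mono)
    finally show "(\<Sum>t<N. (\<rho>\<^sup>2) ^ t) \<le> 1 / (1 - \<rho>)" .
  qed (use \<rho>_bounds in auto)
  finally have V: "(\<Sum>z\<in>?f ` ?T. (w z)\<^sup>2) \<le> \<gamma>\<^sup>2 * \<rho> ^ (2 * m) / (1 - \<rho>)" by simp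
  have fin: "finite (?f ` ?T)" by simp
  show "integrable M (\<lambda>\<omega>. \<bar>ma m i j N \<omega>\<bar> powr r)"
    unfolding eq by (rule noise_moment(1)[OF fin r])
  have "expectation (\<lambda>\<omega>. \<bar>ma m i j N \<omega>\<bar> powr r) \<le> rosenthal_const r * mom * (\<Sum>z\<in>?f ` ?T. (w z)\<^sup>2) powr (r / 2)"
    unfolding eq by (rule noise_moment(2)[OF fin r])
  also have "\<dots> \<le> rosenthal_const r * mom * (\<gamma>\<^sup>2 * \<rho> ^ (2 * m) / (1 - \<rho>)) powr (r / 2)"
    using V r mom_ge_1 rosenthal_const_pos[of r] by (intro mult_left_mono powr_mono2) (auto simp: sum_nonneg)
  finally show "expectation (\<lambda>\<omega>. \<bar>ma m i j N \<omega>\<bar> powr r) \<le> rosenthal_const r * mom * (\<gamma>\<^sup>2 * \<rho> ^ (2 * m) / (1 - \<rho>)) powr (r / 2)" .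
qed

text \<open>Noise part plus remainder, with N tending to infinity so that the remainder drops out.
  The factor 2^r is the price of splitting the power of a sum.\<close>

lemma state_moment:
  assumes j: "j < p" and r: "2 \<le> r" "r \<le> q"
  shows "integrable M (\<lambda>\<omega>. \<bar>\<Sum>k<p. c m j k * X i \<omega> $ k\<bar> powr r)"
    "expectation (\<lambda>\<omega>. \<bar>\<Sum>k<p. c m j k * X i \<omega> $ k\<bar> powr r) \<le>
      2 powr r * (rosenthal_const r * mom * (\<gamma>\<^sup>2 * \<rho> ^ (2 * m) / (1 - \<rho>)) powr (r / 2))"
proof -
  let ?Y = "\<lambda>\<omega>. \<Sum>k<p. c m j k * X i \<omega> $ k"
  let ?R = "\<lambda>N. (\<gamma> * \<rho> ^ (m + N)) powr r * (real p powr r * (real p * (1 + \<mu> powr q)))"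
  let ?K = "rosenthal_const r * mom * (\<gamma>\<^sup>2 * \<rho> ^ (2 * m) / (1 - \<rho>)) powr (r / 2)"
  show i: "integrable M (\<lambda>\<omega>. \<bar>?Y \<omega>\<bar> powr r)"
    using X_powr_moment(1) r by (intro integrable_powr_sum) (auto simp: abs_mult powr_mult)
  have "expectation (\<lambda>\<omega>. \<bar>?Y \<omega>\<bar> powr r) \<le> 2 powr r * (?K + ?R N)" for N
  proof -
    have r0: "0 \<le> r" using r by simp
    note im = ma_moment[OF j r, of m i N] and ir = rem_moment[OF j r0 r(2), of m i N]
    have "expectation (\<lambda>\<omega>. \<bar>?Y \<omega>\<bar> powr r) \<le> expectation (\<lambda>\<omega>. 2 powr r * (\<bar>ma m i j N \<omega>\<bar> powr r + \<bar>rem m i j N \<omega>\<bar> powr r))"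
    proof (rule integral_mono_AE[OF i])
      show "AE \<omega> in M. \<bar>?Y \<omega>\<bar> powr r \<le> 2 powr r * (\<bar>ma m i j N \<omega>\<bar> powr r + \<bar>rem m i j N \<omega>\<bar> powr r)"
        using ma_expansion[OF j, of m i] by eventually_elim (metis abs_add_powr_le_two[OF r0])
    qed (use im ir in auto)
    also have "\<dots> = 2 powr r * (expectation (\<lambda>\<omega>. \<bar>ma m i j N \<omega>\<bar> powr r) + expectation (\<lambda>\<omega>. \<bar>rem m i j N \<omega>\<bar> powr r))"
      using im ir by simp
    also have "\<dots> \<le> 2 powr r * (?K + ?R N)" using im ir by (intro mult_left_mono add_mono) auto
    finally show ?thesis .
  qed
  moreover have "(\<lambda>N. 2 powr r * (?K + ?R N)) \<longlonglongrightarrow> 2 powr r * (?K + 0)"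
  proof (intro tendsto_mult_left tendsto_add tendsto_const tendsto_mult_left_zero)
    have "(\<lambda>N. \<gamma> * \<rho> ^ m * \<rho> ^ N) \<longlonglongrightarrow> 0"
      using \<rho>_bounds by (intro tendsto_mult_right_zero LIMSEQ_power_zero) auto
    then have "(\<lambda>N. \<gamma> * \<rho> ^ (m + N)) \<longlonglongrightarrow> 0" by (simp add: power_add mult.assoc)
    then have "(\<lambda>N. (\<gamma> * \<rho> ^ (m + N)) powr r) \<longlonglongrightarrow> 0 powr r"
      using r by (intro tendsto_powr2 always_eventually allI decay_nonneg tendsto_const) auto
    then show "(\<lambda>N. (\<gamma> * \<rho> ^ (m + N)) powr r) \<longlonglongrightarrow> 0" using r by simp
  qed
  ultimately show "expectation (\<lambda>\<omega>. \<bar>?Y \<omega>\<bar> powr r) \<le> 2 powr r * ?K"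
    by (intro LIMSEQ_le_const[of "\<lambda>N. 2 powr r * (?K + ?R N)"]) auto
qed

end

lemma (in prob_space) product_law_compose:
  assumes X: "X \<in> M \<rightarrow>\<^sub>M S" and Y: "Y \<in> M \<rightarrow>\<^sub>M T" and f: "f \<in> S \<rightarrow>\<^sub>M S'" and g: "g \<in> T \<rightarrow>\<^sub>M T'"
    and d: "distr M S X \<Otimes>\<^sub>M distr M T Y = distr M (S \<Otimes>\<^sub>M T) (\<lambda>x. (X x, Y x))"
  shows "distr M S' (\<lambda>x. f (X x)) \<Otimes>\<^sub>M distr M T' (\<lambda>x. g (Y x)) = distr M (S' \<Otimes>\<^sub>M T') (\<lambda>x. (f (X x), g (Y x)))"
proof -
  have pY: "prob_space (distr (distr M T Y) T' g)"
    by (intro prob_space.prob_space_distr prob_space_distr Y) (use g in simp)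
  note [measurable] = X Y f g
  have "distr M S' (\<lambda>x. f (X x)) \<Otimes>\<^sub>M distr M T' (\<lambda>x. g (Y x)) = distr (distr M S X) S' f \<Otimes>\<^sub>M distr (distr M T Y) T' g"
    by (simp add: distr_distr comp_def)
  also have "\<dots> = distr (distr M S X \<Otimes>\<^sub>M distr M T Y) (S' \<Otimes>\<^sub>M T') (\<lambda>(x, y). (f x, g y))"
    using pY by (intro pair_measure_distr) (auto intro: prob_space_imp_sigma_finite)
  also have "\<dots> = distr M (S' \<Otimes>\<^sub>M T') (\<lambda>x. (f (X x), g (Y x)))"
    unfolding d by (subst distr_distr) (auto simp: comp_def)
  finally show ?thesis .
qed

section \<open>The causal representation and the resulting chain\<close>

context var_process
begin

text \<open>The first absolute moments decay geometrically, so the series of absolute remainders has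
  finite expectation and converges almost surely.\<close>

lemma rem_tendsto_0:
  assumes j: "j < p"
  shows "AE \<omega> in M. (\<lambda>N. rem 0 i j N \<omega>) \<longlonglongrightarrow> 0"
proof -
  let ?C = "\<gamma> * (real p * (real p * (1 + \<mu> powr q)))"
  have C: "0 \<le> ?C" using \<gamma>_ge(2) by simp
  have bnd: "(\<integral>\<^sup>+\<omega>. ennreal \<bar>rem 0 i j N \<omega>\<bar> \<partial>M) \<le> ennreal (?C * \<rho> ^ N)" for N
  proof -
    note m = rem_moment[OF j, of 1 0 i N]
    have i: "integrable M (\<lambda>\<omega>. \<bar>rem 0 i j N \<omega>\<bar>)" using m(1) q by simp
    have e: "expectation (\<lambda>\<omega>. \<bar>rem 0 i j N \<omega>\<bar>) \<le> ?C * \<rho> ^ N"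
      using m(2) q decay_nonneg[of N] by (simp add: mult_ac)
    show ?thesis using nn_integral_eq_integral[OF i] e by (simp add: ennreal_leI)
  qed
  have "(\<integral>\<^sup>+\<omega>. (\<Sum>N. ennreal \<bar>rem 0 i j N \<omega>\<bar>) \<partial>M) = (\<Sum>N. \<integral>\<^sup>+\<omega>. ennreal \<bar>rem 0 i j N \<omega>\<bar> \<partial>M)"
    by (rule nn_integral_suminf) auto
  also have "\<dots> \<le> (\<Sum>N. ennreal (?C * \<rho> ^ N))" by (intro suminf_le bnd summableI)
  also have "\<dots> = ennreal (?C * (1 / (1 - \<rho>)))"
    using \<rho>_bounds C by (intro suminf_ennreal_eq sums_mult geometric_sums) auto
  also have "\<dots> < \<infinity>" by simp
  finally have "(\<integral>\<^sup>+\<omega>. (\<Sum>N. ennreal \<bar>rem 0 i j N \<omega>\<bar>) \<partial>M) \<noteq> \<infinity>" by simp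
  then have "AE \<omega> in M. (\<Sum>N. ennreal \<bar>rem 0 i j N \<omega>\<bar>) \<noteq> \<infinity>"
    by (intro nn_integral_noteq_infinite) auto
  then show ?thesis
  proof (rule AE_mp, intro AE_I2 impI)
    fix \<omega> assume "(\<Sum>N. ennreal \<bar>rem 0 i j N \<omega>\<bar>) \<noteq> \<infinity>"
    then have "summable (\<lambda>N. \<bar>rem 0 i j N \<omega>\<bar>)" by (intro summable_suminf_not_top) auto
    then show "(\<lambda>N. rem 0 i j N \<omega>) \<longlonglongrightarrow> 0" using summable_LIMSEQ_zero tendsto_rabs_zero_iff by blast
  qed
qed

text \<open>\<open>stationary_VAR1\<close> does not require causality; that \<open>X\<close> is almost surely this function of the past noise
  (\<open>x_eq_X\<close>) yields the independence of the current state from the future innovations.\<close>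

primrec causal :: "nat \<Rightarrow> (int \<times> nat \<Rightarrow> real) \<Rightarrow> nat \<Rightarrow> real" where
  "causal 0 u = (\<lambda>j\<in>{..<p}. lim (\<lambda>N. \<Sum>t<N. \<Sum>k<p. c t j k * u (- int t, k)))"
| "causal (Suc l) u = var_step p a (causal l u) (\<lambda>k\<in>{..<p}. u (int l + 1, k))"

definition noise :: "'a \<Rightarrow> int \<times> nat \<Rightarrow> real" where "noise \<omega> = (\<lambda>z. \<epsilon> (fst z) (snd z) \<omega>)"
definition x :: "nat \<Rightarrow> 'a \<Rightarrow> nat \<Rightarrow> real" where "x l \<omega> = causal l (noise \<omega>)"
text \<open>Shifted by one: this is the innovation of time l + 1, which leads from state l to state
  l + 1.\<close>

definition e :: "nat \<Rightarrow> 'a \<Rightarrow> nat \<Rightarrow> real" where "e l \<omega> = (\<lambda>k\<in>{..<p}. \<epsilon> (int l + 1) k \<omega>)"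

abbreviation past :: "nat \<Rightarrow> (int \<times> nat) set" where "past l \<equiv> {..int l} \<times> UNIV"
abbreviation present :: "nat \<Rightarrow> (int \<times> nat) set" where "present l \<equiv> {int l + 1} \<times> {..<p}"

lemma causal_measurable: "i \<le> l \<Longrightarrow> causal i \<in> (\<Pi>\<^sub>M _\<in>past l. borel) \<rightarrow>\<^sub>M vspace p"
proof (induction i)
  case 0
  have [measurable]: "(\<lambda>u. u (- int t, k)) \<in> borel_measurable (\<Pi>\<^sub>M _\<in>past l. borel)" for t k
    by (rule measurable_component_singleton) auto
  have "(\<lambda>u. \<lambda>j\<in>{..<p}. lim (\<lambda>N. \<Sum>t<N. \<Sum>k<p. c t j k * u (- int t, k))) \<in> (\<Pi>\<^sub>M _\<in>past l. borel) \<rightarrow>\<^sub>M vspace p"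
    by (rule measurable_restrict) (intro borel_measurable_lim_metric borel_measurable_sum; measurable)
  moreover have "causal 0 = (\<lambda>u. \<lambda>j\<in>{..<p}. lim (\<lambda>N. \<Sum>t<N. \<Sum>k<p. c t j k * u (- int t, k)))"
    by (rule ext) (rule causal.simps(1))
  ultimately show ?case by (simp only:)
next
  case (Suc i)
  have "(\<lambda>u. var_step p a (causal i u) (\<lambda>k\<in>{..<p}. u (int i + 1, k))) \<in> (\<Pi>\<^sub>M _\<in>past l. borel) \<rightarrow>\<^sub>M vspace p"
  proof (rule measurable_var_step)
    show "causal i \<in> (\<Pi>\<^sub>M _\<in>past l. borel) \<rightarrow>\<^sub>M vspace p" using Suc by simp
    show "(\<lambda>u. \<lambda>k\<in>{..<p}. u (int i + 1, k)) \<in> (\<Pi>\<^sub>M _\<in>past l. borel) \<rightarrow>\<^sub>M vspace p"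
      using Suc by (intro measurable_restrict measurable_component_singleton) auto
  qed
  moreover have "causal (Suc i) = (\<lambda>u. var_step p a (causal i u) (\<lambda>k\<in>{..<p}. u (int i + 1, k)))"
    by (rule ext) (rule causal.simps(2))
  ultimately show ?case by (simp only:)
qed

text \<open>The states up to l read the noise up to time l only, so independence of disjoint blocks
  of noise applies to them.\<close>

lemma causal_restrict: "i \<le> l \<Longrightarrow> causal i (restrict u (past l)) = causal i u"
proof (induction i)
  case (Suc i)
  have "(\<lambda>k\<in>{..<p}. restrict u (past l) (int i + 1, k)) = (\<lambda>k\<in>{..<p}. u (int i + 1, k))"
    using Suc by auto
  then show ?case using Suc by simp
qed simp

lemma noise_restrict_measurable: "(\<lambda>\<omega>. restrict (noise \<omega>) B) \<in> M \<rightarrow>\<^sub>M (\<Pi>\<^sub>M _\<in>B. borel)"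
  unfolding noise_def by (rule measurable_restrict) simp

lemma noise_product_law:
  "distr M (\<Pi>\<^sub>M _\<in>past l. borel) (\<lambda>\<omega>. restrict (noise \<omega>) (past l)) \<Otimes>\<^sub>M
     distr M (\<Pi>\<^sub>M _\<in>present l. borel) (\<lambda>\<omega>. restrict (noise \<omega>) (present l))
   = distr M ((\<Pi>\<^sub>M _\<in>past l. borel) \<Otimes>\<^sub>M (\<Pi>\<^sub>M _\<in>present l. borel)) (\<lambda>\<omega>. (restrict (noise \<omega>) (past l), restrict (noise \<omega>) (present l)))"
  and noise_indep_var: "indep_var (\<Pi>\<^sub>M _\<in>past l. borel) (\<lambda>\<omega>. restrict (noise \<omega>) (past l))
     (\<Pi>\<^sub>M _\<in>present l. borel) (\<lambda>\<omega>. restrict (noise \<omega>) (present l))"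
proof -
  have "indep_vars (\<lambda>_. borel) (\<lambda>z. \<epsilon> (fst z) (snd z)) UNIV"
    using \<epsilon>_indep by (simp add: case_prod_beta')
  moreover have "past l \<inter> present l = {}" by auto
  ultimately have "indep_var (\<Pi>\<^sub>M _\<in>past l. borel) (\<lambda>\<omega>. restrict (\<lambda>z. \<epsilon> (fst z) (snd z) \<omega>) (past l))
     (\<Pi>\<^sub>M _\<in>present l. borel) (\<lambda>\<omega>. restrict (\<lambda>z. \<epsilon> (fst z) (snd z) \<omega>) (present l))"
    by (rule indep_var_restrict) auto
  then
  show "indep_var (\<Pi>\<^sub>M _\<in>past l. borel) (\<lambda>\<omega>. restrict (noise \<omega>) (past l))
     (\<Pi>\<^sub>M _\<in>present l. borel) (\<lambda>\<omega>. restrict (noise \<omega>) (present l))"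
    unfolding noise_def .
  then show "distr M (\<Pi>\<^sub>M _\<in>past l. borel) (\<lambda>\<omega>. restrict (noise \<omega>) (past l)) \<Otimes>\<^sub>M
     distr M (\<Pi>\<^sub>M _\<in>present l. borel) (\<lambda>\<omega>. restrict (noise \<omega>) (present l))
   = distr M ((\<Pi>\<^sub>M _\<in>past l. borel) \<Otimes>\<^sub>M (\<Pi>\<^sub>M _\<in>present l. borel)) (\<lambda>\<omega>. (restrict (noise \<omega>) (past l), restrict (noise \<omega>) (present l)))"
    unfolding indep_var_distribution_eq by auto
qed

lemma x_measurable [measurable]: "x l \<in> M \<rightarrow>\<^sub>M vspace p"
proof -
  have "(\<lambda>\<omega>. causal l (restrict (noise \<omega>) (past l))) \<in> M \<rightarrow>\<^sub>M vspace p"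
    by (rule measurable_compose[OF noise_restrict_measurable causal_measurable]) simp
  then show ?thesis unfolding x_def causal_restrict[OF order_refl] .
qed

lemma e_measurable [measurable]: "e l \<in> M \<rightarrow>\<^sub>M vspace p"
  unfolding e_def by (rule measurable_restrict) simp

definition present_proj :: "nat \<Rightarrow> (int \<times> nat \<Rightarrow> real) \<Rightarrow> nat \<Rightarrow> real" where
  "present_proj l u = (\<lambda>k\<in>{..<p}. u (int l + 1, k))"

lemma present_proj_measurable: "present_proj l \<in> (\<Pi>\<^sub>M _\<in>present l. borel) \<rightarrow>\<^sub>M vspace p"
  unfolding present_proj_def by (intro measurable_restrict measurable_component_singleton) auto

lemma e_eq: "e l \<omega> = present_proj l (restrict (noise \<omega>) (present l))"
  unfolding e_def present_proj_def noise_def by auto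

lemma x_eq: "i \<le> l \<Longrightarrow> x i \<omega> = causal i (restrict (noise \<omega>) (past l))"
  unfolding x_def by (simp add: causal_restrict)

lemma x_Suc: "x (Suc l) \<omega> = var_step p a (x l \<omega>) (e l \<omega>)"
  unfolding x_def e_def noise_def by simp

lemma history_product_law:
  "distr M (\<Pi>\<^sub>M _\<in>{..l}. vspace p) (\<lambda>\<omega>. \<lambda>i\<in>{..l}. x i \<omega>) \<Otimes>\<^sub>M distr M (vspace p) (e l)
      = distr M ((\<Pi>\<^sub>M _\<in>{..l}. vspace p) \<Otimes>\<^sub>M vspace p) (\<lambda>\<omega>. (\<lambda>i\<in>{..l}. x i \<omega>, e l \<omega>))"
proof -
  have hist: "(\<lambda>i\<in>{..l}. x i \<omega>) = (\<lambda>u. \<lambda>i\<in>{..l}. causal i u) (restrict (noise \<omega>) (past l))" for \<omega>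
    using x_eq by auto
  have m: "(\<lambda>u. \<lambda>i\<in>{..l}. causal i u) \<in> (\<Pi>\<^sub>M _\<in>past l. borel) \<rightarrow>\<^sub>M (\<Pi>\<^sub>M _\<in>{..l}. vspace p)"
    by (rule measurable_restrict) (simp add: causal_measurable)
  show ?thesis unfolding hist e_eq
    by (rule product_law_compose[OF noise_restrict_measurable noise_restrict_measurable m present_proj_measurable noise_product_law])
qed

lemma e_distr: "distr M (vspace p) (e l) = (\<Pi>\<^sub>M _\<in>{..<p}. distr M borel (\<epsilon> 0 0))"
proof -
  let ?i = "int l + 1"
  have "indep_vars (\<lambda>_. borel) (\<lambda>z. \<epsilon> (fst z) (snd z)) UNIV"
    using \<epsilon>_indep by (simp add: case_prod_beta')
  then have "indep_vars (\<lambda>k. \<Pi>\<^sub>M _\<in>{(?i, k)}. borel) (\<lambda>k \<omega>. \<lambda>z\<in>{(?i, k)}. \<epsilon> (fst z) (snd z) \<omega>) {..<p}"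
    by (rule indep_vars_restrict) (auto simp: disjoint_family_on_def)
  then have "indep_vars (\<lambda>_. borel) (\<lambda>k \<omega>. (\<lambda>u. u (?i, k)) (\<lambda>z\<in>{(?i, k)}. \<epsilon> (fst z) (snd z) \<omega>)) {..<p}"
    by (rule indep_vars_compose2) (intro measurable_component_singleton, simp)
  then have ind: "indep_vars (\<lambda>_. borel) (\<lambda>k. \<epsilon> ?i k) {..<p}" by simp
  have ne: "{..<p} \<noteq> {}" using p_pos by auto
  have "distr M (vspace p) (\<lambda>\<omega>. \<lambda>k\<in>{..<p}. \<epsilon> ?i k \<omega>) = (\<Pi>\<^sub>M k\<in>{..<p}. distr M borel (\<epsilon> ?i k))"
    using ind indep_vars_iff_distr_eq_PiM'[OF ne, where X="\<lambda>k. \<epsilon> ?i k" and M'="\<lambda>_. borel"] by simp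
  also have "\<dots> = (\<Pi>\<^sub>M _\<in>{..<p}. distr M borel (\<epsilon> 0 0))" by (intro PiM_cong refl \<epsilon>_distr)
  finally show ?thesis unfolding e_def .
qed

text \<open>At time 0 the remainders vanish in the limit, so the moving averages converge to X_0;
  the common recursion transports the equality to later times, outside one null set.\<close>

lemma x_eq_X: "AE \<omega> in M. \<forall>l. \<forall>j<p. x l \<omega> j = X (int l) \<omega> $ j"
proof -
  have 0: "AE \<omega> in M. \<forall>j\<in>{..<p}. x 0 \<omega> j = X 0 \<omega> $ j"
  proof (rule AE_finite_allI)
    fix j assume "j \<in> {..<p}"
    then have j: "j < p" by simp
    show "AE \<omega> in M. x 0 \<omega> j = X 0 \<omega> $ j"
      using ma_expansion[OF j, of 0 0] rem_tendsto_0[OF j, of 0]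
    proof eventually_elim
      fix \<omega> assume 1: "\<forall>N. (\<Sum>k<p. c 0 j k * X 0 \<omega> $ k) = ma 0 0 j N \<omega> + rem 0 0 j N \<omega>"
        and 2: "(\<lambda>N. rem 0 0 j N \<omega>) \<longlonglongrightarrow> 0"
      have "(\<Sum>k<p. c 0 j k * X 0 \<omega> $ k) = X 0 \<omega> $ j"
        using j by (simp add: c_zero if_distrib[of "\<lambda>z. z * _"] cong: if_cong)
      then have "ma 0 0 j N \<omega> = X 0 \<omega> $ j - rem 0 0 j N \<omega>" for N using 1 by (metis add_diff_cancel_right')
      moreover have "(\<lambda>N. X 0 \<omega> $ j - rem 0 0 j N \<omega>) \<longlonglongrightarrow> X 0 \<omega> $ j - 0" by (intro tendsto_intros 2)
      ultimately have "(\<lambda>N. ma 0 0 j N \<omega>) \<longlonglongrightarrow> X 0 \<omega> $ j" by simp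
      then have "lim (\<lambda>N. ma 0 0 j N \<omega>) = X 0 \<omega> $ j" by (rule limI)
      then show "x 0 \<omega> j = X 0 \<omega> $ j" using j by (simp add: x_def ma_def noise_def)
    qed
  qed simp
  have rec: "AE \<omega> in M. \<forall>i. \<forall>j<p. X i \<omega> $ j = (\<Sum>k<p. a j k * X (i - 1) \<omega> $ k) + \<epsilon> i j \<omega>"
    by (subst AE_all_countable) (use X_recursion in blast)
  from 0 rec show ?thesis
  proof eventually_elim
    case (elim \<omega>)
    have "\<forall>j<p. x l \<omega> j = X (int l) \<omega> $ j" for l
    proof (induction l)
      case 0 then show ?case using elim(1) by simp
    next
      case (Suc l)
      show ?case
      proof (intro allI impI)
        fix j assume j: "j < p"
        have "X (int (Suc l)) \<omega> $ j = (\<Sum>k<p. a j k * X (int l) \<omega> $ k) + \<epsilon> (int l + 1) j \<omega>"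
          using elim(2)[rule_format, OF j, of "int (Suc l)"] by (simp add: add.commute)
        then show "x (Suc l) \<omega> j = X (int (Suc l)) \<omega> $ j"
          unfolding x_Suc var_step_def e_def using j Suc by simp
      qed
    qed
    then show ?case by blast
  qed
qed

definition G :: real where "G = rosenthal_const 2 * mom * \<gamma>\<^sup>2"
text \<open>The 4 is the 2^r of \<open>state_moment\<close> at r = 2, and 1 / (1 - \<rho>) accounts
  for the innovations of the whole past.\<close>

definition G0 :: real where "G0 = 4 * (rosenthal_const 2 * mom * (\<gamma>\<^sup>2 / (1 - \<rho>)))"

lemma e_moment:
  fixes w :: "nat \<Rightarrow> real"
  shows "integrable M (\<lambda>\<omega>. (\<Sum>k<p. w k * e l \<omega> k)\<^sup>2)"
    "expectation (\<lambda>\<omega>. (\<Sum>k<p. w k * e l \<omega> k)\<^sup>2) \<le> rosenthal_const 2 * mom * (\<Sum>k<p. (w k)\<^sup>2)"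
proof -
  have inj: "inj_on (\<lambda>k. (int l + 1, k)) {..<p}" by (auto simp: inj_on_def)
  have eq: "(\<Sum>k<p. w k * e l \<omega> k) = (\<Sum>z\<in>(\<lambda>k. (int l + 1, k)) ` {..<p}. w (snd z) * \<epsilon> (fst z) (snd z) \<omega>)" for \<omega>
    by (subst sum.reindex[OF inj]) (auto simp: e_def)
  have sq: "(\<Sum>z\<in>(\<lambda>k. (int l + 1, k)) ` {..<p}. (w (snd z))\<^sup>2) = (\<Sum>k<p. (w k)\<^sup>2)"
    by (subst sum.reindex[OF inj]) simp
  have q2: "2 \<le> q" using q by simp
  have fin: "finite ((\<lambda>k. (int l + 1, k)) ` {..<p})" by simp
  show "integrable M (\<lambda>\<omega>. (\<Sum>k<p. w k * e l \<omega> k)\<^sup>2)"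
    using noise_moment(1)[OF fin order_refl q2, of "\<lambda>z. w (snd z)"] unfolding eq by simp
  show "expectation (\<lambda>\<omega>. (\<Sum>k<p. w k * e l \<omega> k)\<^sup>2) \<le> rosenthal_const 2 * mom * (\<Sum>k<p. (w k)\<^sup>2)"
    using noise_moment(2)[OF fin order_refl q2, of "\<lambda>z. w (snd z)"] unfolding eq sq by (simp add: sum_nonneg)
qed

lemma var_chain: "var_chain M p a c (distr M (vspace p) (e 0)) x e \<rho> G G0"
proof (unfold_locales)
  show "c 0 i k = (if i = k then 1 else 0)" if "i < p" "k < p" for i k using c_zero that .
  show "c (Suc m) i l = (\<Sum>k<p. c m i k * a k l)" if "i < p" "l < p" for m i l using c_Suc that .
  show "x l \<in> M \<rightarrow>\<^sub>M vspace p" for l by (rule x_measurable)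
  show "e l \<in> M \<rightarrow>\<^sub>M vspace p" for l by (rule e_measurable)
  show "x (Suc l) \<omega> = var_step p a (x l \<omega>) (e l \<omega>)" for l \<omega> by (rule x_Suc)
  show "distr M (\<Pi>\<^sub>M _\<in>{..l}. vspace p) (\<lambda>\<omega>. \<lambda>i\<in>{..l}. x i \<omega>) \<Otimes>\<^sub>M distr M (vspace p) (e l)
      = distr M ((\<Pi>\<^sub>M _\<in>{..l}. vspace p) \<Otimes>\<^sub>M vspace p) (\<lambda>\<omega>. (\<lambda>i\<in>{..l}. x i \<omega>, e l \<omega>))" for l
    by (rule history_product_law)
  show "distr M (vspace p) (e l) = distr M (vspace p) (e 0)" for l by (simp add: e_distr)
  show "0 < \<rho>" "\<rho> < 1" by (rule \<rho>_bounds)+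
  have Km: "0 \<le> rosenthal_const 2 * mom" using rosenthal_const_pos[of 2] mom_ge_1 by simp
  have r1: "0 < 1 - \<rho>" using \<rho>_bounds by simp
  show "0 \<le> G0" unfolding G0_def using Km r1 by simp
  fix m i assume i: "i < p"
  have meas: "(\<lambda>y. (\<Sum>l<p. c m i l * y l)\<^sup>2) \<in> borel_measurable (vspace p)"
    by (intro borel_measurable_power borel_measurable_sum borel_measurable_times measurable_component_singleton) auto
  have "expectation (\<lambda>\<omega>. (\<Sum>l<p. c m i l * e 0 \<omega> l)\<^sup>2) \<le> rosenthal_const 2 * mom * (\<gamma> * \<rho> ^ m)\<^sup>2"
    by (rule order_trans[OF e_moment(2)], intro mult_left_mono row_sq_le i Km)
  also have "\<dots> = G * \<rho> ^ (2 * m)" unfolding G_def by (simp add: power_mult_distrib power_mult[symmetric] mult.commute)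
  finally show "integrable (distr M (vspace p) (e 0)) (\<lambda>y. (\<Sum>l<p. c m i l * y l)\<^sup>2) \<and>
      (\<integral>y. (\<Sum>l<p. c m i l * y l)\<^sup>2 \<partial>distr M (vspace p) (e 0)) \<le> G * \<rho> ^ (2 * m)"
    unfolding integrable_distr_eq[OF e_measurable meas] integral_distr[OF e_measurable meas]
    using e_moment(1)[of "c m i" 0] by (rule conjI[rotated])
  have AEeq: "AE \<omega> in M. (\<Sum>k<p. c m i k * X 0 \<omega> $ k)\<^sup>2 = (\<Sum>l<p. c m i l * x 0 \<omega> l)\<^sup>2"
    using x_eq_X by eventually_elim simp
  have [measurable]: "(\<lambda>\<omega>. (\<Sum>l<p. c m i l * x 0 \<omega> l)\<^sup>2) \<in> borel_measurable M"
    by (rule measurable_compose[OF x_measurable meas])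
  have q2: "2 \<le> q" using q by simp
  note sm = state_moment[OF i order_refl q2, of m 0]
  have "integrable M (\<lambda>\<omega>. (\<Sum>l<p. c m i l * x 0 \<omega> l)\<^sup>2)"
    by (subst integrable_cong_AE[OF _ _ AEeq, symmetric]) (use sm(1) in auto)
  moreover have "expectation (\<lambda>\<omega>. (\<Sum>l<p. c m i l * x 0 \<omega> l)\<^sup>2) = expectation (\<lambda>\<omega>. (\<Sum>k<p. c m i k * X 0 \<omega> $ k)\<^sup>2)"
    by (rule integral_cong_AE[symmetric]) (use AEeq in auto)
  moreover have "expectation (\<lambda>\<omega>. (\<Sum>k<p. c m i k * X 0 \<omega> $ k)\<^sup>2) \<le> G0 * \<rho> ^ (2 * m)"
  proof -
    have nn: "0 \<le> \<gamma>\<^sup>2 * \<rho> ^ (2 * m) / (1 - \<rho>)" using r1 \<rho>_bounds(1) by (intro divide_nonneg_pos mult_nonneg_nonneg) auto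
    have two: "2 / 2 = (1 :: real)" "2 powr 2 = (4 :: real)" by simp_all
    have "2 powr 2 * (rosenthal_const 2 * mom * (\<gamma>\<^sup>2 * \<rho> ^ (2 * m) / (1 - \<rho>)) powr (2 / 2)) = G0 * \<rho> ^ (2 * m)"
      unfolding G0_def two powr_one[OF nn] by simp
    then show ?thesis using sm(2) by simp
  qed
  ultimately show "integrable M (\<lambda>\<omega>. (\<Sum>l<p. c m i l * x 0 \<omega> l)\<^sup>2) \<and>
      expectation (\<lambda>\<omega>. (\<Sum>l<p. c m i l * x 0 \<omega> l)\<^sup>2) \<le> G0 * \<rho> ^ (2 * m)" by simp
qed

end

section \<open>Second moments\<close>

context var_process
begin

lemma indep_past_present:
  assumes U: "U \<in> borel_measurable (vspace p)" and V: "V \<in> borel_measurable (vspace p)"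
  shows "indep_var borel (\<lambda>\<omega>. U (x l \<omega>)) borel (\<lambda>\<omega>. V (e l \<omega>) :: real)"
proof -
  have "indep_var borel ((\<lambda>u. U (causal l u)) \<circ> (\<lambda>\<omega>. restrict (noise \<omega>) (past l)))
     borel ((\<lambda>u. V (present_proj l u)) \<circ> (\<lambda>\<omega>. restrict (noise \<omega>) (present l)))"
    by (rule indep_var_compose[OF noise_indep_var measurable_compose[OF causal_measurable[OF order_refl] U]
        measurable_compose[OF present_proj_measurable V]])
  then show ?thesis by (simp add: comp_def causal_restrict x_def e_eq)
qed

lemma linear_measurable: "(\<lambda>y. \<Sum>k<p. w k * y k) \<in> borel_measurable (vspace p)"
  by (intro borel_measurable_sum borel_measurable_times measurable_component_singleton) auto

text \<open>Three coordinates, two at one time and one at the next, cover lags 0 and 1 with a single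
  argument.\<close>

lemma stationary_pair:
  fixes \<phi> :: "real \<times> real \<times> real \<Rightarrow> real"
  assumes \<phi> [measurable]: "\<phi> \<in> borel_measurable borel" and j: "j < p" "k < p" "l < p"
  shows "expectation (\<lambda>\<omega>. \<phi> (X i \<omega> $ j, X i \<omega> $ k, X (i + 1) \<omega> $ l))
    = expectation (\<lambda>\<omega>. \<phi> (X 0 \<omega> $ j, X 0 \<omega> $ k, X 1 \<omega> $ l))"
proof -
  let ?P = "\<Pi>\<^sub>M _\<in>UNIV \<times> {..<p}. (borel :: real measure)"
  let ?f = "\<lambda>u :: int \<times> nat \<Rightarrow> real. \<phi> (u (0, j), u (0, k), u (1, l))"
  have [measurable]: "(\<lambda>u. u (h, m)) \<in> borel_measurable ?P" if "m < p" for h m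
    using that by (intro measurable_component_singleton) auto
  have f: "?f \<in> borel_measurable ?P"
    unfolding borel_prod[symmetric] using \<phi> j by (intro measurable_compose[OF _ \<phi>]) (simp add: borel_prod[symmetric])
  have meas: "(\<lambda>\<omega>. \<lambda>(i, j)\<in>UNIV \<times> {..<p}. X (i + h) \<omega> $ j) \<in> M \<rightarrow>\<^sub>M ?P" for h
    by (rule measurable_restrict) auto
  have law: "integral\<^sup>L (process_law M p (\<lambda>i. X (i + h))) ?f = expectation (\<lambda>\<omega>. \<phi> (X h \<omega> $ j, X h \<omega> $ k, X (h + 1) \<omega> $ l))" for h
    unfolding process_law_def using j by (subst integral_distr[OF meas f]) (simp add: add.commute)
  have "process_law M p (\<lambda>h. X (h + i)) = process_law M p X"
    using VAR unfolding stationary_VAR1_def by blast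
  then have "integral\<^sup>L (process_law M p (\<lambda>h. X (h + i))) ?f = integral\<^sup>L (process_law M p (\<lambda>h. X (h + 0))) ?f" by simp
  then show ?thesis unfolding law by simp
qed

definition cov :: "nat \<Rightarrow> nat \<Rightarrow> real" where "cov j k = expectation (\<lambda>\<omega>. X 0 \<omega> $ j * X 0 \<omega> $ k)"

lemma X_sq_integrable: "j < p \<Longrightarrow> integrable M (\<lambda>\<omega>. (X i \<omega> $ j)\<^sup>2)"
  using X_powr_moment(1)[of j 2 i] q by simp

lemma integrable_mult_of_squares:
  fixes Y Z :: "'a \<Rightarrow> real"
  assumes "integrable M (\<lambda>\<omega>. (Y \<omega>)\<^sup>2)" "integrable M (\<lambda>\<omega>. (Z \<omega>)\<^sup>2)"
    and [measurable]: "Y \<in> borel_measurable M" "Z \<in> borel_measurable M"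
  shows "integrable M (\<lambda>\<omega>. Y \<omega> * Z \<omega>)"
proof (rule Bochner_Integration.integrable_bound)
  show "integrable M (\<lambda>\<omega>. (Y \<omega>)\<^sup>2 + (Z \<omega>)\<^sup>2)" using assms by simp
  have "\<bar>y * z\<bar> \<le> y\<^sup>2 + z\<^sup>2" for y z :: real
  proof -
    have "0 \<le> \<bar>y\<bar> * \<bar>z\<bar>" by simp
    then show ?thesis using sum_squares_bound[of "\<bar>y\<bar>" "\<bar>z\<bar>"] unfolding abs_mult power2_abs by linarith
  qed
  then show "AE \<omega> in M. norm (Y \<omega> * Z \<omega>) \<le> norm ((Y \<omega>)\<^sup>2 + (Z \<omega>)\<^sup>2)"
    by (intro AE_I2) (simp add: order_trans[OF _ abs_ge_self])
qed simp

lemma X_mult_integrable: "j < p \<Longrightarrow> k < p \<Longrightarrow> integrable M (\<lambda>\<omega>. X i \<omega> $ j * X h \<omega> $ k)"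
  by (intro integrable_mult_of_squares X_sq_integrable) auto

lemma cov_shift: "j < p \<Longrightarrow> k < p \<Longrightarrow> expectation (\<lambda>\<omega>. X i \<omega> $ j * X i \<omega> $ k) = cov j k"
proof -
  have "(\<lambda>t :: real \<times> real \<times> real. fst t * fst (snd t)) \<in> borel_measurable borel"
    by (intro borel_measurable_continuous_onI continuous_intros)
  from stationary_pair[OF this, of j k k i]
  show "j < p \<Longrightarrow> k < p \<Longrightarrow> expectation (\<lambda>\<omega>. X i \<omega> $ j * X i \<omega> $ k) = cov j k"
    unfolding cov_def by simp
qed

lemma noise_linear_eq: "(\<Sum>k<p. w k * e l \<omega> k) = (\<Sum>k<p. w k * \<epsilon> (int l + 1) k \<omega>)"
  by (intro sum.cong) (auto simp: e_def)

lemma expectation_noise_linear: "expectation (\<lambda>\<omega>. \<Sum>k<p. w k * e l \<omega> k) = 0"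
proof -
  have "expectation (\<lambda>\<omega>. \<Sum>k<p. w k * e l \<omega> k) = (\<Sum>k<p. w k * expectation (\<epsilon> (int l + 1) k))"
    unfolding noise_linear_eq using \<epsilon>_integrable by (simp add: Bochner_Integration.integral_sum)
  then show ?thesis using mean by simp
qed

lemma noise_linear_integrable: "integrable M (\<lambda>\<omega>. \<Sum>k<p. w k * e l \<omega> k)"
  unfolding noise_linear_eq using \<epsilon>_integrable by (intro Bochner_Integration.integrable_sum) simp

lemma expectation_past_present:
  assumes U: "U \<in> borel_measurable (vspace p)" and i: "integrable M (\<lambda>\<omega>. U (x l \<omega>))"
  shows "integrable M (\<lambda>\<omega>. U (x l \<omega>) * (\<Sum>k<p. w k * e l \<omega> k))"
    "expectation (\<lambda>\<omega>. U (x l \<omega>) * (\<Sum>k<p. w k * e l \<omega> k)) = 0"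
  using indep_var_integrable[OF indep_past_present[OF U linear_measurable] i noise_linear_integrable]
    indep_var_lebesgue_integral[OF indep_past_present[OF U linear_measurable] i noise_linear_integrable]
    expectation_noise_linear by auto

lemma noise_quadratic: "expectation (\<lambda>\<omega>. (\<Sum>k<p. w k * e l \<omega> k)\<^sup>2) = (\<Sum>k<p. (w k)\<^sup>2)"
proof -
  let ?i = "int l + 1"
  have ind: "indep_vars (\<lambda>_. borel) (\<lambda>z. \<epsilon> (fst z) (snd z)) UNIV"
    using \<epsilon>_indep by (simp add: case_prod_beta')
  have cross: "expectation (\<lambda>\<omega>. \<epsilon> ?i j \<omega> * \<epsilon> ?i k \<omega>) = (if j = k then 1 else 0)" for j k
  proof (cases "j = k")
    case True then show ?thesis using var[of ?i k] by (simp add: power2_eq_square)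
  next
    case False
    let ?r = "\<lambda>z \<omega>. restrict (\<lambda>z. \<epsilon> (fst z) (snd z) \<omega>) {z}"
    have "indep_var (\<Pi>\<^sub>M _\<in>{(?i, j)}. borel) (?r (?i, j)) (\<Pi>\<^sub>M _\<in>{(?i, k)}. borel) (?r (?i, k))"
      using False by (intro indep_var_restrict[OF ind]) auto
    from indep_var_compose[OF this measurable_component_singleton[of "(?i, j)"] measurable_component_singleton[of "(?i, k)"]]
    have "indep_var borel (\<epsilon> ?i j) borel (\<epsilon> ?i k)" by (simp add: comp_def)
    from indep_var_lebesgue_integral[OF this \<epsilon>_integrable \<epsilon>_integrable] False show ?thesis by (simp add: mean)
  qed
  have eq: "(\<Sum>k<p. w k * e l \<omega> k)\<^sup>2 = (\<Sum>j<p. \<Sum>k<p. w j * w k * (\<epsilon> ?i j \<omega> * \<epsilon> ?i k \<omega>))" for \<omega>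
    unfolding power2_eq_square sum_product by (intro sum.cong refl) (auto simp: e_def)
  have int: "integrable M (\<lambda>\<omega>. \<epsilon> ?i j \<omega> * \<epsilon> ?i k \<omega>)" for j k
    by (intro integrable_mult_of_squares \<epsilon>_sq_integrable) auto
  then have int: "integrable M (\<lambda>\<omega>. w j * w k * (\<epsilon> ?i j \<omega> * \<epsilon> ?i k \<omega>))" for j k by (rule integrable_mult_right)
  have "expectation (\<lambda>\<omega>. (\<Sum>k<p. w k * e l \<omega> k)\<^sup>2) = (\<Sum>j<p. expectation (\<lambda>\<omega>. \<Sum>k<p. w j * w k * (\<epsilon> ?i j \<omega> * \<epsilon> ?i k \<omega>)))"
    unfolding eq by (intro Bochner_Integration.integral_sum Bochner_Integration.integrable_sum int)
  also have "\<dots> = (\<Sum>j<p. \<Sum>k<p. expectation (\<lambda>\<omega>. w j * w k * (\<epsilon> ?i j \<omega> * \<epsilon> ?i k \<omega>)))"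
    by (intro sum.cong refl Bochner_Integration.integral_sum int)
  also have "\<dots> = (\<Sum>j<p. \<Sum>k<p. w j * w k * (if j = k then 1 else 0))"
    using cross by (intro sum.cong refl) simp
  finally show ?thesis by (simp add: power2_eq_square if_distrib[of "\<lambda>z. _ * z"] cong: if_cong)
qed

lemma x_linear_AE: "AE \<omega> in M. (\<Sum>k<p. w k * x l \<omega> k) = (\<Sum>k<p. w k * X (int l) \<omega> $ k)"
  using x_eq_X by eventually_elim simp

lemma x_component_measurable: "k < p \<Longrightarrow> (\<lambda>\<omega>. x l \<omega> k) \<in> borel_measurable M"
  by (rule measurable_compose[OF x_measurable]) (rule measurable_component_singleton, simp)

lemma x_linear_measurable [measurable]: "(\<lambda>\<omega>. \<Sum>k<p. w k * x l \<omega> k) \<in> borel_measurable M"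
  by (rule measurable_compose[OF x_measurable linear_measurable])

lemma quadratic_eq:
  "expectation (\<lambda>\<omega>. (\<Sum>k<p. w k * X i \<omega> $ k)\<^sup>2) = (\<Sum>j<p. \<Sum>k<p. w j * w k * cov j k)"
  "integrable M (\<lambda>\<omega>. (\<Sum>k<p. w k * X i \<omega> $ k)\<^sup>2)"
proof -
  have eq: "(\<Sum>k<p. w k * X i \<omega> $ k)\<^sup>2 = (\<Sum>j<p. \<Sum>k<p. w j * w k * (X i \<omega> $ j * X i \<omega> $ k))" for \<omega>
    unfolding power2_eq_square sum_product by (intro sum.cong refl) auto
  have int: "integrable M (\<lambda>\<omega>. w j * w k * (X i \<omega> $ j * X i \<omega> $ k))" if "j \<in> {..<p}" "k \<in> {..<p}" for j k
    using X_mult_integrable that by simp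
  show "integrable M (\<lambda>\<omega>. (\<Sum>k<p. w k * X i \<omega> $ k)\<^sup>2)"
    unfolding eq by (intro Bochner_Integration.integrable_sum int)
  have "expectation (\<lambda>\<omega>. (\<Sum>k<p. w k * X i \<omega> $ k)\<^sup>2) = (\<Sum>j<p. expectation (\<lambda>\<omega>. \<Sum>k<p. w j * w k * (X i \<omega> $ j * X i \<omega> $ k)))"
    unfolding eq by (intro Bochner_Integration.integral_sum Bochner_Integration.integrable_sum int)
  also have "\<dots> = (\<Sum>j<p. \<Sum>k<p. expectation (\<lambda>\<omega>. w j * w k * (X i \<omega> $ j * X i \<omega> $ k)))"
    by (intro sum.cong refl Bochner_Integration.integral_sum int) auto
  also have "\<dots> = (\<Sum>j<p. \<Sum>k<p. w j * w k * cov j k)"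
    by (intro sum.cong refl) (simp add: cov_shift)
  finally show "expectation (\<lambda>\<omega>. (\<Sum>k<p. w k * X i \<omega> $ k)\<^sup>2) = (\<Sum>j<p. \<Sum>k<p. w j * w k * cov j k)" .
qed

text \<open>By stationarity the quadratic form may be evaluated at time 1, where w . X_1 is a
  function of the past plus w . \<epsilon>_1; the cross term vanishes and the innovation alone
  contributes |w|^2.\<close>

lemma cov_ge: "(\<Sum>k<p. (w k)\<^sup>2) \<le> (\<Sum>j<p. \<Sum>k<p. w j * w k * cov j k)"
proof -
  let ?v = "\<lambda>\<omega>. \<Sum>k<p. w k * e 0 \<omega> k"
  let ?U = "\<lambda>y. \<Sum>k<p. (\<Sum>j<p. w j * a j k) * y k"
  have step: "(\<Sum>k<p. w k * x 1 \<omega> k) = ?U (x 0 \<omega>) + ?v \<omega>" for \<omega>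
  proof -
    have "(\<Sum>k<p. w k * x 1 \<omega> k) = (\<Sum>j<p. \<Sum>k<p. w j * (a j k * x 0 \<omega> k)) + ?v \<omega>"
      using x_Suc[of 0 \<omega>] by (simp add: var_step_def distrib_left sum.distrib sum_distrib_left)
    also have "(\<Sum>j<p. \<Sum>k<p. w j * (a j k * x 0 \<omega> k)) = ?U (x 0 \<omega>)"
      by (subst sum.swap) (simp add: sum_distrib_right mult.assoc)
    finally show ?thesis .
  qed
  have U2: "integrable M (\<lambda>\<omega>. (?U (x 0 \<omega>))\<^sup>2)"
  proof -
    have AE: "AE \<omega> in M. (?U (x 0 \<omega>))\<^sup>2 = (\<Sum>k<p. (\<Sum>j<p. w j * a j k) * X 0 \<omega> $ k)\<^sup>2"
      using x_linear_AE[of "\<lambda>k. \<Sum>j<p. w j * a j k" 0] by eventually_elim simp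
    show ?thesis using quadratic_eq(2)[of "\<lambda>k. \<Sum>j<p. w j * a j k" 0] by (subst integrable_cong_AE[OF _ _ AE]) auto
  qed
  have U1: "integrable M (\<lambda>\<omega>. ?U (x 0 \<omega>))"
    using integrable_mult_of_squares[OF U2, of "\<lambda>_. 1"] by simp
  note cross = expectation_past_present[OF linear_measurable U1, of w]
  have v2: "integrable M (\<lambda>\<omega>. (?v \<omega>)\<^sup>2)" by (rule e_moment(1))
  have "(\<Sum>k<p. (w k)\<^sup>2) = expectation (\<lambda>\<omega>. (?v \<omega>)\<^sup>2)" by (simp add: noise_quadratic)
  also have "\<dots> \<le> expectation (\<lambda>\<omega>. (?U (x 0 \<omega>))\<^sup>2 + 2 * (?U (x 0 \<omega>) * ?v \<omega>) + (?v \<omega>)\<^sup>2)"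
    using U2 cross v2 by (simp add: integral_nonneg)
  also have "\<dots> = expectation (\<lambda>\<omega>. (\<Sum>k<p. w k * x 1 \<omega> k)\<^sup>2)" unfolding step power2_sum by (simp add: algebra_simps)
  also have "\<dots> = expectation (\<lambda>\<omega>. (\<Sum>k<p. w k * X 1 \<omega> $ k)\<^sup>2)"
    using x_linear_AE[of w 1] by (intro integral_cong_AE) auto
  finally show ?thesis unfolding quadratic_eq .
qed

text \<open>The Yule-Walker equation: multiply the recursion by coordinate j of X_0 and take
  expectations.\<close>

lemma lag_cov:
  assumes j: "j < p" and k: "k < p"
  shows "expectation (\<lambda>\<omega>. X 0 \<omega> $ j * X 1 \<omega> $ k) = (\<Sum>l<p. a k l * cov j l)"
proof -
  have U: "(\<lambda>y. y j) \<in> borel_measurable (vspace p)" using j by (intro measurable_component_singleton) auto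
  have AE0: "AE \<omega> in M. x 0 \<omega> j = X 0 \<omega> $ j" using x_eq_X by eventually_elim (use j in \<open>metis of_nat_0\<close>)
  have Xi: "integrable M (\<lambda>\<omega>. X 0 \<omega> $ j)"
    using integrable_mult_of_squares[OF X_sq_integrable[OF j, of 0], of "\<lambda>_. 1"] j by simp
  have U1: "integrable M (\<lambda>\<omega>. x 0 \<omega> j)"
    using Xi by (subst integrable_cong_AE[OF _ _ AE0]) (use j x_component_measurable in auto)
  let ?w = "\<lambda>l. if l = k then 1 else 0 :: real"
  have ek: "(\<Sum>l<p. ?w l * e 0 \<omega> l) = \<epsilon> 1 k \<omega>" for \<omega>
    using k by (simp add: if_distrib[of "\<lambda>z. z * _"] e_def cong: if_cong)
  have c: "integrable M (\<lambda>\<omega>. x 0 \<omega> j * \<epsilon> 1 k \<omega>)" "expectation (\<lambda>\<omega>. x 0 \<omega> j * \<epsilon> 1 k \<omega>) = 0"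
    using expectation_past_present[OF U U1, of ?w] unfolding ek by auto
  have AE: "AE \<omega> in M. X 0 \<omega> $ j * X 1 \<omega> $ k = (\<Sum>l<p. a k l * (X 0 \<omega> $ j * X 0 \<omega> $ l)) + x 0 \<omega> j * \<epsilon> 1 k \<omega>"
    using X_recursion[of 1] AE0 by eventually_elim (use k in \<open>simp add: distrib_left sum_distrib_left mult_ac\<close>)
  have [measurable]: "(\<lambda>\<omega>. x 0 \<omega> j) \<in> borel_measurable M" using x_component_measurable[OF j] .
  have "expectation (\<lambda>\<omega>. X 0 \<omega> $ j * X 1 \<omega> $ k) =
      expectation (\<lambda>\<omega>. (\<Sum>l<p. a k l * (X 0 \<omega> $ j * X 0 \<omega> $ l)) + x 0 \<omega> j * \<epsilon> 1 k \<omega>)"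
    using j k by (intro integral_cong_AE AE) auto
  also have "\<dots> = expectation (\<lambda>\<omega>. \<Sum>l<p. a k l * (X 0 \<omega> $ j * X 0 \<omega> $ l)) + expectation (\<lambda>\<omega>. x 0 \<omega> j * \<epsilon> 1 k \<omega>)"
    using c X_mult_integrable[OF j] by (intro Bochner_Integration.integral_add Bochner_Integration.integrable_sum integrable_mult_right) auto
  also have "\<dots> = (\<Sum>l<p. expectation (\<lambda>\<omega>. a k l * (X 0 \<omega> $ j * X 0 \<omega> $ l)))"
    using c X_mult_integrable[OF j] by (subst Bochner_Integration.integral_sum) auto
  also have "\<dots> = (\<Sum>l<p. a k l * cov j l)" unfolding cov_def by simp
  finally show ?thesis .
qed

text \<open>The first coordinate has second moment at least 1 by \<open>cov_ge\<close>, and the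
  moment of order q controls it.\<close>

lemma mu_ge_1: "1 \<le> \<mu>"
proof -
  let ?w = "\<lambda>k. if k = 0 then 1 else 0 :: real"
  have "1 \<le> (\<Sum>k<p. (?w k)\<^sup>2)" using member_le_sum[of 0 "{..<p}" "\<lambda>k. (?w k)\<^sup>2"] p_pos by simp
  also have "\<dots> \<le> expectation (\<lambda>\<omega>. (\<Sum>k<p. ?w k * X 0 \<omega> $ k)\<^sup>2)" unfolding quadratic_eq by (rule cov_ge)
  also have "\<dots> = expectation (\<lambda>\<omega>. (X 0 \<omega> $ 0)\<^sup>2)"
    using p_pos by (simp add: if_distrib[of "\<lambda>z. z * _"] cong: if_cong)
  finally have 1: "1 \<le> expectation (\<lambda>\<omega>. (X 0 \<omega> $ 0)\<^sup>2)" .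
  have int: "integrable M (\<lambda>\<omega>. \<bar>X 0 \<omega> $ 0\<bar> powr q)" using X_powr_integrable p_pos by blast
  have le: "expectation (\<lambda>\<omega>. \<bar>X 0 \<omega> $ 0\<bar> powr q) \<le> \<mu> powr q" using X_powr_moment_le p_pos by blast
  show ?thesis
  proof (rule ccontr)
    assume "\<not> 1 \<le> \<mu>"
    then have mu: "\<mu> < 1" by simp
    \<comment> \<open>The tangent bound asks for a positive majorant, and
      \<open>\<mu> powr q\<close> might be 0 here; 1/2 is an arbitrary number below 1.\<close>
    define w where "w = max (\<mu> powr q) (1 / 2)"
    have "\<mu> powr q < 1" using mu mu_nonneg q powr_less_mono2[of q \<mu> 1] by simp
    then have w: "0 < w" "w < 1" "expectation (\<lambda>\<omega>. \<bar>X 0 \<omega> $ 0\<bar> powr q) \<le> w" using le unfolding w_def by auto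
    have "expectation (\<lambda>\<omega>. (\<bar>X 0 \<omega> $ 0\<bar> powr q) powr (2 / q)) \<le> w powr (2 / q)"
      using expectation_powr_le(2)[OF int _ w(1) w(3), of "2 / q"] q by simp
    also have "(\<lambda>\<omega>. (\<bar>X 0 \<omega> $ 0\<bar> powr q) powr (2 / q)) = (\<lambda>\<omega>. (X 0 \<omega> $ 0)\<^sup>2)" using q by (simp add: powr_powr)
    finally have "1 \<le> w powr (2 / q)" using 1 by simp
    moreover have "w powr (2 / q) < 1" using w q powr_less_mono2[of "2 / q" w 1] by simp
    ultimately show False by simp
  qed
qed

text \<open>This is \<open>state_moment\<close> with m = 0 and r = q for a coordinate attaining the
  maximum. The bound \<tau> on the geometric sum is weakened to \<tau>^2, so that its square root is
  the \<tau> of the target.\<close>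

lemma mu_le: "\<mu> \<le> 2 * ((rosenthal_const q * mom) powr (1 / q) * (\<gamma> * \<tau> / sqrt (1 - \<rho>\<^sub>0)))"
proof -
  let ?K = "rosenthal_const q * mom"
  have K: "0 < ?K" using rosenthal_const_pos mom_ge_1 by (intro mult_pos_pos) auto
  have g: "0 \<le> \<gamma>" using \<gamma>_ge(2) by simp
  have "\<mu> \<in> (\<lambda>j. Lq_norm M q (\<lambda>\<omega>. X 0 \<omega> $ j)) ` {..<p}"
  proof -
    have "Max ((\<lambda>j. Lq_norm M q (\<lambda>\<omega>. X 0 \<omega> $ j)) ` {..<p}) = \<mu>" using moment unfolding max_coord_moment_def by blast
    moreover have "Max ((\<lambda>j. Lq_norm M q (\<lambda>\<omega>. X 0 \<omega> $ j)) ` {..<p}) \<in> (\<lambda>j. Lq_norm M q (\<lambda>\<omega>. X 0 \<omega> $ j)) ` {..<p}"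
      using p_pos by (intro Max_in) auto
    ultimately show ?thesis by simp
  qed
  then obtain j where j: "j < p" and mu: "\<mu> = expectation (\<lambda>\<omega>. \<bar>X 0 \<omega> $ j\<bar> powr q) powr (1 / q)"
    unfolding Lq_norm_def by auto
  have q2: "2 \<le> q" using q by simp
  have X0: "(\<Sum>k<p. c 0 j k * X 0 \<omega> $ k) = X 0 \<omega> $ j" for \<omega>
    using j by (simp add: c_zero if_distrib[of "\<lambda>z. z * _"] cong: if_cong)
  have V: "\<gamma>\<^sup>2 / (1 - \<rho>) \<le> (\<gamma> * \<tau> / sqrt (1 - \<rho>\<^sub>0))\<^sup>2"
  proof -
    have "\<gamma>\<^sup>2 * (1 / (1 - \<rho>)) \<le> \<gamma>\<^sup>2 * (\<tau>\<^sup>2 / (1 - \<rho>\<^sub>0))"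
    proof (rule mult_left_mono)
      have "\<tau> * 1 \<le> \<tau> * \<tau>" using \<tau>_ge_1 by (intro mult_left_mono) auto
      then have "\<tau> / (1 - \<rho>\<^sub>0) \<le> \<tau>\<^sup>2 / (1 - \<rho>\<^sub>0)" using rho0 by (intro divide_right_mono) (auto simp: power2_eq_square)
      then show "1 / (1 - \<rho>) \<le> \<tau>\<^sup>2 / (1 - \<rho>\<^sub>0)" using inverse_one_minus_\<rho> by linarith
    qed simp
    then show ?thesis using rho0 by (simp add: power_divide power_mult_distrib)
  qed
  have Vn: "0 \<le> \<gamma>\<^sup>2 / (1 - \<rho>)" using \<rho>_bounds by simp
  have "expectation (\<lambda>\<omega>. \<bar>X 0 \<omega> $ j\<bar> powr q) \<le> 2 powr q * (?K * (\<gamma>\<^sup>2 / (1 - \<rho>)) powr (q / 2))"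
    using state_moment(2)[OF j q2 order_refl, of 0 0] unfolding X0 by simp
  also have "\<dots> \<le> 2 powr q * (?K * ((\<gamma> * \<tau> / sqrt (1 - \<rho>\<^sub>0))\<^sup>2) powr (q / 2))"
    using V Vn K q by (intro mult_left_mono powr_mono2) auto
  also have "((\<gamma> * \<tau> / sqrt (1 - \<rho>\<^sub>0))\<^sup>2) powr (q / 2) = (\<gamma> * \<tau> / sqrt (1 - \<rho>\<^sub>0)) powr q"
  proof -
    have "0 < \<gamma> * \<tau> / sqrt (1 - \<rho>\<^sub>0)" using \<gamma>_ge(2) \<tau>_ge_1 rho0 by (intro divide_pos_pos mult_pos_pos) auto
    then show ?thesis by (simp add: powr_powr flip: powr_numeral)
  qed
  finally have "\<mu> \<le> (2 powr q * (?K * (\<gamma> * \<tau> / sqrt (1 - \<rho>\<^sub>0)) powr q)) powr (1 / q)"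
    unfolding mu using q by (intro powr_mono2) (auto intro: integral_nonneg)
  also have "\<dots> = 2 * (?K powr (1 / q) * (\<gamma> * \<tau> / sqrt (1 - \<rho>\<^sub>0)))"
    using K q g \<tau>_ge_1 rho0 by (simp add: powr_mult powr_powr)
  finally show ?thesis .
qed

end

section \<open>Truncated empirical covariances\<close>

lemma abs_trunc_le: "0 \<le> \<nu> \<Longrightarrow> \<bar>trunc \<nu> x\<bar> \<le> \<nu>" "0 \<le> \<nu> \<Longrightarrow> \<bar>trunc \<nu> x\<bar> \<le> \<bar>x\<bar>"
  unfolding trunc_def by auto

lemma abs_trunc_diff_le: "\<bar>trunc \<nu> x - trunc \<nu> y\<bar> \<le> \<bar>x - y\<bar>"
  unfolding trunc_def by (auto simp: max_def min_def)

lemma trunc_continuous: "continuous_on S (trunc \<nu>)"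
  unfolding trunc_def by (intro continuous_intros)

lemma trunc_measurable [measurable]: "trunc \<nu> \<in> borel_measurable borel"
  by (intro borel_measurable_continuous_onI trunc_continuous)

text \<open>Where truncation acts, |x| > \<nu>, and the negative power |x|^(2-q) is at most
  \<nu>^(2-q).\<close>

lemma abs_trunc_error_le:
  assumes \<nu>: "0 < \<nu>" and q: "2 < q"
  shows "\<bar>trunc \<nu> x - x\<bar> \<le> \<nu> powr (2 - q) * \<bar>x\<bar> powr (q - 1)"
proof (cases "\<bar>x\<bar> \<le> \<nu>")
  case True
  then have "trunc \<nu> x = x" unfolding trunc_def by auto
  then show ?thesis by simp
next
  case False
  then have x: "\<nu> < \<bar>x\<bar>" by simp
  have "\<bar>trunc \<nu> x - x\<bar> \<le> \<bar>x\<bar>" using \<nu> unfolding trunc_def by (auto simp: max_def min_def)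
  also have "\<bar>x\<bar> = \<bar>x\<bar> powr (2 - q) * \<bar>x\<bar> powr (q - 1)" using x \<nu> by (simp add: powr_add[symmetric])
  also have "\<dots> \<le> \<nu> powr (2 - q) * \<bar>x\<bar> powr (q - 1)"
    using x \<nu> q by (intro mult_right_mono powr_mono2') auto
  finally show ?thesis .
qed

lemma mult_powr_le:
  assumes "0 \<le> y" "0 \<le> (z::real)" "1 \<le> q" shows "y * z powr (q - 1) \<le> y powr q + z powr q"
proof -
  have m: "max y z * max y z powr (q - 1) = max y z powr q"
    using assms by (cases "max y z = 0") (auto simp: powr_diff max_def split: if_splits)
  have "y * z powr (q - 1) \<le> max y z * max y z powr (q - 1)"
    using assms by (intro mult_mono powr_mono2) auto
  also have "\<dots> \<le> y powr q + z powr q" unfolding m by (auto simp: max_def)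
  finally show ?thesis .
qed

text \<open>Changing one factor at a time pairs a power 1 with a power q - 1, so that exactly the
  available moment of order q is used.\<close>

lemma abs_trunc_mult_error_le:
  assumes \<nu>: "0 < \<nu>" and q: "2 < q"
  shows "\<bar>trunc \<nu> y * trunc \<nu> z - y * z\<bar> \<le> \<nu> powr (2 - q) * (2 * (\<bar>y\<bar> powr q + \<bar>z\<bar> powr q))"
proof -
  have "trunc \<nu> y * trunc \<nu> z - y * z = trunc \<nu> y * (trunc \<nu> z - z) + z * (trunc \<nu> y - y)" by (simp add: algebra_simps)
  then have "\<bar>trunc \<nu> y * trunc \<nu> z - y * z\<bar> \<le> \<bar>trunc \<nu> y\<bar> * \<bar>trunc \<nu> z - z\<bar> + \<bar>z\<bar> * \<bar>trunc \<nu> y - y\<bar>"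
    by (metis abs_mult abs_triangle_ineq)
  also have "\<dots> \<le> \<bar>y\<bar> * (\<nu> powr (2 - q) * \<bar>z\<bar> powr (q - 1)) + \<bar>z\<bar> * (\<nu> powr (2 - q) * \<bar>y\<bar> powr (q - 1))"
    using \<nu> by (intro add_mono mult_mono abs_trunc_error_le q abs_trunc_le(2)) auto
  also have "\<dots> = \<nu> powr (2 - q) * (\<bar>y\<bar> * \<bar>z\<bar> powr (q - 1) + \<bar>z\<bar> * \<bar>y\<bar> powr (q - 1))" by (simp add: algebra_simps)
  also have "\<dots> \<le> \<nu> powr (2 - q) * ((\<bar>y\<bar> powr q + \<bar>z\<bar> powr q) + (\<bar>z\<bar> powr q + \<bar>y\<bar> powr q))"
    using q by (intro mult_left_mono add_mono mult_powr_le) auto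
  finally show ?thesis by (simp add: add.commute)
qed

text \<open>Here 72 = 8 * 9 comes from \<open>mgf_rate\<close>; of the two last summands the first
  stands for the n innovations and the second for the initial state.\<close>

definition variance_const :: "real \<Rightarrow> real \<Rightarrow> real" where
  "variance_const m \<rho>\<^sub>0 = 72 * (exp 1)\<^sup>2 / (1 - \<rho>\<^sub>0)\<^sup>2 * (rosenthal_const 2 * m) * (1 / \<rho>\<^sub>0\<^sup>2 + 4 / (1 - \<rho>\<^sub>0))"

definition moment_const :: "real \<Rightarrow> real \<Rightarrow> real \<Rightarrow> real" where
  "moment_const m \<rho>\<^sub>0 q = 2 * ((rosenthal_const q * m) powr (1 / q) / sqrt (1 - \<rho>\<^sub>0))"

context var_process
begin

definition later :: "bool \<Rightarrow> int" where "later h = (if h then 1 else 0)"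

definition emp :: "nat \<Rightarrow> real \<Rightarrow> bool \<Rightarrow> nat \<Rightarrow> nat \<Rightarrow> 'a \<Rightarrow> real" where
  "emp n \<nu> h j k \<omega> = (1 / real n) * (\<Sum>i\<in>{1..int n}. trunc \<nu> (X (i - 1) \<omega> $ j) * trunc \<nu> (X (i - 1 + later h) \<omega> $ k))"

definition trunc_mean :: "real \<Rightarrow> bool \<Rightarrow> nat \<Rightarrow> nat \<Rightarrow> real" where
  "trunc_mean \<nu> h j k = expectation (\<lambda>\<omega>. trunc \<nu> (X 0 \<omega> $ j) * trunc \<nu> (X (later h) \<omega> $ k))"

definition true_mean :: "bool \<Rightarrow> nat \<Rightarrow> nat \<Rightarrow> real" where
  "true_mean h j k = expectation (\<lambda>\<omega>. X 0 \<omega> $ j * X (later h) \<omega> $ k)"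

lemma trunc_mult_integrable:
  assumes "j < p" "k < p" "0 \<le> \<nu>"
  shows "integrable M (\<lambda>\<omega>. trunc \<nu> (X i \<omega> $ j) * trunc \<nu> (X i' \<omega> $ k))"
proof (rule integrable_bounded[of _ "\<nu> * \<nu>"])
  show "(\<lambda>\<omega>. trunc \<nu> (X i \<omega> $ j) * trunc \<nu> (X i' \<omega> $ k)) \<in> borel_measurable M"
    using assms by (intro borel_measurable_times measurable_compose[OF X_measurable trunc_measurable])
  show "\<bar>trunc \<nu> (X i \<omega> $ j) * trunc \<nu> (X i' \<omega> $ k)\<bar> \<le> \<nu> * \<nu>" for \<omega>
    unfolding abs_mult using assms by (intro mult_mono abs_trunc_le) auto
qed

lemma bias_le:
  assumes j: "j < p" and k: "k < p" and \<nu>: "0 < \<nu>"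
  shows "\<bar>trunc_mean \<nu> h j k - true_mean h j k\<bar> \<le> 4 * \<mu> powr q * \<nu> powr (2 - q)"
proof -
  let ?Y = "\<lambda>\<omega>. X 0 \<omega> $ j" and ?Z = "\<lambda>\<omega>. X (later h) \<omega> $ k"
  have i1: "integrable M (\<lambda>\<omega>. trunc \<nu> (?Y \<omega>) * trunc \<nu> (?Z \<omega>))" using j k \<nu> by (intro trunc_mult_integrable) auto
  have i2: "integrable M (\<lambda>\<omega>. ?Y \<omega> * ?Z \<omega>)" using j k by (rule X_mult_integrable)
  have i3: "integrable M (\<lambda>\<omega>. \<nu> powr (2 - q) * (2 * (\<bar>?Y \<omega>\<bar> powr q + \<bar>?Z \<omega>\<bar> powr q)))"
    using X_powr_integrable j k by simp
  have "\<bar>trunc_mean \<nu> h j k - true_mean h j k\<bar> = \<bar>expectation (\<lambda>\<omega>. trunc \<nu> (?Y \<omega>) * trunc \<nu> (?Z \<omega>) - ?Y \<omega> * ?Z \<omega>)\<bar>"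
    unfolding trunc_mean_def true_mean_def using i1 i2 by simp
  also have "\<dots> \<le> expectation (\<lambda>\<omega>. \<bar>trunc \<nu> (?Y \<omega>) * trunc \<nu> (?Z \<omega>) - ?Y \<omega> * ?Z \<omega>\<bar>)" by (rule integral_abs_bound)
  also have "\<dots> \<le> expectation (\<lambda>\<omega>. \<nu> powr (2 - q) * (2 * (\<bar>?Y \<omega>\<bar> powr q + \<bar>?Z \<omega>\<bar> powr q)))"
    using i1 i2 i3 \<nu> q by (intro integral_mono abs_trunc_mult_error_le) auto
  also have "\<dots> = \<nu> powr (2 - q) * (2 * (expectation (\<lambda>\<omega>. \<bar>?Y \<omega>\<bar> powr q) + expectation (\<lambda>\<omega>. \<bar>?Z \<omega>\<bar> powr q)))"
    using X_powr_integrable j k by simp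
  also have "\<dots> \<le> \<nu> powr (2 - q) * (2 * (\<mu> powr q + \<mu> powr q))"
    by (intro mult_left_mono add_mono X_powr_moment_le j k) auto
  finally show ?thesis by (simp add: mult_ac)
qed

lemma X_sq_moment_le: "j < p \<Longrightarrow> expectation (\<lambda>\<omega>. (X i \<omega> $ j)\<^sup>2) \<le> \<mu>\<^sup>2"
proof -
  assume j: "j < p"
  have mu: "0 < \<mu>" using mu_ge_1 by simp
  have "expectation (\<lambda>\<omega>. (\<bar>X i \<omega> $ j\<bar> powr q) powr (2 / q)) \<le> (\<mu> powr q) powr (2 / q)"
    using q mu by (intro expectation_powr_le(2)[OF X_powr_integrable[OF j] _ _ X_powr_moment_le[OF j]]) auto
  then show ?thesis using q mu by (simp add: powr_powr)
qed

lemma abs_true_mean_le: "j < p \<Longrightarrow> k < p \<Longrightarrow> \<bar>true_mean h j k\<bar> \<le> \<mu>\<^sup>2"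
proof -
  assume jk: "j < p" "k < p"
  let ?Y = "\<lambda>\<omega>. X 0 \<omega> $ j" and ?Z = "\<lambda>\<omega>. X (later h) \<omega> $ k"
  have "\<bar>true_mean h j k\<bar> \<le> expectation (\<lambda>\<omega>. \<bar>?Y \<omega> * ?Z \<omega>\<bar>)" unfolding true_mean_def by (rule integral_abs_bound)
  also have "\<dots> \<le> expectation (\<lambda>\<omega>. ((?Y \<omega>)\<^sup>2 + (?Z \<omega>)\<^sup>2) / 2)"
  proof (rule integral_mono)
    show "integrable M (\<lambda>\<omega>. \<bar>?Y \<omega> * ?Z \<omega>\<bar>)" using X_mult_integrable[OF jk] by simp
    show "integrable M (\<lambda>\<omega>. ((?Y \<omega>)\<^sup>2 + (?Z \<omega>)\<^sup>2) / 2)" using X_sq_integrable jk by simp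
    show "\<bar>?Y \<omega> * ?Z \<omega>\<bar> \<le> ((?Y \<omega>)\<^sup>2 + (?Z \<omega>)\<^sup>2) / 2" for \<omega>
      using sum_squares_bound[of "\<bar>?Y \<omega>\<bar>" "\<bar>?Z \<omega>\<bar>"] by (simp add: abs_mult)
  qed
  also have "\<dots> = (expectation (\<lambda>\<omega>. (?Y \<omega>)\<^sup>2) + expectation (\<lambda>\<omega>. (?Z \<omega>)\<^sup>2)) / 2" using X_sq_integrable jk by simp
  also have "\<dots> \<le> (\<mu>\<^sup>2 + \<mu>\<^sup>2) / 2" using X_sq_moment_le jk by (intro divide_right_mono add_mono) auto
  finally show ?thesis by simp
qed

lemma emp_measurable: "j < p \<Longrightarrow> k < p \<Longrightarrow> emp n \<nu> h j k \<in> borel_measurable M"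
  unfolding emp_def
  by (intro borel_measurable_times borel_measurable_sum borel_measurable_const measurable_compose[OF X_measurable trunc_measurable])

lemma sum_shift: "(\<Sum>i\<in>{1..int n}. f (i - 1)) = (\<Sum>i<n. f (int i))"
  by (rule sum.reindex_bij_witness[of _ "\<lambda>i. int i + 1" "\<lambda>i. nat (i - 1)"]) auto

lemma trunc_stationary:
  assumes j: "j < p" and k: "k < p"
  shows "expectation (\<lambda>\<omega>. trunc \<nu> (X i \<omega> $ j) * trunc \<nu> (X (i + later h) \<omega> $ k)) = trunc_mean \<nu> h j k"
proof -
  have c1: "(\<lambda>t :: real \<times> real \<times> real. trunc \<nu> (fst t) * trunc \<nu> (fst (snd t))) \<in> borel_measurable borel"
    by (intro borel_measurable_continuous_onI continuous_intros continuous_on_compose2[OF trunc_continuous[of UNIV]]) auto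
  have c2: "(\<lambda>t :: real \<times> real \<times> real. trunc \<nu> (fst t) * trunc \<nu> (snd (snd t))) \<in> borel_measurable borel"
    by (intro borel_measurable_continuous_onI continuous_intros continuous_on_compose2[OF trunc_continuous[of UNIV]]) auto
  show ?thesis
    using stationary_pair[OF c1 j k j, of i] stationary_pair[OF c2 j j k, of i]
    unfolding trunc_mean_def later_def by (cases h) simp_all
qed

text \<open>Each 1 / (1 - \<rho>) becomes \<tau> / (1 - \<rho>_0). The initial state has one such
  factor more than the innovations, and \<tau> \<le> n absorbs it into the factor n.\<close>

lemma rate_bound:
  assumes n: "\<tau> \<le> real n"
  shows "real n * (8 * (\<theta> * exp 1 / (1 - \<rho>))\<^sup>2 * (9 * \<nu>\<^sup>2 * (G / \<rho>\<^sup>2))) + 8 * (\<theta> * exp 1 / (1 - \<rho>))\<^sup>2 * (9 * \<nu>\<^sup>2 * G0)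
    \<le> variance_const mom \<rho>\<^sub>0 * (real n * (\<theta> * \<tau> * \<gamma> * \<nu>)\<^sup>2)"
proof -
  let ?K = "rosenthal_const 2 * mom"
  have K: "0 \<le> ?K" using rosenthal_const_pos[of 2] mom_ge_1 by simp
  have r: "0 < 1 - \<rho>\<^sub>0" "0 < 1 - \<rho>" using rho0 \<rho>_bounds by auto
  have inv: "(1 / (1 - \<rho>))\<^sup>2 \<le> (\<tau> / (1 - \<rho>\<^sub>0))\<^sup>2" using inverse_one_minus_\<rho> r by (intro power_mono) auto
  have G: "real n * (G / \<rho>\<^sup>2) \<le> real n * (?K * \<gamma>\<^sup>2 * (1 / \<rho>\<^sub>0\<^sup>2))"
  proof (rule mult_left_mono)
    have "1 / \<rho>\<^sup>2 \<le> 1 / \<rho>\<^sub>0\<^sup>2" using rho0 \<rho>_bounds by (intro divide_left_mono power_mono mult_pos_pos) auto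
    then have "?K * \<gamma>\<^sup>2 * (1 / \<rho>\<^sup>2) \<le> ?K * \<gamma>\<^sup>2 * (1 / \<rho>\<^sub>0\<^sup>2)" using K by (intro mult_left_mono) auto
    then show "G / \<rho>\<^sup>2 \<le> ?K * \<gamma>\<^sup>2 * (1 / \<rho>\<^sub>0\<^sup>2)" unfolding G_def by simp
  qed simp
  have G0': "G0 \<le> real n * (?K * \<gamma>\<^sup>2 * (4 / (1 - \<rho>\<^sub>0)))"
  proof -
    have "1 / (1 - \<rho>) \<le> real n / (1 - \<rho>\<^sub>0)"
      by (rule order_trans[OF inverse_one_minus_\<rho>]) (use n r in \<open>simp add: divide_right_mono\<close>)
    then have "4 * (?K * \<gamma>\<^sup>2) * (1 / (1 - \<rho>)) \<le> 4 * (?K * \<gamma>\<^sup>2) * (real n / (1 - \<rho>\<^sub>0))" using K by (intro mult_left_mono) auto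
    then show ?thesis unfolding G0_def by (simp add: mult_ac)
  qed
  have "real n * (8 * (\<theta> * exp 1 / (1 - \<rho>))\<^sup>2 * (9 * \<nu>\<^sup>2 * (G / \<rho>\<^sup>2))) + 8 * (\<theta> * exp 1 / (1 - \<rho>))\<^sup>2 * (9 * \<nu>\<^sup>2 * G0)
      = (72 * (\<theta> * exp 1)\<^sup>2 * \<nu>\<^sup>2) * ((1 / (1 - \<rho>))\<^sup>2 * (real n * (G / \<rho>\<^sup>2) + G0))"
  proof -
    have "n' * (8 * (b / d)\<^sup>2 * (9 * v * g)) + 8 * (b / d)\<^sup>2 * (9 * v * g0) = (72 * b\<^sup>2 * v) * ((1 / d)\<^sup>2 * (n' * g + g0))"
      for n' b d v g g0 :: real by (simp add: power_divide algebra_simps add_divide_distrib)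
    then show ?thesis .
  qed
  also have "\<dots> \<le> (72 * (\<theta> * exp 1)\<^sup>2 * \<nu>\<^sup>2) * ((\<tau> / (1 - \<rho>\<^sub>0))\<^sup>2 * (real n * (?K * \<gamma>\<^sup>2 * (1 / \<rho>\<^sub>0\<^sup>2)) + real n * (?K * \<gamma>\<^sup>2 * (4 / (1 - \<rho>\<^sub>0)))))"
  proof (rule mult_left_mono, rule mult_mono[OF inv add_mono[OF G G0']])
    show "0 \<le> real n * (G / \<rho>\<^sup>2) + G0"
      unfolding G_def G0_def using K r mom_ge_1 less_imp_le[OF rosenthal_const_pos[of 2]] by (intro add_nonneg_nonneg mult_nonneg_nonneg divide_nonneg_nonneg) auto
  qed auto
  also have "\<dots> = variance_const mom \<rho>\<^sub>0 * (real n * (\<theta> * \<tau> * \<gamma> * \<nu>)\<^sup>2)"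
  proof -
    have "(72 * (\<theta> * E)\<^sup>2 * \<nu>\<^sup>2) * ((\<tau> / d)\<^sup>2 * (n' * (K * \<gamma>\<^sup>2 * u) + n' * (K * \<gamma>\<^sup>2 * v))) =
       72 * E\<^sup>2 / d\<^sup>2 * K * (u + v) * (n' * (\<theta> * \<tau> * \<gamma> * \<nu>)\<^sup>2)" for E d n' K u v :: real
      by (simp add: power_divide power_mult_distrib algebra_simps add_divide_distrib)
    then show ?thesis unfolding variance_const_def .
  qed
  finally show ?thesis .
qed

text \<open>The chain bound for B = 2 \<nu>^2, which is where the 4 in the condition on \<theta>
  comes from. The sign \<sigma> produces both tails, and h selects the lag.\<close>

lemma emp_upper_tail:
  assumes j: "j < p" and k: "k < p" and \<nu>: "0 < \<nu>" and n: "1 \<le> n" "\<tau> \<le> real n"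
    and \<theta>: "0 \<le> \<theta>" "4 * exp 1 * \<theta> * \<nu>\<^sup>2 * \<tau> \<le> 1 - \<rho>\<^sub>0" and \<sigma>: "\<bar>\<sigma>\<bar> = 1"
  shows "prob {\<omega> \<in> space M. t \<le> \<sigma> * (emp n \<nu> h j k \<omega> - trunc_mean \<nu> h j k)}
    \<le> exp (variance_const mom \<rho>\<^sub>0 * (real n * (\<theta> * \<tau> * \<gamma> * \<nu>)\<^sup>2) - \<theta> * (real n * t))"
proof -
  define g where "g = (\<lambda>z y :: nat \<Rightarrow> real. \<sigma> * (trunc \<nu> (z j) * trunc \<nu> ((if h then y else z) k)))"
  have tm: "\<bar>u * v - u' * v'\<bar> \<le> \<nu> * (\<bar>u - u'\<bar> + \<bar>v - v'\<bar>)" if "\<bar>v\<bar> \<le> \<nu>" "\<bar>u'\<bar> \<le> \<nu>" for u v u' v' :: real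
  proof -
    have "u * v - u' * v' = (u - u') * v + u' * (v - v')" by (simp add: algebra_simps)
    then have "\<bar>u * v - u' * v'\<bar> \<le> \<bar>u - u'\<bar> * \<bar>v\<bar> + \<bar>u'\<bar> * \<bar>v - v'\<bar>" by (metis abs_mult abs_triangle_ineq)
    also have "\<dots> \<le> \<bar>u - u'\<bar> * \<nu> + \<nu> * \<bar>v - v'\<bar>" using that by (intro add_mono mult_left_mono mult_right_mono) auto
    finally show ?thesis by (simp add: algebra_simps)
  qed
  interpret V: var_chain M p a c "distr M (vspace p) (e 0)" x e \<rho> G G0 by (rule var_chain)
  have comp: "(\<lambda>z. f z i) \<in> borel_measurable N" if "f \<in> N \<rightarrow>\<^sub>M vspace p" "i < p" for f i and N :: "'z measure"
    by (rule measurable_compose[OF that(1)]) (use that(2) in \<open>simp add: measurable_component_singleton\<close>)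
  interpret C: var_chain_fun M p a c "distr M (vspace p) (e 0)" x e \<rho> G G0 g j k "2 * \<nu>\<^sup>2" \<nu>
  proof
    show "j < p" "k < p" by fact+
    show "0 \<le> \<nu>" using \<nu> by simp
    show "(\<lambda>(z, y). g z y) \<in> borel_measurable (vspace p \<Otimes>\<^sub>M vspace p)"
    proof -
      have "(\<lambda>w. g (fst w) (snd w)) \<in> borel_measurable (vspace p \<Otimes>\<^sub>M vspace p)"
        unfolding g_def using j k
        by (cases h) (auto intro!: borel_measurable_times measurable_compose[OF _ trunc_measurable] comp measurable_fst measurable_snd)
      then show ?thesis by (simp add: case_prod_beta')
    qed
    fix z y z' y' :: "nat \<Rightarrow> real"
    have "\<bar>trunc \<nu> u * trunc \<nu> v\<bar> \<le> \<nu>\<^sup>2" for u v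
      unfolding abs_mult power2_eq_square using \<nu> by (intro mult_mono abs_trunc_le) auto
    then show "\<bar>g z y\<bar> \<le> 2 * \<nu>\<^sup>2 / 2" unfolding g_def abs_mult[of \<sigma>] \<sigma> by simp
    let ?w = "(if h then y else z) k" and ?w' = "(if h then y' else z') k"
    have "\<bar>g z y - g z' y'\<bar> = \<bar>trunc \<nu> (z j) * trunc \<nu> ?w - trunc \<nu> (z' j) * trunc \<nu> ?w'\<bar>"
      unfolding g_def right_diff_distrib[symmetric] abs_mult[of \<sigma>] \<sigma> by simp
    also have "\<dots> \<le> \<nu> * (\<bar>trunc \<nu> (z j) - trunc \<nu> (z' j)\<bar> + \<bar>trunc \<nu> ?w - trunc \<nu> ?w'\<bar>)"
      using \<nu> by (intro tm abs_trunc_le) auto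
    also have "\<dots> \<le> \<nu> * (\<bar>z j - z' j\<bar> + \<bar>?w - ?w'\<bar>)"
      using \<nu> by (intro mult_left_mono add_mono abs_trunc_diff_le) auto
    also have "\<dots> \<le> \<nu> * (\<bar>z j - z' j\<bar> + \<bar>z k - z' k\<bar> + \<bar>y k - y' k\<bar>)"
      using \<nu> by (intro mult_left_mono) auto
    finally show "\<bar>g z y - g z' y'\<bar> \<le> \<nu> * (\<bar>z j - z' j\<bar> + \<bar>z k - z' k\<bar> + \<bar>y k - y' k\<bar>)" .
  qed
  have gX: "AE \<omega> in M. \<forall>i. g (x i \<omega>) (x (Suc i) \<omega>) = \<sigma> * (trunc \<nu> (X (int i) \<omega> $ j) * trunc \<nu> (X (int i + later h) \<omega> $ k))"
    using x_eq_X
  proof eventually_elim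
    case (elim \<omega>)
    have "x (Suc i) \<omega> k = X (int i + 1) \<omega> $ k" for i using elim[rule_format, OF k, of "Suc i"] by (simp add: add.commute)
    then show ?case using elim j k unfolding g_def later_def by simp
  qed
  have Eg: "expectation (\<lambda>\<omega>. g (x i \<omega>) (x (Suc i) \<omega>)) = \<sigma> * trunc_mean \<nu> h j k" for i
  proof -
    have "expectation (\<lambda>\<omega>. g (x i \<omega>) (x (Suc i) \<omega>)) = expectation (\<lambda>\<omega>. \<sigma> * (trunc \<nu> (X (int i) \<omega> $ j) * trunc \<nu> (X (int i + later h) \<omega> $ k)))"
    proof (rule integral_cong_AE)
      show "(\<lambda>\<omega>. \<sigma> * (trunc \<nu> (X (int i) \<omega> $ j) * trunc \<nu> (X (int i + later h) \<omega> $ k))) \<in> borel_measurable M"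
        using j k by (intro borel_measurable_times borel_measurable_const measurable_compose[OF X_measurable trunc_measurable])
      show "(\<lambda>\<omega>. g (x i \<omega>) (x (Suc i) \<omega>)) \<in> borel_measurable M" by (intro C.g_measurable x_measurable)
    qed (use gX in auto)
    then show ?thesis using trunc_stationary[OF j k] by simp
  qed
  have n0: "0 < real n" using n by simp
  have Zeq: "AE \<omega> in M. (\<omega> \<in> {\<omega> \<in> space M. t \<le> \<sigma> * (emp n \<nu> h j k \<omega> - trunc_mean \<nu> h j k)}) \<longleftrightarrow>
      (\<omega> \<in> {\<omega> \<in> space M. (\<Sum>i<n. expectation (\<lambda>\<omega>. g (x i \<omega>) (x (Suc i) \<omega>))) + real n * t \<le> C.Z n \<omega>})"
    using gX
  proof eventually_elim
    case (elim \<omega>)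
    have "C.Z n \<omega> = \<sigma> * (\<Sum>i<n. trunc \<nu> (X (int i) \<omega> $ j) * trunc \<nu> (X (int i + later h) \<omega> $ k))"
      unfolding C.Z_def using elim by (simp add: sum_distrib_left)
    also have "(\<Sum>i<n. trunc \<nu> (X (int i) \<omega> $ j) * trunc \<nu> (X (int i + later h) \<omega> $ k)) = real n * emp n \<nu> h j k \<omega>"
      unfolding emp_def using n0 sum_shift[of "\<lambda>i. trunc \<nu> (X i \<omega> $ j) * trunc \<nu> (X (i + later h) \<omega> $ k)" n] by simp
    finally have Z: "C.Z n \<omega> = real n * (\<sigma> * emp n \<nu> h j k \<omega>)" by simp
    have "(\<Sum>i<n. expectation (\<lambda>\<omega>. g (x i \<omega>) (x (Suc i) \<omega>))) + real n * t \<le> C.Z n \<omega> \<longleftrightarrow>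
      real n * t \<le> real n * (\<sigma> * (emp n \<nu> h j k \<omega> - trunc_mean \<nu> h j k))"
      unfolding Eg Z by (simp add: algebra_simps)
    also have "\<dots> \<longleftrightarrow> t \<le> \<sigma> * (emp n \<nu> h j k \<omega> - trunc_mean \<nu> h j k)" using n0 by simp
    finally show ?case by simp
  qed
  have [measurable]: "emp n \<nu> h j k \<in> borel_measurable M" using emp_measurable[OF j k] .
  have "prob {\<omega> \<in> space M. t \<le> \<sigma> * (emp n \<nu> h j k \<omega> - trunc_mean \<nu> h j k)} =
      prob {\<omega> \<in> space M. (\<Sum>i<n. expectation (\<lambda>\<omega>. g (x i \<omega>) (x (Suc i) \<omega>))) + real n * t \<le> C.Z n \<omega>}"
    by (rule finite_measure_eq_AE[OF Zeq]) measurable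
  also have "\<dots> \<le> exp (real n * C.mgf_rate \<theta> (G / \<rho>\<^sup>2) + C.mgf_rate \<theta> G0 - \<theta> * (real n * t))"
  proof (rule C.upper_tail[OF \<theta>(1)])
    have "2 * exp 1 * \<theta> * (2 * \<nu>\<^sup>2) * \<tau> \<le> 1 - \<rho>\<^sub>0" using \<theta>(2) by (simp add: mult_ac)
    then have "2 * exp 1 * \<theta> * (2 * \<nu>\<^sup>2) \<le> (1 - \<rho>\<^sub>0) / \<tau>" using \<tau>_ge_1 by (simp add: pos_le_divide_eq)
    also have "\<dots> \<le> 1 - \<rho>" unfolding \<rho>_def using rho0 \<tau>_ge_1 by (intro one_minus_root_ge) auto
    finally show "2 * exp 1 * \<theta> * (2 * \<nu>\<^sup>2) \<le> 1 - \<rho>" .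
  qed
  also have "\<dots> \<le> exp (variance_const mom \<rho>\<^sub>0 * (real n * (\<theta> * \<tau> * \<gamma> * \<nu>)\<^sup>2) - \<theta> * (real n * t))"
    unfolding C.mgf_rate_def using rate_bound[OF n(2), of \<theta> \<nu>] by simp
  finally show ?thesis .
qed

end

section \<open>The Lasso\<close>

text \<open>Let u and v be the l1 masses of the error on and off the support. Optimality gives v
  \<le> 3 u, so (u + v)^2 \<le> 16 s D with D the squared l2 error, and \<open>Q\<close> then bounds
  the empirical quadratic form below by D / 2.\<close>

lemma lasso_row_bound:
  fixes b bh :: "nat \<Rightarrow> real" and z :: "int \<Rightarrow> nat \<Rightarrow> real" and r :: "int \<Rightarrow> real" and Q :: "nat \<Rightarrow> nat \<Rightarrow> real"
  assumes fin: "finite I" and n: "0 < n"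
    and opt: "(1 / n) * (\<Sum>i\<in>I. (r i - (\<Sum>l<p. bh l * z i l))\<^sup>2) + lam * (\<Sum>l<p. \<bar>bh l\<bar>)
      \<le> (1 / n) * (\<Sum>i\<in>I. (r i - (\<Sum>l<p. b l * z i l))\<^sup>2) + lam * (\<Sum>l<p. \<bar>b l\<bar>)"
    and Q: "\<And>d. (\<Sum>l<p. (d l)\<^sup>2) \<le> (\<Sum>j<p. \<Sum>l<p. d j * d l * Q j l)"
    and emp: "\<And>j l. j < p \<Longrightarrow> l < p \<Longrightarrow> \<bar>(1 / n) * (\<Sum>i\<in>I. z i j * z i l) - Q j l\<bar> \<le> \<delta>"
    and score: "\<And>l. l < p \<Longrightarrow> \<bar>(1 / n) * (\<Sum>i\<in>I. z i l * (r i - (\<Sum>m<p. b m * z i m)))\<bar> \<le> lam / 4"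
    and lam: "0 < lam" and \<delta>: "0 \<le> \<delta>" "32 * real (card {l. l < p \<and> b l \<noteq> 0}) * \<delta> \<le> 1"
  shows "(\<Sum>l<p. \<bar>bh l - b l\<bar>) \<le> 12 * lam * real (card {l. l < p \<and> b l \<noteq> 0})"
    and "(\<Sum>l<p. (bh l - b l)\<^sup>2) \<le> 9 * lam\<^sup>2 * real (card {l. l < p \<and> b l \<noteq> 0})"
proof -
  define d where "d = (\<lambda>l. bh l - b l)"
  define S where "S = {l. l < p \<and> b l \<noteq> 0}"
  define s where "s = real (card S)"
  define u where "u = (\<Sum>l\<in>S. \<bar>d l\<bar>)"
  define v where "v = (\<Sum>l\<in>{..<p} - S. \<bar>d l\<bar>)"
  define D where "D = (\<Sum>l<p. (d l)\<^sup>2)"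
  define quad where "quad = (1 / n) * (\<Sum>i\<in>I. (\<Sum>l<p. d l * z i l)\<^sup>2)"
  define e where "e = (\<lambda>i. r i - (\<Sum>l<p. b l * z i l))"
  have Sp: "S \<subseteq> {..<p}" "finite S" by (auto simp: S_def)
  have split: "(\<Sum>l<p. f l) = (\<Sum>l\<in>S. f l) + (\<Sum>l\<in>{..<p} - S. f l)" for f :: "nat \<Rightarrow> real"
    using sum.subset_diff[OF Sp(1), of f] by simp
  have duv: "(\<Sum>l<p. \<bar>d l\<bar>) = u + v" unfolding u_def v_def by (rule split)
  have uv0: "0 \<le> u" "0 \<le> v" unfolding u_def v_def by (simp_all add: sum_nonneg)
  have l1: "(\<Sum>l<p. \<bar>b l\<bar>) - (\<Sum>l<p. \<bar>bh l\<bar>) \<le> u - v"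
  proof -
    have "(\<Sum>l\<in>S. \<bar>b l\<bar>) - (\<Sum>l\<in>S. \<bar>bh l\<bar>) \<le> u"
      unfolding u_def sum_subtractf[symmetric] by (intro sum_mono) (auto simp: d_def)
    moreover have "(\<Sum>l\<in>{..<p} - S. \<bar>bh l\<bar>) = v" unfolding v_def by (intro sum.cong) (auto simp: d_def S_def)
    moreover have "(\<Sum>l\<in>{..<p} - S. \<bar>b l\<bar>) = 0" by (auto simp: S_def intro!: sum.neutral)
    ultimately show ?thesis unfolding split[of "\<lambda>l. \<bar>b l\<bar>"] split[of "\<lambda>l. \<bar>bh l\<bar>"] by linarith
  qed
  have res: "r i - (\<Sum>l<p. bh l * z i l) = e i - (\<Sum>l<p. d l * z i l)" for i
    unfolding e_def d_def by (simp add: left_diff_distrib sum_subtractf)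
  have expand: "(1 / n) * (\<Sum>i\<in>I. (r i - (\<Sum>l<p. bh l * z i l))\<^sup>2)
      = (1 / n) * (\<Sum>i\<in>I. (e i)\<^sup>2) - 2 * ((1 / n) * (\<Sum>i\<in>I. e i * (\<Sum>l<p. d l * z i l))) + quad"
    unfolding res quad_def power2_diff sum.distrib sum_subtractf
    by (simp add: sum_distrib_left algebra_simps)
  have cross: "(1 / n) * (\<Sum>i\<in>I. e i * (\<Sum>l<p. d l * z i l)) = (\<Sum>l<p. d l * ((1 / n) * (\<Sum>i\<in>I. z i l * e i)))"
  proof -
    have "(\<Sum>i\<in>I. e i * (\<Sum>l<p. d l * z i l)) = (\<Sum>l<p. \<Sum>i\<in>I. d l * (z i l * e i))"
      by (subst sum.swap) (simp add: sum_distrib_left mult_ac)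
    then show ?thesis by (simp add: sum_distrib_left mult_ac)
  qed
  have cross_le: "(1 / n) * (\<Sum>i\<in>I. e i * (\<Sum>l<p. d l * z i l)) \<le> (u + v) * (lam / 4)"
  proof -
    have "(\<Sum>l<p. d l * ((1 / n) * (\<Sum>i\<in>I. z i l * e i))) \<le> (\<Sum>l<p. \<bar>d l\<bar> * (lam / 4))"
    proof (rule sum_mono)
      fix l assume "l \<in> {..<p}"
      then have "\<bar>(1 / n) * (\<Sum>i\<in>I. z i l * e i)\<bar> \<le> lam / 4" unfolding e_def using score by simp
      then have "\<bar>d l * ((1 / n) * (\<Sum>i\<in>I. z i l * e i))\<bar> \<le> \<bar>d l\<bar> * (lam / 4)"
        unfolding abs_mult[of "d l"] by (intro mult_left_mono) auto
      then show "d l * ((1 / n) * (\<Sum>i\<in>I. z i l * e i)) \<le> \<bar>d l\<bar> * (lam / 4)" by (rule order_trans[OF abs_ge_self])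
    qed
    then show ?thesis unfolding cross duv[symmetric] sum_distrib_right .
  qed
  \<comment> \<open>The basic inequality. The score costs lam / 2 per unit of l1 error and the
    penalty gains lam (u - v), hence the coefficients 3/2 and -1/2 and the cone v \<le> 3 u.\<close>
  have "quad \<le> 2 * ((u + v) * (lam / 4)) + lam * ((\<Sum>l<p. \<bar>b l\<bar>) - (\<Sum>l<p. \<bar>bh l\<bar>))"
  proof -
    have ee: "(\<Sum>i\<in>I. (r i - (\<Sum>l<p. b l * z i l))\<^sup>2) = (\<Sum>i\<in>I. (e i)\<^sup>2)" by (simp add: e_def)
    show ?thesis using opt cross_le unfolding expand ee right_diff_distrib[of lam] by linarith
  qed
  also have "\<dots> \<le> 2 * ((u + v) * (lam / 4)) + lam * (u - v)"
    using l1 lam by (intro add_left_mono mult_left_mono) auto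
  also have "\<dots> = 3 / 2 * lam * u - 1 / 2 * lam * v" by (simp add: algebra_simps)
  finally have quad_le: "quad \<le> 3 / 2 * lam * u - 1 / 2 * lam * v" .
  have "0 \<le> quad" unfolding quad_def using n by (simp add: sum_nonneg)
  then have "lam * v \<le> lam * (3 * u)" using quad_le by simp
  then have v3u: "v \<le> 3 * u" using lam by simp
  have u2: "u\<^sup>2 \<le> s * D"
  proof -
    have "u \<le> L2_set (\<lambda>l. 1) S * L2_set d S"
      unfolding u_def using L2_set_mult_ineq[of "\<lambda>l. 1" d S] by simp
    then have "u\<^sup>2 \<le> (L2_set (\<lambda>l. 1) S * L2_set d S)\<^sup>2" using uv0 by (intro power_mono) auto
    also have "\<dots> = s * (\<Sum>l\<in>S. (d l)\<^sup>2)" unfolding s_def by (simp add: power_mult_distrib L2_set_def sum_nonneg)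
    also have "\<dots> \<le> s * D" unfolding D_def s_def using Sp by (intro mult_left_mono sum_mono2) auto
    finally show ?thesis .
  qed
  have D0: "0 \<le> D" unfolding D_def by (simp add: sum_nonneg)
  have s0: "0 \<le> s" unfolding s_def by simp
  have quad_ge: "D - \<delta> * (u + v)\<^sup>2 \<le> quad"
  proof -
    have sq: "(\<Sum>l<p. d l * z i l)\<^sup>2 = (\<Sum>j<p. \<Sum>l<p. d j * d l * (z i j * z i l))" for i
      by (simp add: power2_eq_square sum_product mult_ac)
    have "(\<Sum>i\<in>I. (\<Sum>l<p. d l * z i l)\<^sup>2) = (\<Sum>j<p. \<Sum>l<p. d j * d l * (\<Sum>i\<in>I. z i j * z i l))"
      unfolding sq sum_distrib_left by (subst sum.swap) (intro sum.cong refl sum.swap)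
    then have q: "quad = (\<Sum>j<p. \<Sum>l<p. d j * d l * ((1 / n) * (\<Sum>i\<in>I. z i j * z i l)))"
      unfolding quad_def by (simp add: sum_distrib_left mult_ac)
    have "(\<Sum>j<p. \<Sum>l<p. d j * d l * Q j l) - quad
        = (\<Sum>j<p. \<Sum>l<p. d j * d l * (Q j l - (1 / n) * (\<Sum>i\<in>I. z i j * z i l)))"
      unfolding q by (simp add: sum_subtractf right_diff_distrib)
    also have "\<dots> \<le> (\<Sum>j<p. \<Sum>l<p. \<bar>d j\<bar> * \<bar>d l\<bar> * \<delta>)"
    proof (intro sum_mono)
      fix j l assume "j \<in> {..<p}" "l \<in> {..<p}"
      then have "\<bar>Q j l - (1 / n) * (\<Sum>i\<in>I. z i j * z i l)\<bar> \<le> \<delta>" using emp[of j l] by (simp add: abs_minus_commute)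
      then have "\<bar>d j * d l * (Q j l - (1 / n) * (\<Sum>i\<in>I. z i j * z i l))\<bar> \<le> \<bar>d j\<bar> * \<bar>d l\<bar> * \<delta>"
        unfolding abs_mult[of "d j * d l"] abs_mult[of "d j"] by (intro mult_left_mono) auto
      then show "d j * d l * (Q j l - (1 / n) * (\<Sum>i\<in>I. z i j * z i l)) \<le> \<bar>d j\<bar> * \<bar>d l\<bar> * \<delta>"
        by (rule order_trans[OF abs_ge_self])
    qed
    also have "\<dots> = \<delta> * (u + v)\<^sup>2"
    proof -
      have "(\<Sum>j<p. \<Sum>l<p. \<bar>d j\<bar> * \<bar>d l\<bar> * \<delta>) = (\<Sum>j<p. \<Sum>l<p. \<bar>d j\<bar> * \<bar>d l\<bar>) * \<delta>"
        by (simp only: sum_distrib_right)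
      also have "\<dots> = \<delta> * (u + v)\<^sup>2" unfolding duv[symmetric] power2_eq_square sum_product by (rule mult.commute)
      finally show ?thesis .
    qed
    finally show ?thesis using Q[of d] unfolding D_def by linarith
  qed
  have "(u + v)\<^sup>2 \<le> (4 * u)\<^sup>2" using v3u uv0 by (intro power_mono) auto
  also have "\<dots> \<le> 16 * (s * D)" using u2 by (simp add: power_mult_distrib)
  finally have uv2: "(u + v)\<^sup>2 \<le> 16 * (s * D)" .
  \<comment> \<open>Restricted eigenvalue condition: on the cone the deviation
    \<open>\<delta>\<close> uses up at most half of D.\<close>
  have "\<delta> * (u + v)\<^sup>2 \<le> \<delta> * (16 * (s * D))" using uv2 \<delta> by (intro mult_left_mono) auto
  also have "\<dots> = (32 * s * \<delta>) * (D / 2)" by simp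
  also have "\<dots> \<le> 1 * (D / 2)" using \<delta> D0 unfolding s_def S_def by (intro mult_right_mono) auto
  finally have "D / 2 \<le> quad" using quad_ge by (simp add: field_simps)
  also have "quad \<le> 3 / 2 * lam * u" using quad_le uv0 lam mult_nonneg_nonneg[of lam v] by linarith
  finally have D3: "D \<le> 3 * lam * u" by simp
  \<comment> \<open>From D \<le> 3 lam u and u^2 \<le> s D one factor D cancels, giving D \<le> 9
    lam^2 s. With (u + v)^2 \<le> 16 s D this becomes (12 lam s)^2.\<close>
  have "D\<^sup>2 \<le> (3 * lam * u)\<^sup>2" using D3 D0 by (intro power_mono) auto
  also have "\<dots> \<le> 9 * lam\<^sup>2 * (s * D)" using u2 by (simp add: power_mult_distrib mult_left_mono)
  finally have DD: "D * D \<le> (9 * lam\<^sup>2 * s) * D" by (simp add: power2_eq_square mult_ac)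
  have D9: "D \<le> 9 * lam\<^sup>2 * s"
  proof (cases "D = 0")
    case True then show ?thesis using s0 by simp
  next
    case False then show ?thesis using DD D0 by simp
  qed
  then show "(\<Sum>l<p. (bh l - b l)\<^sup>2) \<le> 9 * lam\<^sup>2 * real (card {l. l < p \<and> b l \<noteq> 0})"
    unfolding D_def d_def s_def S_def .
  have "(u + v)\<^sup>2 \<le> 16 * (s * (9 * lam\<^sup>2 * s))"
    using uv2 D9 s0 by (meson mult_left_mono order_trans zero_le_numeral)
  also have "\<dots> = (12 * lam * s)\<^sup>2" by (simp add: power_mult_distrib power2_eq_square)
  finally have "u + v \<le> 12 * lam * s" by (rule power2_le_imp_le) (use lam s0 in simp)
  then show "(\<Sum>l<p. \<bar>bh l - b l\<bar>) \<le> 12 * lam * real (card {l. l < p \<and> b l \<noteq> 0})"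
    unfolding duv[symmetric] d_def s_def S_def .
qed

section \<open>Separation of the Lasso problem over the rows\<close>

definition replace_row :: "real mat \<Rightarrow> real mat \<Rightarrow> nat \<Rightarrow> real mat" where
  "replace_row D A k = mat (dim_row D) (dim_col D) (\<lambda>(i, j). if i = k then A $$ (i, j) else D $$ (i, j))"

definition row_objective :: "nat \<Rightarrow> nat \<Rightarrow> real \<Rightarrow> (int \<Rightarrow> real vec) \<Rightarrow> nat \<Rightarrow> (nat \<Rightarrow> real) \<Rightarrow> real" where
  "row_objective n p lam y k b = (1 / real n) * (\<Sum>i\<in>{1..int n}. (y i $ k - (\<Sum>l<p. b l * y (i - 1) $ l))\<^sup>2) + lam * (\<Sum>l<p. \<bar>b l\<bar>)"

lemma lasso_objective_rows:
  assumes x: "\<And>i. i \<in> {0..int n} \<Longrightarrow> x i \<in> carrier_vec p" and D: "D \<in> carrier_mat p p"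
  shows "lasso_objective n \<nu> lam x D = (\<Sum>k<p. row_objective n p lam (\<lambda>i. map_vec (trunc \<nu>) (x i)) k (\<lambda>l. D $$ (k, l)))"
proof -
  let ?y = "\<lambda>i. map_vec (trunc \<nu>) (x i)"
  have "(vec_l2 (?y i - D *\<^sub>v ?y (i - 1)))\<^sup>2 = (\<Sum>k<p. (?y i $ k - (\<Sum>l<p. D $$ (k, l) * ?y (i - 1) $ l))\<^sup>2)"
    if i: "i \<in> {1..int n}" for i
  proof -
    have "x i \<in> carrier_vec p" "x (i - 1) \<in> carrier_vec p" using i x by auto
    then have d: "dim_vec (x i) = p" "dim_vec (x (i - 1)) = p" by auto
    show ?thesis unfolding vec_l2_def using D d
      by (auto simp: sum_nonneg scalar_prod_def lessThan_atLeast0 intro!: sum.cong)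
  qed
  then have "(\<Sum>i\<in>{1..int n}. (vec_l2 (?y i - D *\<^sub>v ?y (i - 1)))\<^sup>2)
      = (\<Sum>i\<in>{1..int n}. \<Sum>k<p. (?y i $ k - (\<Sum>l<p. D $$ (k, l) * ?y (i - 1) $ l))\<^sup>2)" by simp
  also have "\<dots> = (\<Sum>k<p. \<Sum>i\<in>{1..int n}. (?y i $ k - (\<Sum>l<p. D $$ (k, l) * ?y (i - 1) $ l))\<^sup>2)" by (rule sum.swap)
  moreover have "mat_l1 D = (\<Sum>k<p. \<Sum>l<p. \<bar>D $$ (k, l)\<bar>)" unfolding mat_l1_def using D by simp
  ultimately show ?thesis unfolding lasso_objective_def row_objective_def
    by (simp add: sum.distrib sum_distrib_left)
qed

text \<open>Compare the minimiser with the matrix in which row k alone is replaced by that of A: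
  squared error and penalty are both sums over rows, so all the other rows cancel.\<close>

lemma is_lasso_row_objective_le:
  assumes x: "\<And>i. i \<in> {0..int n} \<Longrightarrow> x i \<in> carrier_vec p" and A: "A \<in> carrier_mat p p" and k: "k < p"
    and lasso: "is_lasso n p \<nu> lam x Ahat"
  defines "y \<equiv> \<lambda>i. map_vec (trunc \<nu>) (x i)"
  shows "row_objective n p lam y k (\<lambda>l. Ahat $$ (k, l)) \<le> row_objective n p lam y k (\<lambda>l. A $$ (k, l))"
proof -
  have Ah: "Ahat \<in> carrier_mat p p"
    and min: "\<And>D. D \<in> carrier_mat p p \<Longrightarrow> lasso_objective n \<nu> lam x Ahat \<le> lasso_objective n \<nu> lam x D"
    using lasso unfolding is_lasso_def is_arg_min_linorder by auto
  let ?D = "replace_row Ahat A k"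
  have D: "?D \<in> carrier_mat p p" using Ah unfolding replace_row_def by simp
  have rows: "row_objective n p lam y i (\<lambda>l. ?D $$ (i, l)) =
      (if i = k then row_objective n p lam y k (\<lambda>l. A $$ (k, l)) else row_objective n p lam y i (\<lambda>l. Ahat $$ (i, l)))"
    if "i < p" for i
    using that Ah unfolding row_objective_def replace_row_def by (auto intro!: arg_cong2[where f="(+)"] arg_cong2[where f="(*)"] sum.cong)
  let ?f = "\<lambda>i. row_objective n p lam y i (\<lambda>l. Ahat $$ (i, l))"
  have "(\<Sum>i<p. ?f i) \<le> (\<Sum>i<p. row_objective n p lam y i (\<lambda>l. ?D $$ (i, l)))"
  proof -
    have e: "lasso_objective n \<nu> lam x E = (\<Sum>k<p. row_objective n p lam y k (\<lambda>l. E $$ (k, l)))"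
      if "E \<in> carrier_mat p p" for E
      unfolding y_def by (rule lasso_objective_rows[OF _ that]) (rule x)
    show ?thesis using min[OF D] unfolding e[OF Ah] e[OF D] .
  qed
  also have "\<dots> = (\<Sum>i<p. if i = k then row_objective n p lam y k (\<lambda>l. A $$ (k, l)) else ?f i)"
    using rows by (intro sum.cong) auto
  finally have "?f k + (\<Sum>i\<in>{..<p} - {k}. ?f i) \<le> row_objective n p lam y k (\<lambda>l. A $$ (k, l)) +
      (\<Sum>i\<in>{..<p} - {k}. if i = k then row_objective n p lam y k (\<lambda>l. A $$ (k, l)) else ?f i)"
    using k by (simp add: sum.remove[of "{..<p}" k])
  also have "(\<Sum>i\<in>{..<p} - {k}. if i = k then row_objective n p lam y k (\<lambda>l. A $$ (k, l)) else ?f i)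
      = (\<Sum>i\<in>{..<p} - {k}. ?f i)" by (intro sum.cong) auto
  finally show ?thesis by simp
qed

text \<open>The row bounds assembled: the l-infinity norm takes the largest row support, the
  Frobenius norm adds the squared errors and so meets the total support.\<close>

lemma lasso_bounds:
  fixes Q :: "nat \<Rightarrow> nat \<Rightarrow> real"
  assumes x: "\<And>i. i \<in> {0..int n} \<Longrightarrow> x i \<in> carrier_vec p" and A: "A \<in> carrier_mat p p" and p: "0 < p" and n: "0 < n"
    and lasso: "is_lasso n p \<nu> lam x Ahat"
    and Q: "\<And>d. (\<Sum>l<p. (d l)\<^sup>2) \<le> (\<Sum>j<p. \<Sum>l<p. d j * d l * Q j l)"
    and emp0: "\<And>j l. j < p \<Longrightarrow> l < p \<Longrightarrow>
      \<bar>(1 / real n) * (\<Sum>i\<in>{1..int n}. trunc \<nu> (x (i - 1) $ j) * trunc \<nu> (x (i - 1) $ l)) - Q j l\<bar> \<le> \<delta>"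
    and emp1: "\<And>j k. j < p \<Longrightarrow> k < p \<Longrightarrow>
      \<bar>(1 / real n) * (\<Sum>i\<in>{1..int n}. trunc \<nu> (x (i - 1) $ j) * trunc \<nu> (x i $ k)) - (\<Sum>l<p. A $$ (k, l) * Q j l)\<bar> \<le> \<delta>"
    and lam: "0 < lam" "4 * \<delta> * (mat_linf A + 1) \<le> lam" and \<delta>: "0 \<le> \<delta>" "32 * real (max_supp A) * \<delta> \<le> 1"
  shows "mat_linf (Ahat - A) \<le> 12 * lam * real (max_supp A)"
    and "mat_frob (Ahat - A) \<le> 3 * lam * sqrt (real (total_supp A))"
proof -
  let ?y = "\<lambda>i. map_vec (trunc \<nu>) (x i)"
  have Ah: "Ahat \<in> carrier_mat p p" using lasso unfolding is_lasso_def is_arg_min_linorder by auto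
  have dx: "dim_vec (x i) = p" "dim_vec (x (i - 1)) = p" if i: "i \<in> {1..int n}" for i
  proof -
    have "x i \<in> carrier_vec p" "x (i - 1) \<in> carrier_vec p" using i x by auto
    then show "dim_vec (x i) = p" "dim_vec (x (i - 1)) = p" by auto
  qed
  have supp_le: "row_supp A k \<le> max_supp A" if "k < p" for k
    unfolding max_supp_def using that A by (intro Max_ge) auto
  have supp: "row_supp A k = card {l. l < p \<and> A $$ (k, l) \<noteq> 0}" for k
    unfolding row_supp_def using A by auto
  have linf: "(\<Sum>l<p. \<bar>A $$ (k, l)\<bar>) \<le> mat_linf A" if "k < p" for k
    unfolding mat_linf_def using that A by (intro Max_ge) auto
  have row: "(\<Sum>l<p. \<bar>Ahat $$ (k, l) - A $$ (k, l)\<bar>) \<le> 12 * lam * real (row_supp A k)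
      \<and> (\<Sum>l<p. (Ahat $$ (k, l) - A $$ (k, l))\<^sup>2) \<le> 9 * lam\<^sup>2 * real (row_supp A k)" if k: "k < p" for k
  proof -
    let ?z = "\<lambda>i l. trunc \<nu> (x (i - 1) $ l)" and ?r = "\<lambda>i. trunc \<nu> (x i $ k)"
    have obj: "row_objective n p lam ?y k b = (1 / real n) * (\<Sum>i\<in>{1..int n}. (?r i - (\<Sum>l<p. b l * ?z i l))\<^sup>2) + lam * (\<Sum>l<p. \<bar>b l\<bar>)" for b
      unfolding row_objective_def using dx k by (auto intro!: arg_cong2[where f="(+)"] arg_cong2[where f="(*)"] sum.cong)
    have score: "\<bar>(1 / real n) * (\<Sum>i\<in>{1..int n}. ?z i j * (?r i - (\<Sum>m<p. A $$ (k, m) * ?z i m)))\<bar> \<le> lam / 4" if j: "j < p" for j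
    proof -
      let ?E0 = "\<lambda>l. (1 / real n) * (\<Sum>i\<in>{1..int n}. ?z i j * ?z i l)"
      let ?E1 = "(1 / real n) * (\<Sum>i\<in>{1..int n}. ?z i j * ?r i)"
      have "(\<Sum>i\<in>{1..int n}. ?z i j * (\<Sum>m<p. A $$ (k, m) * ?z i m)) = (\<Sum>m<p. \<Sum>i\<in>{1..int n}. A $$ (k, m) * (?z i j * ?z i m))"
        by (subst sum.swap) (simp add: sum_distrib_left mult_ac)
      then have eq: "(1 / real n) * (\<Sum>i\<in>{1..int n}. ?z i j * (?r i - (\<Sum>m<p. A $$ (k, m) * ?z i m))) = ?E1 - (\<Sum>m<p. A $$ (k, m) * ?E0 m)"
        by (simp add: right_diff_distrib sum_subtractf sum_distrib_left mult_ac diff_divide_distrib)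
      \<comment> \<open>The score is centred at the Yule-Walker equation. What remains is one lag-1
        deviation and a row of A applied to lag-0 deviations, at most \<open>\<delta>\<close> (1 +
        |A|_inf).\<close>
      have "?E1 - (\<Sum>m<p. A $$ (k, m) * ?E0 m) = (?E1 - (\<Sum>m<p. A $$ (k, m) * Q j m)) - (\<Sum>m<p. A $$ (k, m) * (?E0 m - Q j m))"
        by (simp add: right_diff_distrib sum_subtractf)
      also have "\<bar>\<dots>\<bar> \<le> \<delta> + (\<Sum>m<p. \<bar>A $$ (k, m)\<bar>) * \<delta>"
      proof -
        have "\<bar>\<Sum>m<p. A $$ (k, m) * (?E0 m - Q j m)\<bar> \<le> (\<Sum>m<p. \<bar>A $$ (k, m)\<bar> * \<delta>)"
        proof (rule order_trans[OF sum_abs], rule sum_mono)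
          fix m assume "m \<in> {..<p}"
          then show "\<bar>A $$ (k, m) * (?E0 m - Q j m)\<bar> \<le> \<bar>A $$ (k, m)\<bar> * \<delta>"
            unfolding abs_mult using emp0[OF j, of m] by (intro mult_left_mono) auto
        qed
        then have "\<bar>\<Sum>m<p. A $$ (k, m) * (?E0 m - Q j m)\<bar> \<le> (\<Sum>m<p. \<bar>A $$ (k, m)\<bar>) * \<delta>" unfolding sum_distrib_right .
        then show ?thesis using emp1[OF j k] by linarith
      qed
      also have "\<dots> \<le> \<delta> + mat_linf A * \<delta>" using linf[OF k] \<delta> by (intro add_left_mono mult_right_mono) auto
      also have "\<dots> \<le> lam / 4" using lam by (simp add: algebra_simps)
      finally show ?thesis unfolding eq .
    qed
    have sd: "32 * real (card {l. l < p \<and> A $$ (k, l) \<noteq> 0}) * \<delta> \<le> 1"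
    proof -
      have "32 * real (row_supp A k) * \<delta> \<le> 32 * real (max_supp A) * \<delta>"
        using supp_le[OF k] \<delta> by (intro mult_right_mono) auto
      then show ?thesis using \<delta> unfolding supp by linarith
    qed
    note opt = is_lasso_row_objective_le[OF x A k lasso, unfolded obj]
    note bounds = lasso_row_bound[where I="{1..int n}" and n="real n" and r="?r" and z="?z" and p=p and lam=lam
        and b="\<lambda>l. A $$ (k, l)" and bh="\<lambda>l. Ahat $$ (k, l)" and Q=Q and \<delta>=\<delta>, OF _ _ opt Q emp0 score lam(1) \<delta>(1) sd]
    show ?thesis using bounds n unfolding supp by simp
  qed
  have dims: "dim_row (Ahat - A) = p" "dim_col (Ahat - A) = p" using A Ah by auto
  have entry: "(Ahat - A) $$ (k, l) = Ahat $$ (k, l) - A $$ (k, l)" if "k < p" "l < p" for k l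
    using that A Ah by simp
  show "mat_linf (Ahat - A) \<le> 12 * lam * real (max_supp A)"
    unfolding mat_linf_def dims
  proof (rule Max.boundedI)
    show "(\<lambda>i. \<Sum>j<p. \<bar>(Ahat - A) $$ (i, j)\<bar>) ` {..<p} \<noteq> {}" using p by auto
    fix t assume "t \<in> (\<lambda>i. \<Sum>j<p. \<bar>(Ahat - A) $$ (i, j)\<bar>) ` {..<p}"
    then obtain k where k: "k < p" and t: "t = (\<Sum>j<p. \<bar>(Ahat - A) $$ (k, j)\<bar>)" by auto
    have "t = (\<Sum>l<p. \<bar>Ahat $$ (k, l) - A $$ (k, l)\<bar>)" unfolding t using entry[OF k] by (intro sum.cong) auto
    also have "\<dots> \<le> 12 * lam * real (row_supp A k)" using row[OF k] by simp
    also have "\<dots> \<le> 12 * lam * real (max_supp A)" using supp_le[OF k] lam by (intro mult_left_mono) auto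
    finally show "t \<le> 12 * lam * real (max_supp A)" .
  qed simp
  have "(\<Sum>i<p. \<Sum>j<p. ((Ahat - A) $$ (i, j))\<^sup>2) = (\<Sum>k<p. \<Sum>l<p. (Ahat $$ (k, l) - A $$ (k, l))\<^sup>2)"
    using entry by (intro sum.cong) auto
  also have "\<dots> \<le> (\<Sum>k<p. 9 * lam\<^sup>2 * real (row_supp A k))" using row by (intro sum_mono) auto
  also have "\<dots> = (3 * lam)\<^sup>2 * real (total_supp A)"
    unfolding total_supp_def using A by (simp add: sum_distrib_left power_mult_distrib)
  finally have "mat_frob (Ahat - A) \<le> sqrt ((3 * lam)\<^sup>2 * real (total_supp A))"
    unfolding mat_frob_def dims by (rule real_sqrt_le_mono)
  then show "mat_frob (Ahat - A) \<le> 3 * lam * sqrt (real (total_supp A))"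
    using lam by (simp add: real_sqrt_mult)
qed

section \<open>High-probability bounds\<close>

context var_process
begin

lemma emp_tail:
  assumes j: "j < p" and k: "k < p" and \<nu>: "0 < \<nu>" and n: "1 \<le> n" "\<tau> \<le> real n"
    and \<theta>: "0 \<le> \<theta>" "4 * exp 1 * \<theta> * \<nu>\<^sup>2 * \<tau> \<le> 1 - \<rho>\<^sub>0"
  shows "prob {\<omega> \<in> space M. t \<le> \<bar>emp n \<nu> h j k \<omega> - trunc_mean \<nu> h j k\<bar>}
    \<le> 2 * exp (variance_const mom \<rho>\<^sub>0 * (real n * (\<theta> * \<tau> * \<gamma> * \<nu>)\<^sup>2) - \<theta> * (real n * t))"
proof -
  let ?b = "exp (variance_const mom \<rho>\<^sub>0 * (real n * (\<theta> * \<tau> * \<gamma> * \<nu>)\<^sup>2) - \<theta> * (real n * t))"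
  let ?E = "\<lambda>\<sigma>. {\<omega> \<in> space M. t \<le> \<sigma> * (emp n \<nu> h j k \<omega> - trunc_mean \<nu> h j k)}"
  have [measurable]: "emp n \<nu> h j k \<in> borel_measurable M" by (rule emp_measurable[OF j k])
  have E: "?E \<sigma> \<in> sets M" for \<sigma> by measurable
  have "{\<omega> \<in> space M. t \<le> \<bar>emp n \<nu> h j k \<omega> - trunc_mean \<nu> h j k\<bar>} \<subseteq> ?E 1 \<union> ?E (- 1)"
    by (auto simp: abs_if split: if_splits)
  then have "prob {\<omega> \<in> space M. t \<le> \<bar>emp n \<nu> h j k \<omega> - trunc_mean \<nu> h j k\<bar>} \<le> prob (?E 1 \<union> ?E (- 1))"
    using E by (intro finite_measure_mono) auto
  also have "\<dots> \<le> prob (?E 1) + prob (?E (- 1))" by (rule measure_Un_le[OF E E])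
  also have "\<dots> \<le> ?b + ?b"
    using emp_upper_tail[OF j k \<nu> n \<theta>, of 1] emp_upper_tail[OF j k \<nu> n \<theta>, of "- 1"] by (intro add_mono) auto
  finally show ?thesis by simp
qed

lemma union_bound:
  assumes tail: "\<And>h j k. j < p \<Longrightarrow> k < p \<Longrightarrow>
      prob {\<omega> \<in> space M. t \<le> \<bar>emp n \<nu> h j k \<omega> - trunc_mean \<nu> h j k\<bar>} \<le> b"
  defines "E \<equiv> {\<omega> \<in> space M. \<forall>h. \<forall>j<p. \<forall>k<p. \<bar>emp n \<nu> h j k \<omega> - trunc_mean \<nu> h j k\<bar> < t}"
  shows "E \<in> sets M" "1 - 2 * (real p)\<^sup>2 * b \<le> prob E"
proof -
  define F where "F = (\<lambda>z :: bool \<times> nat \<times> nat. {\<omega> \<in> space M. t \<le> \<bar>emp n \<nu> (fst z) (fst (snd z)) (snd (snd z)) \<omega>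
    - trunc_mean \<nu> (fst z) (fst (snd z)) (snd (snd z))\<bar>})"
  let ?I = "(UNIV :: bool set) \<times> {..<p} \<times> {..<p}"
  have F: "F z \<in> sets M" if "z \<in> ?I" for z
  proof -
    have [measurable]: "emp n \<nu> (fst z) (fst (snd z)) (snd (snd z)) \<in> borel_measurable M"
      using that by (intro emp_measurable) auto
    show ?thesis unfolding F_def by measurable
  qed
  have U: "(\<Union>z\<in>?I. F z) \<in> sets M" using F by (intro sets.finite_UN) auto
  have "\<omega> \<in> E \<longleftrightarrow> \<omega> \<in> space M \<and> (\<forall>z\<in>?I. \<omega> \<notin> F z)" for \<omega>
    unfolding E_def F_def by (auto simp: not_le)
  then have eq: "E = space M - (\<Union>z\<in>?I. F z)" by blast
  show "E \<in> sets M" unfolding eq using U by auto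
  have "prob (\<Union>z\<in>?I. F z) \<le> (\<Sum>z\<in>?I. prob (F z))"
    using F by (intro finite_measure_subadditive_finite) auto
  also have "\<dots> \<le> (\<Sum>z\<in>?I. b)" using tail unfolding F_def by (intro sum_mono) auto
  also have "\<dots> = 2 * (real p)\<^sup>2 * b" by (simp add: card_cartesian_product power2_eq_square)
  finally show "1 - 2 * (real p)\<^sup>2 * b \<le> prob E" unfolding eq using prob_compl[OF U] by simp
qed

end

text \<open>The condition on \<theta> has a factor 4 e, the square of \<nu> \<le> 2 \<mu> W a factor
  4, and \<mu> L / \<gamma> \<le> 1 + c_0 gives the last one; their product with this constant is 1
  - \<rho>_0.\<close>

definition exponent_const :: "real \<Rightarrow> real \<Rightarrow> real" where
  "exponent_const c\<^sub>0 \<rho>\<^sub>0 = (1 - \<rho>\<^sub>0) / (16 * exp 1 * (1 + c\<^sub>0))"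

text \<open>The fraction is the multiple at which the Chernoff exponent equals -3 ln p. Of the 5
  c_0, the bias uses 4 c_0; the case ln p > n needs all 5.\<close>

definition deviation_const :: "real \<Rightarrow> real \<Rightarrow> real \<Rightarrow> real" where
  "deviation_const m \<rho>\<^sub>0 q = (let c\<^sub>0 = moment_const m \<rho>\<^sub>0 q; \<kappa> = exponent_const c\<^sub>0 \<rho>\<^sub>0 in
     (4 * variance_const m \<rho>\<^sub>0 * \<kappa>\<^sup>2 + 3) / \<kappa> + 5 * c\<^sub>0)"

context var_process
begin

lemma mu_le_moment_const: "\<mu> \<le> moment_const mom \<rho>\<^sub>0 q * (\<gamma> * \<tau>)"
  using mu_le unfolding moment_const_def by (simp add: mult_ac)

lemma moment_const_nonneg: "0 \<le> moment_const mom \<rho>\<^sub>0 q"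
  unfolding moment_const_def using rho0 by simp

lemma exponent_const_pos: "0 < exponent_const (moment_const mom \<rho>\<^sub>0 q) \<rho>\<^sub>0"
  unfolding exponent_const_def using rho0 moment_const_nonneg by (intro divide_pos_pos mult_pos_pos) auto

lemma variance_const_nonneg: "0 \<le> variance_const mom \<rho>\<^sub>0"
  unfolding variance_const_def using rho0 mom_ge_1 rosenthal_const_pos[of 2] by simp

lemma deviation_const_pos: "0 < deviation_const mom \<rho>\<^sub>0 q"
proof -
  have "0 \<le> 4 * variance_const mom \<rho>\<^sub>0 * (exponent_const (moment_const mom \<rho>\<^sub>0 q) \<rho>\<^sub>0)\<^sup>2"
    using variance_const_nonneg by (intro mult_nonneg_nonneg) auto
  then have "0 < 4 * variance_const mom \<rho>\<^sub>0 * (exponent_const (moment_const mom \<rho>\<^sub>0 q) \<rho>\<^sub>0)\<^sup>2 + 3"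
    by linarith
  from divide_pos_pos[OF this exponent_const_pos] show ?thesis
    unfolding deviation_const_def Let_def using moment_const_nonneg by linarith
qed

text \<open>Union bound over both lags and all pairs of coordinates, plus the truncation bias. The
  hypothesis \<open>small\<close> keeps \<theta> in the admissible range.\<close>

lemma good_event:
  fixes n :: nat and \<nu> :: real
  assumes p3: "3 \<le> p" and n: "1 \<le> n" "\<tau> \<le> real n"
  defines "L \<equiv> (ln (real p) / real n) powr ((q - 2) / (2 * q - 2))"
    and "W \<equiv> (real n / ln (real p)) powr (1 / (2 * q - 2))"
  assumes \<nu>: "\<mu> * W \<le> \<nu>" "\<nu> \<le> 2 * (\<mu> * W)"
    and small: "L \<le> 1 \<Longrightarrow> \<mu> * L \<le> (1 + moment_const mom \<rho>\<^sub>0 q) * \<gamma>"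
  obtains E where "E \<in> sets M" "1 - 8 * real p powr (- 1) \<le> prob E"
    "\<And>\<omega> h j k. \<omega> \<in> E \<Longrightarrow> j < p \<Longrightarrow> k < p \<Longrightarrow>
      \<bar>emp n \<nu> h j k \<omega> - true_mean h j k\<bar> \<le> deviation_const mom \<rho>\<^sub>0 q * (\<mu> * \<gamma> * \<tau> * L)"
proof -
  let ?c0 = "moment_const mom \<rho>\<^sub>0 q" and ?C = "variance_const mom \<rho>\<^sub>0"
  let ?\<kappa> = "exponent_const ?c0 \<rho>\<^sub>0"
  let ?P = "\<mu> * \<gamma> * \<tau> * L"
  define T where "T = (4 * ?C * ?\<kappa>\<^sup>2 + 3) / ?\<kappa>"
  have dev: "deviation_const mom \<rho>\<^sub>0 q = T + 5 * ?c0" unfolding deviation_const_def T_def Let_def by simp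
  have lnp: "1 \<le> ln (real p)"
  proof -
    have "exp 1 \<le> real p" using p3 exp_le by linarith
    then show ?thesis using p3 by (subst ln_ge_iff) auto
  qed
  have n0: "0 < real n" using n by simp
  have mu: "1 \<le> \<mu>" by (rule mu_ge_1)
  have g: "1 \<le> \<gamma>" by (rule \<gamma>_ge)
  have t: "1 \<le> \<tau>" by (rule \<tau>_ge_1)
  have L0: "0 < L" unfolding L_def using lnp n0 by simp
  have W0: "0 < W" unfolding W_def using lnp n0 by simp
  have \<nu>0: "0 < \<nu>" using \<nu>(1) W0 mu by (smt (verit) mult_pos_pos)
  have P0: "0 < ?P" using L0 mu g t by (intro mult_pos_pos) auto
  have T0: "0 \<le> T" unfolding T_def using exponent_const_pos variance_const_nonneg by (intro divide_nonneg_pos) auto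
  have mu2: "\<mu>\<^sup>2 \<le> ?c0 * (\<mu> * \<gamma> * \<tau>)"
    using mult_left_mono[OF mu_le_moment_const, of \<mu>] mu by (simp add: power2_eq_square mult_ac)
  have mu2L: "\<mu>\<^sup>2 * L \<le> ?c0 * ?P"
    using mult_right_mono[OF mu2, of L] L0 by (simp add: mult_ac)
  \<comment> \<open>The balance behind the rate: the truncation level is tuned so that
    \<open>\<nu>\<close>^2 ln p has the order \<open>\<mu>\<close>^2 n L^2.\<close>
  have W2: "W\<^sup>2 * ln (real p) = real n * L\<^sup>2"
  proof -
    define r where "r = real n / ln (real p)"
    have r: "0 < r" unfolding r_def using lnp n0 by simp
    have Lr: "L = r powr (- ((q - 2) / (2 * q - 2)))"
    proof -
      have "ln (real p) / real n = inverse r" unfolding r_def by simp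
      then show ?thesis unfolding L_def using r by (simp add: powr_minus inverse_powr)
    qed
    have sq: "(r powr y)\<^sup>2 = r powr (2 * y)" for y unfolding power2_eq_square powr_add[symmetric] by simp
    have W2: "W\<^sup>2 = r powr (2 / (2 * q - 2))" unfolding W_def r_def[symmetric] sq by simp
    have "L\<^sup>2 = r powr (2 * (- ((q - 2) / (2 * q - 2))))" unfolding Lr by (rule sq)
    also have "2 * (- ((q - 2) / (2 * q - 2))) = 2 / (2 * q - 2) - 1" using q by (simp add: field_simps)
    finally have "L\<^sup>2 = W\<^sup>2 / r" unfolding W2 using r by (simp add: powr_diff)
    then show ?thesis unfolding r_def using lnp n0 by (simp add: field_simps)
  qed
  show ?thesis
  proof (cases "ln (real p) \<le> real n")
    \<comment> \<open>If \<open>A = 0\<close>, the sparsity assumption (B2) is void and \<open>ln p\<close> may exceed \<open>n\<close>; the bound then holds surely.\<close>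
    case False
    have W1: "W \<le> 1"
    proof -
      have "W \<le> 1 powr (1 / (2 * q - 2))" unfolding W_def using False n0 q by (intro powr_mono2) auto
      then show ?thesis by simp
    qed
    have L1: "1 \<le> L" unfolding L_def using False n0 q by (intro ge_one_powr_ge_zero) auto
    have \<nu>2: "\<nu> \<le> 2 * \<mu>"
    proof -
      have "\<mu> * W \<le> \<mu> * 1" using W1 mu by (intro mult_left_mono) auto
      then show ?thesis using \<nu>(2) by simp
    qed
    have bound: "\<bar>emp n \<nu> h j k \<omega> - true_mean h j k\<bar> \<le> deviation_const mom \<rho>\<^sub>0 q * ?P" if jk: "j < p" "k < p" for h j k \<omega>
    proof -
      have "\<bar>\<Sum>i\<in>{1..int n}. trunc \<nu> (X (i - 1) \<omega> $ j) * trunc \<nu> (X (i - 1 + later h) \<omega> $ k)\<bar> \<le> (\<Sum>i\<in>{1..int n}. \<nu> * \<nu>)"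
        by (rule order_trans[OF sum_abs], rule sum_mono) (use \<nu>0 in \<open>auto simp: abs_mult intro!: mult_mono abs_trunc_le\<close>)
      then have "\<bar>emp n \<nu> h j k \<omega>\<bar> \<le> \<nu>\<^sup>2"
        unfolding emp_def abs_mult using n0 by (simp add: power2_eq_square field_simps)
      also have "\<dots> \<le> (2 * \<mu>)\<^sup>2" using \<nu>2 \<nu>0 by (intro power_mono) auto
      finally have "\<bar>emp n \<nu> h j k \<omega>\<bar> \<le> 4 * \<mu>\<^sup>2" by (simp add: power_mult_distrib)
      then have "\<bar>emp n \<nu> h j k \<omega> - true_mean h j k\<bar> \<le> 5 * \<mu>\<^sup>2" using abs_true_mean_le[OF jk, of h] by linarith
      also have "\<dots> \<le> 5 * (\<mu>\<^sup>2 * L)" using L1 mult_left_mono[OF L1, of "\<mu>\<^sup>2"] by simp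
      also have "\<dots> \<le> 5 * (?c0 * ?P)" using mu2L by simp
      also have "\<dots> \<le> deviation_const mom \<rho>\<^sub>0 q * ?P" unfolding dev distrib_right using T0 P0 by simp
      finally show ?thesis .
    qed
    have "1 - 8 * real p powr (- 1) \<le> prob (space M)" by (simp add: prob_space)
    then show ?thesis using bound by (intro that[of "space M"]) auto
  next
    case True
    have L1: "L \<le> 1"
    proof -
      have "L \<le> 1 powr ((q - 2) / (2 * q - 2))" unfolding L_def using True n0 lnp q by (intro powr_mono2) auto
      then show ?thesis by simp
    qed
    \<comment> \<open>This choice makes the linear part of the exponent a multiple of ln p. By
      \<open>W2\<close> the quadratic part is then at most a multiple of ln p as well, and \<theta>
      \<open>\<nu>\<close>^2 \<tau> stays bounded.\<close>
    define \<theta> where "\<theta> = ?\<kappa> * ln (real p) / (real n * ?P)"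
    have \<theta>0: "0 \<le> \<theta>"
      unfolding \<theta>_def using exponent_const_pos lnp by (intro divide_nonneg_pos mult_nonneg_nonneg mult_pos_pos[OF n0 P0]) auto
    have \<nu>sq: "\<nu>\<^sup>2 * ln (real p) \<le> 4 * \<mu>\<^sup>2 * (real n * L\<^sup>2)"
    proof -
      have "\<nu>\<^sup>2 \<le> (2 * (\<mu> * W))\<^sup>2" using \<nu>(2) \<nu>0 by (intro power_mono) auto
      then have "\<nu>\<^sup>2 * ln (real p) \<le> (2 * (\<mu> * W))\<^sup>2 * ln (real p)" using lnp by (intro mult_right_mono) auto
      also have "\<dots> = 4 * \<mu>\<^sup>2 * (W\<^sup>2 * ln (real p))" by (simp add: power_mult_distrib)
      finally show ?thesis unfolding W2 .
    qed
    have \<theta>nP: "\<theta> * (real n * ?P) = ?\<kappa> * ln (real p)" 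
    proof -
      have "y / z * z = y" if "0 < z" for y z :: real using that by simp
      from this[OF mult_pos_pos[OF n0 P0]] show ?thesis unfolding \<theta>_def .
    qed
    have nz: "\<mu> \<noteq> 0" "\<gamma> \<noteq> 0" "\<tau> \<noteq> 0" "L \<noteq> 0" "real n \<noteq> 0" using mu g t L0 n0 by auto
    have cond: "4 * exp 1 * \<theta> * \<nu>\<^sup>2 * \<tau> \<le> 1 - \<rho>\<^sub>0"
    proof -
      have "\<theta> * \<nu>\<^sup>2 * \<tau> = ?\<kappa> * (\<nu>\<^sup>2 * ln (real p)) * \<tau> / (real n * ?P)" unfolding \<theta>_def by simp
      also have "\<dots> \<le> ?\<kappa> * (4 * \<mu>\<^sup>2 * (real n * L\<^sup>2)) * \<tau> / (real n * ?P)"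
        using \<nu>sq exponent_const_pos t n0 P0 by (intro divide_right_mono mult_right_mono mult_left_mono) auto
      also have "\<dots> = 4 * ?\<kappa> * (\<mu> * L / \<gamma>)"
        using nz by (simp add: power2_eq_square field_simps)
      also have "\<dots> \<le> 4 * ?\<kappa> * (1 + ?c0)"
        using small[OF L1] exponent_const_pos g by (intro mult_left_mono) (auto simp: pos_divide_le_eq)
      finally have "4 * exp 1 * (\<theta> * \<nu>\<^sup>2 * \<tau>) \<le> 4 * exp 1 * (4 * ?\<kappa> * (1 + ?c0))" by (intro mult_left_mono) auto
      also have "\<dots> = 1 - \<rho>\<^sub>0" 
      proof -
        have "4 * E * (4 * (b / (16 * E * c)) * c) = b" if "E \<noteq> 0" "c \<noteq> 0" for E b c :: real using that by simp
        moreover have "1 + ?c0 \<noteq> 0" using moment_const_nonneg by linarith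
        ultimately show ?thesis unfolding exponent_const_def by simp
      qed
      finally show ?thesis by (simp add: mult.assoc)
    qed
    have quad: "real n * (\<theta> * \<tau> * \<gamma> * \<nu>)\<^sup>2 \<le> 4 * ?\<kappa>\<^sup>2 * ln (real p)"
    proof -
      have "real n * (\<theta> * \<tau> * \<gamma> * \<nu>)\<^sup>2 = ?\<kappa>\<^sup>2 * ln (real p) * (\<nu>\<^sup>2 * ln (real p)) / (real n * \<mu>\<^sup>2 * L\<^sup>2)"
        unfolding \<theta>_def using nz by (simp add: power2_eq_square field_simps)
      also have "\<dots> \<le> ?\<kappa>\<^sup>2 * ln (real p) * (4 * \<mu>\<^sup>2 * (real n * L\<^sup>2)) / (real n * \<mu>\<^sup>2 * L\<^sup>2)"
        using \<nu>sq lnp n0 by (intro divide_right_mono mult_left_mono) auto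
      also have "\<dots> = 4 * ?\<kappa>\<^sup>2 * ln (real p)" using nz by simp
      finally show ?thesis .
    qed
    \<comment> \<open>The constant T is defined to offset the quadratic part and leave 3 ln
      p.\<close>
    have expo: "?C * (real n * (\<theta> * \<tau> * \<gamma> * \<nu>)\<^sup>2) - \<theta> * (real n * (T * ?P)) \<le> - 3 * ln (real p)"
    proof -
      have "\<theta> * (real n * (T * ?P)) = T * (\<theta> * (real n * ?P))" by (simp only: mult_ac)
      also have "\<dots> = (T * ?\<kappa>) * ln (real p)" unfolding \<theta>nP by simp
      also have "T * ?\<kappa> = 4 * ?C * ?\<kappa>\<^sup>2 + 3" unfolding T_def using exponent_const_pos by simp
      finally have 1: "\<theta> * (real n * (T * ?P)) = ?C * (4 * ?\<kappa>\<^sup>2 * ln (real p)) + 3 * ln (real p)" by (simp add: algebra_simps)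
      have "?C * (real n * (\<theta> * \<tau> * \<gamma> * \<nu>)\<^sup>2) \<le> ?C * (4 * ?\<kappa>\<^sup>2 * ln (real p))"
        using quad variance_const_nonneg by (intro mult_left_mono) auto
      then show ?thesis unfolding 1 by simp
    qed
    have p0: "0 < real p" using p3 by simp
    have tail: "prob {\<omega> \<in> space M. T * ?P \<le> \<bar>emp n \<nu> h j k \<omega> - trunc_mean \<nu> h j k\<bar>} \<le> 2 * real p powr (- 3)"
      if "j < p" "k < p" for h j k
    proof -
      have "prob {\<omega> \<in> space M. T * ?P \<le> \<bar>emp n \<nu> h j k \<omega> - trunc_mean \<nu> h j k\<bar>} \<le>
          2 * exp (?C * (real n * (\<theta> * \<tau> * \<gamma> * \<nu>)\<^sup>2) - \<theta> * (real n * (T * ?P)))"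
        by (rule emp_tail[OF that \<nu>0 n \<theta>0 cond])
      also have "\<dots> \<le> 2 * exp (- 3 * ln (real p))" using expo by simp
      finally show ?thesis using p0 by (simp add: powr_def)
    qed
    let ?E = "{\<omega> \<in> space M. \<forall>h. \<forall>j<p. \<forall>k<p. \<bar>emp n \<nu> h j k \<omega> - trunc_mean \<nu> h j k\<bar> < T * ?P}"
    note E = union_bound[where t="T * ?P" and b="2 * real p powr (- 3)", OF tail]
    \<comment> \<open>About p^2 events of probability p^(-3) each leave p^(-1), the origin of the
      exponent c = 1.\<close>
    have "2 * (real p)\<^sup>2 * (2 * real p powr (- 3)) = 4 * (real p powr 2 * real p powr (- 3))" using p0 by simp
    also have "\<dots> = 4 * real p powr (- 1)" unfolding powr_add[symmetric] by simp
    also have "\<dots> \<le> 8 * real p powr (- 1)" by (rule mult_right_mono[OF _ powr_ge_zero]) simp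
    finally have pE: "1 - 8 * real p powr (- 1) \<le> prob ?E" using E(2) by linarith
    \<comment> \<open>The lower bound on \<open>\<nu>\<close> enters here through the negative power
      2 - q; since W^(2-q) = L, the bias is at most 4 \<mu>^2 L.\<close>
    have bias: "\<bar>trunc_mean \<nu> h j k - true_mean h j k\<bar> \<le> 4 * ?c0 * ?P" if "j < p" "k < p" for h j k
    proof -
      have "\<nu> powr (2 - q) \<le> (\<mu> * W) powr (2 - q)" using \<nu>(1) mu W0 q by (intro powr_mono2') auto
      also have "\<dots> = \<mu> powr (2 - q) * W powr (2 - q)" using mu W0 by (simp add: powr_mult)
      also have "W powr (2 - q) = L"
      proof -
        have "W powr (2 - q) = (real n / ln (real p)) powr (- ((q - 2) / (2 * q - 2)))"
          unfolding W_def powr_powr by (rule arg_cong[where f="\<lambda>z. _ powr z"]) (simp add: minus_divide_left)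
        also have "\<dots> = inverse (real n / ln (real p)) powr ((q - 2) / (2 * q - 2))"
          unfolding powr_minus by (rule inverse_powr[symmetric])
        also have "\<dots> = L" unfolding L_def by simp
        finally show ?thesis .
      qed
      finally have "4 * \<mu> powr q * \<nu> powr (2 - q) \<le> 4 * \<mu> powr q * (\<mu> powr (2 - q) * L)" by (intro mult_left_mono) auto
      also have "\<dots> = 4 * (\<mu> powr q * \<mu> powr (2 - q)) * L" by simp
      also have "\<mu> powr q * \<mu> powr (2 - q) = \<mu>\<^sup>2" unfolding powr_add[symmetric] using mu by simp
      also have "4 * \<mu>\<^sup>2 * L \<le> 4 * ?c0 * ?P" using mu2L by simp
      finally show ?thesis using bias_le[OF that \<nu>0, of h] by linarith
    qed
    have final: "\<bar>emp n \<nu> h j k \<omega> - true_mean h j k\<bar> \<le> deviation_const mom \<rho>\<^sub>0 q * ?P" if "\<omega> \<in> ?E" "j < p" "k < p" for \<omega> h j k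
    proof -
      have "\<bar>emp n \<nu> h j k \<omega> - trunc_mean \<nu> h j k\<bar> < T * ?P" using that by blast
      then have "\<bar>emp n \<nu> h j k \<omega> - true_mean h j k\<bar> \<le> T * ?P + 4 * ?c0 * ?P" using bias[OF that(2,3), of h] by linarith
      also have "\<dots> \<le> deviation_const mom \<rho>\<^sub>0 q * ?P"
        unfolding dev distrib_right using mult_nonneg_nonneg[OF moment_const_nonneg less_imp_le[OF P0]] by linarith
      finally show ?thesis .
    qed
    show ?thesis by (rule that[OF E(1) pE final])
  qed
qed

text \<open>Without support (B2) puts no constraint on \<mu> and L; this lemma supplies \<tau> = 1
  instead.\<close>

lemma zero_support:
  assumes "max_supp A = 0" shows "A = 0\<^sub>m p p" "\<tau> = 1"
proof -
  have "A $$ (i, k) = 0" if "i < p" "k < p" for i k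
  proof (rule ccontr)
    assume nz: "A $$ (i, k) \<noteq> 0"
    have "row_supp A i \<le> max_supp A" unfolding max_supp_def using that A_dim by (intro Max_ge) auto
    then have "{k. k < dim_col A \<and> A $$ (i, k) \<noteq> 0} = {}" using assms unfolding row_supp_def by simp
    then show False using nz that A_dim by auto
  qed
  then show "A = 0\<^sub>m p p" using A_dim by (intro eq_matI) auto
  then show "\<tau> = 1" unfolding \<tau>_def using tau_zero_mat[OF rho0(1) p_pos] by simp
qed

text \<open>Both norms are bounded on one event, for one fixed n; the asymptotic hypotheses appear
  only as the inequalities they imply for that n.\<close>

theorem lasso_high_probability:
  fixes n :: nat and \<nu> lam :: real
  assumes p3: "3 \<le> p" and n: "1 \<le> n" "tau \<rho>\<^sub>0 A \<le> n"
  defines "L \<equiv> (ln (real p) / real n) powr ((q - 2) / (2 * q - 2))"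
    and "W \<equiv> (real n / ln (real p)) powr (1 / (2 * q - 2))"
    and "P \<equiv> \<mu> * gam \<rho>\<^sub>0 A * real (tau \<rho>\<^sub>0 A)"
    and "K \<equiv> deviation_const mom \<rho>\<^sub>0 q"
  assumes \<nu>: "\<mu> * W \<le> \<nu>" "\<nu> \<le> 2 * (\<mu> * W)"
    and lam: "4 * K * (P * (mat_linf A + 1) * L) \<le> lam" "lam \<le> 8 * K * (P * (mat_linf A + 1) * L)"
    and sparse: "P * (real (max_supp A))\<^sup>2 * L \<le> 1" "P * (real (max_supp A))\<^sup>2 * L \<le> 1 / (32 * K)"
    and lasso: "\<And>\<omega>. \<omega> \<in> space M \<Longrightarrow> is_lasso n p \<nu> lam (\<lambda>i. X i \<omega>) (Ahat \<omega>)"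
  shows "with_prob_at_least M (1 - 8 * real p powr (- 1)) (\<lambda>\<omega>.
      mat_linf (Ahat \<omega> - A) \<le> 96 * K * (P * (mat_linf A + 1) * L) * real (max_supp A) \<and>
      mat_frob (Ahat \<omega> - A) \<le> 24 * K * (P * (mat_linf A + 1) * L) * sqrt (real (total_supp A)))"
proof -
  have P: "P = \<mu> * \<gamma> * \<tau>" unfolding P_def \<gamma>_def \<tau>_def ..
  have tn: "\<tau> \<le> real n" unfolding \<tau>_def using n by simp
  have lnp: "0 < ln (real p)" using p3 by simp
  have L0: "0 < L" unfolding L_def using lnp n by simp
  have mu: "1 \<le> \<mu>" by (rule mu_ge_1)
  have g: "1 \<le> \<gamma>" by (rule \<gamma>_ge)
  have t: "1 \<le> \<tau>" by (rule \<tau>_ge_1)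
  have P0: "0 < P" unfolding P using mu g t by (intro mult_pos_pos) auto
  have K0: "0 < K" unfolding K_def by (rule deviation_const_pos)
  \<comment> \<open>With non-empty support \<open>sparse\<close> gives \<open>P\<close> L \<le> 1,
    hence \<mu> L \<le> 1. With empty support L \<le> 1 and \<tau> = 1 reduce the claim to the bound
    on \<mu>.\<close>
  have small: "\<mu> * L \<le> (1 + moment_const mom \<rho>\<^sub>0 q) * \<gamma>" if L1: "L \<le> 1"
  proof (cases "max_supp A = 0")
    case True
    have "\<mu> * L \<le> \<mu> * 1" using L1 mu by (intro mult_left_mono) auto
    also have "\<dots> \<le> moment_const mom \<rho>\<^sub>0 q * \<gamma>" using mu_le_moment_const zero_support(2)[OF True] by simp
    also have "\<dots> \<le> (1 + moment_const mom \<rho>\<^sub>0 q) * \<gamma>" using g by (intro mult_right_mono) auto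
    finally show ?thesis .
  next
    case False
    have "1 * 1 \<le> \<gamma> * \<tau>" using g t by (intro mult_mono) auto
    then have "(\<mu> * L) * 1 \<le> (\<mu> * L) * (\<gamma> * \<tau>)" using mu L0 by (intro mult_left_mono) auto
    then have "\<mu> * L \<le> P * 1 * L" unfolding P by (simp add: mult_ac)
    also have "\<dots> \<le> P * (real (max_supp A))\<^sup>2 * L"
      using False P0 L0 by (intro mult_right_mono mult_left_mono one_le_power) auto
    also have "\<dots> \<le> 1 * 1" using sparse(1) by simp
    also have "\<dots> \<le> (1 + moment_const mom \<rho>\<^sub>0 q) * \<gamma>" using moment_const_nonneg g by (intro mult_mono) auto
    finally show ?thesis .
  qed
  obtain E where E: "E \<in> sets M" "1 - 8 * real p powr (- 1) \<le> prob E"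
    and dev: "\<And>\<omega> h j k. \<omega> \<in> E \<Longrightarrow> j < p \<Longrightarrow> k < p \<Longrightarrow> \<bar>emp n \<nu> h j k \<omega> - true_mean h j k\<bar> \<le> K * (\<mu> * \<gamma> * \<tau> * L)"
    using good_event[OF p3 n(1) tn \<nu>[unfolded W_def] small[unfolded L_def]] unfolding K_def L_def by blast
  define \<delta> where "\<delta> = K * (P * L)"
  have \<delta>0: "0 < \<delta>" unfolding \<delta>_def using K0 P0 L0 by simp
  have linf0: "0 \<le> mat_linf A"
  proof -
    have "(\<Sum>j<dim_col A. \<bar>A $$ (0, j)\<bar>) \<le> mat_linf A" unfolding mat_linf_def using A_dim p_pos by (intro Max_ge) auto
    moreover have "0 \<le> (\<Sum>j<dim_col A. \<bar>A $$ (0, j)\<bar>)" by (simp add: sum_nonneg)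
    ultimately show ?thesis by linarith
  qed
  have lam4: "4 * \<delta> * (mat_linf A + 1) \<le> lam" using lam(1) unfolding \<delta>_def by (simp add: mult_ac)
  have lam0: "0 < lam"
  proof -
    have "0 < 4 * \<delta> * (mat_linf A + 1)" using \<delta>0 linf0 by (intro mult_pos_pos) auto
    then show ?thesis using lam4 by linarith
  qed
  \<comment> \<open>The support size is a natural number, so it is at most its square, which is what
    \<open>sparse\<close> controls.\<close>
  have s32: "32 * real (max_supp A) * \<delta> \<le> 1"
  proof -
    have "real (max_supp A) \<le> (real (max_supp A))\<^sup>2"
      by (cases "max_supp A = 0") (auto simp: power2_eq_square)
    then have "\<delta> * real (max_supp A) \<le> \<delta> * (real (max_supp A))\<^sup>2" using \<delta>0 by (intro mult_left_mono) auto
    also have "\<dots> = K * (P * (real (max_supp A))\<^sup>2 * L)" unfolding \<delta>_def by (simp add: mult_ac)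
    also have "\<dots> \<le> K * (1 / (32 * K))" using sparse(2) K0 by (intro mult_left_mono) auto
    also have "\<dots> = 1 / 32" using K0 by simp
    finally show ?thesis by (simp add: mult.commute)
  qed
  have "mat_linf (Ahat \<omega> - A) \<le> 96 * K * (P * (mat_linf A + 1) * L) * real (max_supp A) \<and>
      mat_frob (Ahat \<omega> - A) \<le> 24 * K * (P * (mat_linf A + 1) * L) * sqrt (real (total_supp A))" if \<omega>E: "\<omega> \<in> E" for \<omega>
  proof -
    have \<omega>: "\<omega> \<in> space M" using \<omega>E E(1) sets.sets_into_space by blast
    have bounds: "mat_linf (Ahat \<omega> - A) \<le> 12 * lam * real (max_supp A)"
      "mat_frob (Ahat \<omega> - A) \<le> 3 * lam * sqrt (real (total_supp A))"
    proof (atomize(full), rule conjI)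
      have x: "X i \<omega> \<in> carrier_vec p" for i by (rule X_carrier[OF \<omega>])
      have e0: "\<bar>(1 / real n) * (\<Sum>i\<in>{1..int n}. trunc \<nu> (X (i - 1) \<omega> $ j) * trunc \<nu> (X (i - 1) \<omega> $ l)) - cov j l\<bar> \<le> \<delta>"
        if "j < p" "l < p" for j l
        using dev[OF \<omega>E that, of False] unfolding emp_def true_mean_def later_def cov_def \<delta>_def P by (simp add: mult_ac)
      have e1: "\<bar>(1 / real n) * (\<Sum>i\<in>{1..int n}. trunc \<nu> (X (i - 1) \<omega> $ j) * trunc \<nu> (X i \<omega> $ k)) - (\<Sum>l<p. A $$ (k, l) * cov j l)\<bar> \<le> \<delta>"
        if "j < p" "k < p" for j k
        using dev[OF \<omega>E that, of True] lag_cov[OF that] unfolding emp_def true_mean_def later_def a_def \<delta>_def P by (simp add: mult_ac)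
      have n0: "0 < n" using n by simp
      note b = lasso_bounds[where x="\<lambda>i. X i \<omega>" and Q=cov and \<delta>=\<delta>, OF x A_dim p_pos n0 lasso[OF \<omega>] cov_ge e0 e1 lam0 lam4 less_imp_le[OF \<delta>0] s32]
      show "mat_linf (Ahat \<omega> - A) \<le> 12 * lam * real (max_supp A)" by (rule b(1))
      show "mat_frob (Ahat \<omega> - A) \<le> 3 * lam * sqrt (real (total_supp A))" by (rule b(2))
    qed
    \<comment> \<open>Inserting lam \<le> 8 K (...) turns the deterministic 12 and 3 into 96 and
      24.\<close>
    have le: "12 * lam \<le> 96 * K * (P * (mat_linf A + 1) * L)" "3 * lam \<le> 24 * K * (P * (mat_linf A + 1) * L)"
      using lam(2) by linarith+
    show ?thesis
      using order_trans[OF bounds(1) mult_right_mono[OF le(1)]] order_trans[OF bounds(2) mult_right_mono[OF le(2)]] by simp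
  qed
  then show ?thesis unfolding with_prob_at_least_def using E by blast
qed

end

theorem theorem3p3:
  fixes M :: "'a measure"
    and \<epsilon> :: "int \<Rightarrow> nat \<Rightarrow> 'a \<Rightarrow> real"
    and p :: "nat \<Rightarrow> nat"
    and A :: "nat \<Rightarrow> real mat"
    and X :: "nat \<Rightarrow> int \<Rightarrow> 'a \<Rightarrow> real vec"
    and \<mu> :: "nat \<Rightarrow> real"
    and \<rho>\<^sub>0 q :: real
  assumes rho0: "0 < \<rho>\<^sub>0" "\<rho>\<^sub>0 < 1"
    and prob: "prob_space M"
    and innov_iid: "iid M \<epsilon>"
    and p_pos: "\<And>n. 1 \<le> n \<Longrightarrow> 1 \<le> p n"
    and p_lim: "filterlim p at_top sequentially"
    and A_dim: "\<And>n. 1 \<le> n \<Longrightarrow> A n \<in> carrier_mat (p n) (p n)"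
    and A_radius: "\<And>n. 1 \<le> n \<Longrightarrow> spectral_radius (map_mat complex_of_real (A n)) < 1"
    and tau_le: "\<And>n. 1 \<le> n \<Longrightarrow> tau \<rho>\<^sub>0 (A n) \<le> n"
    and VAR: "\<And>n. 1 \<le> n \<Longrightarrow> stationary_VAR1 M (p n) (A n) \<epsilon> (X n)"
    and B1_mean: "\<And>i j. (\<integral>\<omega>. \<epsilon> i j \<omega> \<partial>M) = 0"
    and B1_var: "\<And>i j. (\<integral>\<omega>. (\<epsilon> i j \<omega>)\<^sup>2 \<partial>M) = 1"
    and B1_q: "2 < q"
    and B1_moment: "\<And>n. 1 \<le> n \<Longrightarrow> max_coord_moment M q (p n) (X n) (\<mu> n)"
    and B2: "(\<lambda>n. \<mu> n * gam \<rho>\<^sub>0 (A n) * real (tau \<rho>\<^sub>0 (A n)) * (real (max_supp (A n)))\<^sup>2 *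
                  (ln (real (p n)) / real n) powr ((q - 2) / (2 * q - 2))) \<longlonglongrightarrow> 0"
  shows "\<exists>a_nu b_nu a_lam b_lam c C c' C'.
    0 < a_nu \<and> a_nu < b_nu \<and> 0 < a_lam \<and> a_lam < b_lam \<and> 0 < c \<and> 0 < C \<and> 0 < c' \<and> 0 < C' \<and>
    (\<forall>(\<nu> :: nat \<Rightarrow> real) (lam :: nat \<Rightarrow> real) (Ahat :: nat \<Rightarrow> 'a \<Rightarrow> real mat).
       asymp_between a_nu b_nu \<nu> (\<lambda>n. \<mu> n * (real n / ln (real (p n))) powr (1 / (2 * q - 2))) \<longrightarrow>
       asymp_between a_lam b_lam lam
         (\<lambda>n. \<mu> n * gam \<rho>\<^sub>0 (A n) * real (tau \<rho>\<^sub>0 (A n)) * (mat_linf (A n) + 1) *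
              (ln (real (p n)) / real n) powr ((q - 2) / (2 * q - 2))) \<longrightarrow>
       (\<forall>\<^sub>F n in sequentially. \<forall>\<omega>\<in>space M.
          is_lasso n (p n) (\<nu> n) (lam n) (\<lambda>i. X n i \<omega>) (Ahat n \<omega>)) \<longrightarrow>
       (\<forall>\<^sub>F n in sequentially.
          with_prob_at_least M (1 - 8 * real (p n) powr (- c)) (\<lambda>\<omega>.
            mat_linf (Ahat n \<omega> - A n)
              \<le> C * \<mu> n * gam \<rho>\<^sub>0 (A n) * real (tau \<rho>\<^sub>0 (A n)) * (mat_linf (A n) + 1) *
                real (max_supp (A n)) *
                (ln (real (p n)) / real n) powr (1 / 2 - 1 / (2 * q - 2)))) \<and>
       ((\<lambda>n. \<mu> n * gam \<rho>\<^sub>0 (A n) * real (tau \<rho>\<^sub>0 (A n)) * (real (total_supp (A n)))\<^sup>2 *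
             (ln (real (p n)) / real n) powr ((q - 2) / (2 * q - 2))) \<longlonglongrightarrow> 0 \<longrightarrow>
        (\<forall>\<^sub>F n in sequentially.
          with_prob_at_least M (1 - 8 * real (p n) powr (- c')) (\<lambda>\<omega>.
            mat_frob (Ahat n \<omega> - A n)
              \<le> C' * \<mu> n * gam \<rho>\<^sub>0 (A n) * real (tau \<rho>\<^sub>0 (A n)) * (mat_linf (A n) + 1) *
                sqrt (real (total_supp (A n))) *
                (ln (real (p n)) / real n) powr (1 / 2 - 1 / (2 * q - 2))))))"
proof -
  have proc: "var_process M \<epsilon> (p n) (A n) (X n) (\<mu> n) \<rho>\<^sub>0 q" if n: "1 \<le> n" for n
  proof -
    interpret prob_space M by (rule prob)
    show ?thesis
      by unfold_locales (use n rho0 innov_iid p_pos[OF n] A_dim A_radius VAR B1_mean B1_var B1_q B1_moment in auto)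
  qed
  \<comment> \<open>\<open>var_process.mom\<close> takes only M, \<epsilon> and q as arguments, so
    this one constant serves every n.\<close>
  define K where "K = deviation_const (var_process.mom M \<epsilon> q) \<rho>\<^sub>0 q"
  have K0: "0 < K" unfolding K_def by (rule var_process.deviation_const_pos[OF proc[OF order_refl]])
  define L where "L = (\<lambda>n. (ln (real (p n)) / real n) powr ((q - 2) / (2 * q - 2)))"
  define P where "P = (\<lambda>n. \<mu> n * gam \<rho>\<^sub>0 (A n) * real (tau \<rho>\<^sub>0 (A n)))"
  \<comment> \<open>The rate is written with two forms of the same exponent, one in the choice of
    the penalty and one in the error bounds.\<close>
  have exponent: "1 / 2 - 1 / (2 * q - 2) = (q - 2) / (2 * q - 2)" using B1_q by (simp add: field_simps)
  have lim: "(\<lambda>n. P n * (real (max_supp (A n)))\<^sup>2 * L n) \<longlonglongrightarrow> 0"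
    using B2 unfolding P_def L_def .
  have main: "\<forall>\<^sub>F n in sequentially. with_prob_at_least M (1 - 8 * real (p n) powr (- 1)) (\<lambda>\<omega>.
      mat_linf (Ahat n \<omega> - A n) \<le> 96 * K * (P n * (mat_linf (A n) + 1) * L n) * real (max_supp (A n)) \<and>
      mat_frob (Ahat n \<omega> - A n) \<le> 24 * K * (P n * (mat_linf (A n) + 1) * L n) * sqrt (real (total_supp (A n))))"
    if nu: "asymp_between 1 2 \<nu> (\<lambda>n. \<mu> n * (real n / ln (real (p n))) powr (1 / (2 * q - 2)))"
      and la: "asymp_between (4 * K) (8 * K) lam (\<lambda>n. \<mu> n * gam \<rho>\<^sub>0 (A n) * real (tau \<rho>\<^sub>0 (A n)) * (mat_linf (A n) + 1) *
              (ln (real (p n)) / real n) powr ((q - 2) / (2 * q - 2)))"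
      and lasso: "\<forall>\<^sub>F n in sequentially. \<forall>\<omega>\<in>space M. is_lasso n (p n) (\<nu> n) (lam n) (\<lambda>i. X n i \<omega>) (Ahat n \<omega>)"
    for \<nu> lam :: "nat \<Rightarrow> real" and Ahat :: "nat \<Rightarrow> 'a \<Rightarrow> real mat"
  proof -
    have "\<forall>\<^sub>F n in sequentially. 3 \<le> p n" using p_lim by (auto simp: filterlim_at_top)
    moreover have "\<forall>\<^sub>F n in sequentially. 1 \<le> n" by (rule eventually_ge_at_top)
    moreover have "\<forall>\<^sub>F n in sequentially. P n * (real (max_supp (A n)))\<^sup>2 * L n < 1"
      by (rule order_tendstoD(2)[OF lim]) simp
    moreover have "\<forall>\<^sub>F n in sequentially. P n * (real (max_supp (A n)))\<^sup>2 * L n < 1 / (32 * K)"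
      by (rule order_tendstoD(2)[OF lim]) (use K0 in simp)
    moreover note nu[unfolded asymp_between_def] la[unfolded asymp_between_def] lasso
    ultimately show ?thesis
    proof eventually_elim
      case (elim n)
      interpret var_process M \<epsilon> "p n" "A n" "X n" "\<mu> n" \<rho>\<^sub>0 q by (rule proc[OF elim(2)])
      show ?case
        unfolding K_def P_def L_def
      proof (rule lasso_high_probability[OF elim(1,2) tau_le[OF elim(2)], where \<nu>="\<nu> n" and lam="lam n"])
        show "\<mu> n * (real n / ln (real (p n))) powr (1 / (2 * q - 2)) \<le> \<nu> n"
          "\<nu> n \<le> 2 * (\<mu> n * (real n / ln (real (p n))) powr (1 / (2 * q - 2)))"
          using elim(5) by simp_all
      qed (use elim in \<open>auto simp: K_def P_def L_def mult.assoc less_imp_le\<close>)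
    qed
  qed
  have weaken: "with_prob_at_least M r Q" if "with_prob_at_least M r R" "\<And>\<omega>. R \<omega> \<Longrightarrow> Q \<omega>" for r R Q
    using that unfolding with_prob_at_least_def by blast
  show ?thesis
  \<comment> \<open>Truncation factors 1 and 2, penalty factors 4 K and 8 K, exponents 1 from the
    union bound, and the error constants 96 K and 24 K.\<close>
  proof (rule exI[of _ 1], rule exI[of _ 2], rule exI[of _ "4 * K"], rule exI[of _ "8 * K"], rule exI[of _ 1],
      rule exI[of _ "96 * K"], rule exI[of _ 1], rule exI[of _ "24 * K"], intro conjI allI impI)
    fix \<nu> lam :: "nat \<Rightarrow> real" and Ahat :: "nat \<Rightarrow> 'a \<Rightarrow> real mat"
    assume h: "asymp_between 1 2 \<nu> (\<lambda>n. \<mu> n * (real n / ln (real (p n))) powr (1 / (2 * q - 2)))"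
      "asymp_between (4 * K) (8 * K) lam (\<lambda>n. \<mu> n * gam \<rho>\<^sub>0 (A n) * real (tau \<rho>\<^sub>0 (A n)) * (mat_linf (A n) + 1) *
              (ln (real (p n)) / real n) powr ((q - 2) / (2 * q - 2)))"
      "\<forall>\<^sub>F n in sequentially. \<forall>\<omega>\<in>space M. is_lasso n (p n) (\<nu> n) (lam n) (\<lambda>i. X n i \<omega>) (Ahat n \<omega>)"
    show "\<forall>\<^sub>F n in sequentially. with_prob_at_least M (1 - 8 * real (p n) powr (- 1)) (\<lambda>\<omega>.
            mat_linf (Ahat n \<omega> - A n)
              \<le> 96 * K * \<mu> n * gam \<rho>\<^sub>0 (A n) * real (tau \<rho>\<^sub>0 (A n)) * (mat_linf (A n) + 1) *
                real (max_supp (A n)) * (ln (real (p n)) / real n) powr (1 / 2 - 1 / (2 * q - 2)))"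
      using main[OF h] unfolding exponent
      by (rule eventually_mono, elim weaken) (simp add: P_def L_def mult_ac)
    show "\<forall>\<^sub>F n in sequentially. with_prob_at_least M (1 - 8 * real (p n) powr (- 1)) (\<lambda>\<omega>.
            mat_frob (Ahat n \<omega> - A n)
              \<le> 24 * K * \<mu> n * gam \<rho>\<^sub>0 (A n) * real (tau \<rho>\<^sub>0 (A n)) * (mat_linf (A n) + 1) *
                sqrt (real (total_supp (A n))) * (ln (real (p n)) / real n) powr (1 / 2 - 1 / (2 * q - 2)))"
      using main[OF h] unfolding exponent
      by (rule eventually_mono, elim weaken) (simp add: P_def L_def mult_ac)
  qed (use K0 in auto)
qed

end
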